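(* Let $\mathbb{K}$ be a field, $S = \mathbb{K}[x_1,\ldots,x_n]$ and let $\mathfrak{I}$ be a monomial ideal in $S$. Then for all integers $i_1, i_2 \geq 0$ we have $$t_{i_1+i_2}(S/\mathfrak{I}) \leq t_{i_1}(S/\mathfrak{I}) + t_{i_2}(S/\mathfrak{I}).$$
   Context: $S$ is standard graded. The graded Betti numbers are $\beta_{ij}(S/\mathfrak{I}) = \dim_{\mathbb{K}} \mathrm{Tor}_i^S(S/\mathfrak{I},\mathbb{K})_j$. The maximal shift $t_i(S/\mathfrak{I})$ is the maximal $j$ such that $\beta_{ij}(S/\mathfrak{I}) \neq 0$; if $\beta_{ij}(S/\mathfrak{I}) = 0$ for all $j$, one sets $t_i(S/\mathfrak{I}) = 0$. *)

theory Defs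
  imports Complex_Main "HOL-Library.Poly_Mapping" "HOL-Library.Function_Algebras"
begin

text \<open>
  The polynomial ring over the field \<open>'k\<close> in the variables indexed by the finite type \<open>'n\<close>:
  finitely supported functions from exponent vectors to coefficients, with convolution as product.
\<close>

type_synonym ('n, 'k) mpoly = "('n \<Rightarrow>\<^sub>0 nat) \<Rightarrow>\<^sub>0 'k"

text \<open>
  Every polynomial ring is a module over itself via \<open>(*)\<close>, and the span of a set in that module is
  the ideal it generates. The set \<open>M\<close> may be empty, which gives the zero ideal.
\<close>

definition monomial_ideal :: "('n::finite, 'k::field) mpoly set \<Rightarrow> bool" where
  "monomial_ideal I \<longleftrightarrow>
     (\<exists>M :: ('n \<Rightarrow>\<^sub>0 nat) set. I = module.span (*) ((\<lambda>m. Poly_Mapping.single m 1) ` M))"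

definition total_degree :: "('n::finite \<Rightarrow>\<^sub>0 nat) \<Rightarrow> nat" where
  "total_degree m = (\<Sum>x\<in>UNIV. Poly_Mapping.lookup m x)"

text \<open>The zero polynomial is homogeneous of every degree and the only one of negative degree.\<close>

definition homogeneous :: "('n::finite, 'k::field) mpoly \<Rightarrow> int \<Rightarrow> bool" where
  "homogeneous p e \<longleftrightarrow> (\<forall>m\<in>Poly_Mapping.keys p. int (total_degree m) = e)"

text \<open>The free module of rank \<open>r\<close> over the ring \<open>'a\<close>, and the action of an \<open>r \<times> c\<close> matrix.\<close>

definition free_mod :: "nat \<Rightarrow> (nat \<Rightarrow> 'a::zero) set" where
  "free_mod r = {v. \<forall>k\<ge>r. v k = 0}"

definition mat_apply ::
  "nat \<Rightarrow> nat \<Rightarrow> (nat \<Rightarrow> nat \<Rightarrow> 'a::comm_ring_1) \<Rightarrow> (nat \<Rightarrow> 'a) \<Rightarrow> (nat \<Rightarrow> 'a)" where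
  "mat_apply r c A v = (\<lambda>k. if k < r then \<Sum>l<c. A k l * v l else 0)"

text \<open>
  Data of an augmented complex \<open>\<dots> \<rightarrow> F\<^sub>1 \<rightarrow> F\<^sub>0 \<rightarrow> S/I \<rightarrow> 0\<close> of finitely generated graded free
  modules. The module \<open>F\<^sub>i\<close> has basis \<open>e\<^sub>k\<close> for \<open>k < rank i\<close>, with \<open>e\<^sub>k\<close> in degree \<open>shift i k\<close>;
  \<open>bd i\<close> is the matrix of the map from \<open>F\<^bsub>i+1\<^esub>\<close> to \<open>F\<^sub>i\<close>; and \<open>aug k\<close> is a representative in \<open>S\<close> of
  the image of the \<open>k\<close>-th basis element of \<open>F\<^sub>0\<close> in \<open>S/I\<close>.
\<close>

record (overloaded) ('n, 'k) free_cpx =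
  rank :: "nat \<Rightarrow> nat"
  shift :: "nat \<Rightarrow> nat \<Rightarrow> int"
  bd :: "nat \<Rightarrow> nat \<Rightarrow> nat \<Rightarrow> ('n, 'k) mpoly"
  aug :: "nat \<Rightarrow> ('n, 'k) mpoly"

definition bd_map ::
  "('n::finite, 'k::field) free_cpx \<Rightarrow> nat \<Rightarrow> (nat \<Rightarrow> ('n, 'k) mpoly) \<Rightarrow> (nat \<Rightarrow> ('n, 'k) mpoly)" where
  "bd_map F i = mat_apply (rank F i) (rank F (Suc i)) (bd F i)"

definition aug_map ::
  "('n::finite, 'k::field) free_cpx \<Rightarrow> (nat \<Rightarrow> ('n, 'k) mpoly) \<Rightarrow> ('n, 'k) mpoly" where
  "aug_map F v = (\<Sum>k<rank F 0. aug F k * v k)"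

text \<open>
  Graded free resolutions of \<open>S/I\<close>: all maps are homogeneous of degree \<open>0\<close> and the augmented complex
  is exact. Exactness at \<open>S/I\<close> and at \<open>F\<^sub>0\<close> is expressed modulo \<open>I\<close>.
\<close>

definition graded_free_resolution ::
  "('n::finite, 'k::field) free_cpx \<Rightarrow> ('n, 'k) mpoly set \<Rightarrow> bool" where
  "graded_free_resolution F I \<longleftrightarrow>
     (\<forall>k<rank F 0. homogeneous (aug F k) (shift F 0 k)) \<and>
     (\<forall>i. \<forall>k<rank F i. \<forall>l<rank F (Suc i).
        homogeneous (bd F i k l) (shift F (Suc i) l - shift F i k)) \<and>
     (\<forall>p. \<exists>v\<in>free_mod (rank F 0). aug_map F v - p \<in> I) \<and>
     bd_map F 0 ` free_mod (rank F 1) = {v \<in> free_mod (rank F 0). aug_map F v \<in> I} \<and>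
     (\<forall>i. bd_map F (Suc i) ` free_mod (rank F (Suc (Suc i))) =
        {v \<in> free_mod (rank F (Suc i)). bd_map F i v = 0})"

text \<open>
  The complex \<open>F \<otimes>\<^sub>S K\<close>, where \<open>S\<close> acts on \<open>K\<close> through the constant coefficient: its \<open>i\<close>-th term is
  \<open>K\<close> to the power \<open>rank i\<close>, and its maps are the matrices of constant coefficients. These maps
  preserve the grading, because a homogeneous entry with nonzero constant coefficient has degree \<open>0\<close>.
\<close>

definition tensor_bd_map ::
  "('n::finite, 'k::field) free_cpx \<Rightarrow> nat \<Rightarrow> (nat \<Rightarrow> 'k) \<Rightarrow> (nat \<Rightarrow> 'k)" where
  "tensor_bd_map F i =
     mat_apply (rank F i) (rank F (Suc i)) (\<lambda>k l. Poly_Mapping.lookup (bd F i k l) 0)"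

definition tensor_piece :: "('n::finite, 'k::field) free_cpx \<Rightarrow> nat \<Rightarrow> int \<Rightarrow> (nat \<Rightarrow> 'k) set" where
  "tensor_piece F i j = {v \<in> free_mod (rank F i). \<forall>k. v k \<noteq> 0 \<longrightarrow> shift F i k = j}"

definition tor_cycles :: "('n::finite, 'k::field) free_cpx \<Rightarrow> nat \<Rightarrow> int \<Rightarrow> (nat \<Rightarrow> 'k) set" where
  "tor_cycles F i j =
     {v \<in> tensor_piece F i j. case i of 0 \<Rightarrow> True | Suc i' \<Rightarrow> tensor_bd_map F i' v = 0}"

definition tor_boundaries :: "('n::finite, 'k::field) free_cpx \<Rightarrow> nat \<Rightarrow> int \<Rightarrow> (nat \<Rightarrow> 'k) set" where
  "tor_boundaries F i j = tensor_bd_map F i ` tensor_piece F (Suc i) j"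

abbreviation kdim :: "(nat \<Rightarrow> 'k::field) set \<Rightarrow> nat" where
  "kdim \<equiv> vector_space.dim (\<lambda>c v. \<lambda>k. c * v k)"

text \<open>
  The dimension of the degree \<open>j\<close> part of the \<open>i\<close>-th homology of \<open>F \<otimes>\<^sub>S K\<close>. Both spaces are
  finite-dimensional and, for a resolution, the boundaries are contained in the cycles, so the
  difference does not truncate and is the dimension of the quotient.
\<close>

definition tor_dim :: "('n::finite, 'k::field) free_cpx \<Rightarrow> nat \<Rightarrow> int \<Rightarrow> nat" where
  "tor_dim F i j = kdim (tor_cycles F i j) - kdim (tor_boundaries F i j)"

text \<open>
  As usual, \<open>Tor\<^sub>i\<^sup>S(S/I, K)\<close> is computed from a chosen graded free resolution of \<open>S/I\<close>; up to
  isomorphism it does not depend on the choice.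
\<close>

definition betti :: "('n::finite, 'k::field) mpoly set \<Rightarrow> nat \<Rightarrow> int \<Rightarrow> nat" where
  "betti I i j = tor_dim (SOME F. graded_free_resolution F I) i j"

definition max_shift :: "('n::finite, 'k::field) mpoly set \<Rightarrow> nat \<Rightarrow> int" where
  "max_shift I i = (if \<forall>j. betti I i j = 0 then 0 else Max {j. betti I i j \<noteq> 0})"

end

theory Submission
  imports Defs
begin

text \<open>
  Let \<open>F\<close> be the minimal multigraded free resolution of \<open>S/I\<close>, with basis elements of multidegrees
  \<open>w\<close>. The Hadamard product \<open>F # F\<close>, whose part in multidegree \<open>u\<close> is \<open>F\<^sub>u \<otimes>\<^sub>K F\<^sub>u\<close>, is again free: the
  pair of basis elements \<open>p\<close> and \<open>q\<close> has as multidegree the least common multiple of those of \<open>p\<close> and \<open>q\<close>.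
  It is exact in positive homological degrees by the Kuenneth formula, so the two inclusions
  \<open>x \<mapsto> 1 \<otimes> x\<close> and \<open>x \<mapsto> x \<otimes> 1\<close> of \<open>F\<close> are homotopic through some \<open>s\<close>, and there is a product
  \<open>F # F \<rightarrow> F\<close> that sends \<open>1 \<otimes> x\<close> to \<open>x\<close>.

  Suppose that \<open>x\<close> is a basis element of \<open>F\<close> in homological degree \<open>a + b\<close> and multidegree \<open>m\<close>, and that no
  basis elements \<open>p\<close>, \<open>q\<close> of homological degrees \<open>a\<close>, \<open>b\<close> satisfy \<open>lcm (w p) (w q) = m\<close>. In multidegree \<open>m\<close>,
  and modulo smaller multidegrees, the double complex \<open>F # F\<close> then has a gap at position \<open>(a, b)\<close>. Since
  the boundary of \<open>s x\<close> is \<open>1 \<otimes> x - x \<otimes> 1\<close> there and the two terms lie on different sides of the gap, the part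
  of \<open>s x\<close> on the first side already has boundary \<open>1 \<otimes> x\<close>. Multiplying out, \<open>x\<close> is a boundary modulo
  smaller multidegrees, which contradicts minimality. Hence every multidegree in homological degree \<open>a + b\<close>
  is the least common multiple of one in degree \<open>a\<close> and one in degree \<open>b\<close>, and total degrees are subadditive.
\<close>

section \<open>Chains over a ring\<close>

abbreviation keys :: "('a \<Rightarrow>\<^sub>0 'b::zero) \<Rightarrow> 'a set" where
  "keys \<equiv> Poly_Mapping.keys"

abbreviation lookup :: "('a \<Rightarrow>\<^sub>0 'b::zero) \<Rightarrow> 'a \<Rightarrow> 'b" where
  "lookup \<equiv> Poly_Mapping.lookup"

text \<open>Elements of \<open>'b \<Rightarrow>\<^sub>0 'a\<close> are read as vectors of the free
  module with basis \<open>'b\<close>; this is the scalar action on them.\<close>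

definition scale :: "'a::comm_ring_1 \<Rightarrow> ('b \<Rightarrow>\<^sub>0 'a) \<Rightarrow> ('b \<Rightarrow>\<^sub>0 'a)" where
  "scale c = Poly_Mapping.map ((*) c)"

definition unit :: "'b \<Rightarrow> ('b \<Rightarrow>\<^sub>0 'a::comm_ring_1)" where
  "unit b = Poly_Mapping.single b 1"

text \<open>The linear extension of a map given on basis elements. Differentials, homotopies and
  chain maps are all stored by their values on a basis and applied through
  \<open>ext\<close>.\<close>

definition ext :: "('b \<Rightarrow> 'c \<Rightarrow>\<^sub>0 'a::comm_ring_1) \<Rightarrow> ('b \<Rightarrow>\<^sub>0 'a) \<Rightarrow> ('c \<Rightarrow>\<^sub>0 'a)" where
  "ext f v = (\<Sum>b\<in>keys v. scale (lookup v b) (f b))"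

lemma lookup_scale [simp]: "lookup (scale c v) b = c * lookup v b"
  unfolding scale_def by (auto simp: Poly_Mapping.map.rep_eq when_def)

lemma lookup_unit: "lookup (unit b) c = (if b = c then 1 else 0)"
  by (simp add: unit_def lookup_single when_def)

lemma keys_unit [simp]: "keys (unit b :: 'b \<Rightarrow>\<^sub>0 'a::comm_ring_1) = {b}"
  by (simp add: unit_def)

text \<open>Any finite superset of the support may index the sum, so that two vectors can be
  compared over one common index set.\<close>

lemma lookup_ext:
  assumes "finite S" "keys v \<subseteq> S"
  shows "lookup (ext f v) c =
    (\<Sum>b\<in>S. lookup v b * lookup (f b) c)"
proof -
  have "lookup (ext f v) c =
    (\<Sum>b\<in>keys v. lookup v b * lookup (f b) c)"
    by (simp add: ext_def lookup_sum)
  also have "\<dots> = (\<Sum>b\<in>S. lookup v b * lookup (f b) c)"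
    using assms by (intro sum.mono_neutral_left) (auto simp: in_keys_iff)
  finally show ?thesis .
qed

lemma keys_ext: "keys (ext f v) \<subseteq> (\<Union>b\<in>keys v. keys (f b))"
proof
  fix c assume "c \<in> keys (ext f v)"
  then have "(\<Sum>b\<in>keys v. lookup v b * lookup (f b) c) \<noteq> 0"
    by (simp add: in_keys_iff lookup_ext[OF finite_keys subset_refl])
  then obtain b where "b \<in> keys v"
    "lookup v b * lookup (f b) c \<noteq> 0"
    by (meson sum.not_neutral_contains_not_neutral)
  then show "c \<in> (\<Union>b\<in>keys v. keys (f b))"
    by (auto simp: in_keys_iff intro!: bexI[of _ b])
qed

lemma keys_ext_subset:
  assumes "\<And>b. b \<in> keys v \<Longrightarrow> keys (f b) \<subseteq> S"
  shows "keys (ext f v) \<subseteq> S"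
  using keys_ext[of f v] assms by blast

lemma keys_scale_subset: "keys (scale c v) \<subseteq> keys v"
  by (auto simp: in_keys_iff)

lemma ext_cong:
  assumes "\<And>b. b \<in> keys v \<Longrightarrow> f b = g b"
  shows "ext f v = ext g v"
  unfolding ext_def using assms by (intro sum.cong) auto

lemma ext_unit [simp]: "ext f (unit b) = f b"
  by (rule poly_mapping_eqI) (simp add: ext_def lookup_unit)

lemma ext_unit_self [simp]: "ext unit v = v"
proof (rule poly_mapping_eqI)
  fix c
  have "lookup (ext unit v) c =
      (\<Sum>b\<in>keys v. if b = c then lookup v b else 0)"
    unfolding lookup_ext[OF finite_keys subset_refl] by (intro sum.cong) (auto simp: lookup_unit)
  then show "lookup (ext unit v) c = lookup v c"
    by (simp add: in_keys_iff)
qed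

lemma ext_zero [simp]: "ext f 0 = 0"
  by (simp add: ext_def)

lemma ext_zero_fun [simp]: "ext (\<lambda>b. 0) v = 0"
  by (rule poly_mapping_eqI) (simp add: lookup_ext[OF finite_keys subset_refl])

lemma ext_add: "ext f (u + v) = ext f u + ext f v"
proof (rule poly_mapping_eqI)
  fix c
  let ?S = "keys u \<union> keys v"
  show "lookup (ext f (u + v)) c = lookup (ext f u + ext f v) c"
    using keys_add[of u v]
    by (simp add: lookup_ext[of ?S] lookup_add distrib_right sum.distrib)
qed

lemma ext_diff: "ext f (u - v) = ext f u - ext f v"
  using ext_add[of f "u - v" v] by (simp add: algebra_simps)

lemma ext_scale: "ext f (scale c v) = scale c (ext f v)"
proof (rule poly_mapping_eqI)
  fix d
  show "lookup (ext f (scale c v)) d = lookup (scale c (ext f v)) d"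
    using keys_scale_subset[of c v]
    by (simp add: lookup_ext[of "keys v"] sum_distrib_left mult.assoc)
qed

lemma ext_sum: "ext f (sum g A) = (\<Sum>x\<in>A. ext f (g x))"
  by (induction A rule: infinite_finite_induct) (auto simp: ext_add)

text \<open>Composition of linear extensions; in this form relations between maps can be checked on
  basis elements.\<close>

lemma ext_ext: "ext g (ext f v) = ext (\<lambda>b. ext g (f b)) v"
proof -
  have "ext g (ext f v) = (\<Sum>b\<in>keys v. ext g (scale (lookup v b) (f b)))"
    unfolding ext_def[of f] by (rule ext_sum)
  then show ?thesis by (simp add: ext_scale ext_def[of "\<lambda>b. ext g (f b)"])
qed

lemma scale_one [simp]: "scale 1 u = u"
  by (rule poly_mapping_eqI) simp

lemma scale_uminus: "scale (- c) u = - scale c u"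
  by (rule poly_mapping_eqI) simp

lemma scale_zero_right [simp]: "scale c 0 = 0"
  by (rule poly_mapping_eqI) simp

lemma ext_fun_add: "ext (\<lambda>b. f b + g b) v = ext f v + ext g v"
  by (rule poly_mapping_eqI)
    (simp add: lookup_ext[OF finite_keys subset_refl] lookup_add distrib_left sum.distrib)

lemma ext_fun_diff: "ext (\<lambda>b. f b - g b) v = ext f v - ext g v"
  by (rule poly_mapping_eqI)
    (simp add: lookup_ext[OF finite_keys subset_refl] lookup_minus right_diff_distrib sum_subtractf)

lemma ext_fun_scale: "ext (\<lambda>b. scale c (f b)) v = scale c (ext f v)"
  by (rule poly_mapping_eqI)
    (simp add: lookup_ext[OF finite_keys subset_refl] sum_distrib_left mult.left_commute)

section \<open>Tensor products of chains\<close>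

definition tens :: "('b \<Rightarrow>\<^sub>0 'a::comm_ring_1) \<Rightarrow> ('c \<Rightarrow>\<^sub>0 'a) \<Rightarrow> ('b \<times> 'c \<Rightarrow>\<^sub>0 'a)" where
  "tens u v = ext (\<lambda>b. ext (\<lambda>c. unit (b, c)) v) u"

lemma tens_unit_unit [simp]: "tens (unit b) (unit c) = unit (b, c)"
  by (simp add: tens_def)

lemma keys_tens: "keys (tens u v) \<subseteq> keys u \<times> keys v"
  unfolding tens_def by (intro keys_ext_subset) (auto dest!: subsetD[OF keys_ext])

lemma lookup_tens: "lookup (tens u v) (b, c) = lookup u b * lookup v c"
proof -
  have 1: "lookup (ext (\<lambda>c'. unit (b', c')) v) (b, c) =
      (if b' = b then lookup v c else 0)" for b'
  proof -
    have "lookup (ext (\<lambda>c'. unit (b', c')) v) (b, c) =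
      (\<Sum>c'\<in>keys v. if c' = c then (if b' = b then lookup v c' else 0) else 0)"
      unfolding lookup_ext[OF finite_keys subset_refl] by (intro sum.cong) (auto simp: lookup_unit)
    then show ?thesis by (auto simp: in_keys_iff)
  qed
  have "lookup (tens u v) (b, c) =
     (\<Sum>b'\<in>keys u. if b' = b then lookup u b' * lookup v c else 0)"
    unfolding tens_def lookup_ext[OF finite_keys[of u] subset_refl] 1 by (intro sum.cong) auto
  then show ?thesis by (auto simp: in_keys_iff)
qed

lemma tens_ext_left: "tens (ext f u) v = ext (\<lambda>b. tens (f b) v) u"
  by (simp add: tens_def ext_ext)

text \<open>\<open>tens\<close> extends over the left factor last, so linearity on the right does
  not follow from \<open>ext_ext\<close> directly and is checked on coefficients.\<close>

lemma tens_ext_right: "tens u (ext f v) = ext (\<lambda>c. tens u (f c)) v"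
proof (rule poly_mapping_eqI, clarify)
  fix b c
  show "lookup (tens u (ext f v)) (b, c) = lookup (ext (\<lambda>c. tens u (f c)) v) (b, c)"
    by (simp add: lookup_tens lookup_ext[OF finite_keys subset_refl] sum_distrib_left mult.left_commute)
qed

lemma tens_diff_left: "tens (u - u') v = tens u v - tens u' v"
  by (simp add: tens_def ext_diff)

lemma tens_zero [simp]: "tens 0 v = 0" "tens u 0 = 0"
  by (simp_all add: tens_def)

lemma tens_eq_ext: "tens u v = ext (\<lambda>b. tens (unit b) v) u"
  by (simp add: tens_def)

section \<open>Splitting the degrees of a minimal multigraded resolution\<close>

text \<open>
  In the last assumption the basis element \<open>b\<close> forces \<open>u\<close> into the monomial ideal, where the
  augmented complex is exact even in homological degree \<open>0\<close>.
\<close>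

locale multigraded_resolution =
  fixes B :: "'b set" and hdeg :: "'b \<Rightarrow> nat" and mdeg :: "'b \<Rightarrow> 'd::semilattice_sup"
    and bd :: "'b \<Rightarrow> ('b \<Rightarrow>\<^sub>0 'a::field)" and e :: 'b
  assumes e_in: "e \<in> B" and hdeg_e: "hdeg e = 0"
    and e_unique: "\<And>b. b \<in> B \<Longrightarrow> hdeg b = 0 \<Longrightarrow> b = e"
    and e_least: "\<And>b. b \<in> B \<Longrightarrow> mdeg e \<le> mdeg b"
    and keys_bd: "\<And>b c. b \<in> B \<Longrightarrow> c \<in> keys (bd b) \<Longrightarrow>
      c \<in> B \<and> hdeg b = Suc (hdeg c) \<and> mdeg c < mdeg b"
    and bd_bd: "\<And>b. b \<in> B \<Longrightarrow> ext bd (bd b) = 0"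
    and exact: "\<And>b u n v. b \<in> B \<Longrightarrow> 0 < hdeg b \<Longrightarrow> mdeg b \<le> u \<Longrightarrow>
      keys v \<subseteq> {c \<in> B. hdeg c = n \<and> mdeg c \<le> u} \<Longrightarrow> ext bd v = 0 \<Longrightarrow>
      \<exists>y. keys y \<subseteq> {c \<in> B. hdeg c = Suc n \<and> mdeg c \<le> u} \<and> ext bd y = v"
begin

text \<open>The strand of the resolution in multidegree \<open>u\<close>. A basis element of
  multidegree at most \<open>u\<close> has exactly one monomial multiple there, so the strand is the
  vector space on those basis elements.\<close>

definition chn :: "nat \<Rightarrow> 'd \<Rightarrow> ('b \<Rightarrow>\<^sub>0 'a) set" where
  "chn n u = {v. keys v \<subseteq> {c \<in> B. hdeg c = n \<and> mdeg c \<le> u}}"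

section \<open>The Hadamard product of the resolution with itself\<close>

definition tchn :: "nat \<Rightarrow> 'd \<Rightarrow> ('b \<times> 'b \<Rightarrow>\<^sub>0 'a) set" where
  "tchn n u = {t. keys t \<subseteq> {(b, c). b \<in> B \<and> c \<in> B \<and> hdeg b + hdeg c = n \<and> mdeg b \<le> u \<and> mdeg c \<le> u}}"

text \<open>The tensor product differential with the usual sign; on \<open>tchn\<close> it is the
  differential of the Hadamard product in multidegree \<open>u\<close>.\<close>

definition tbd :: "'b \<times> 'b \<Rightarrow> ('b \<times> 'b \<Rightarrow>\<^sub>0 'a)" where
  "tbd = (\<lambda>(b, c). tens (bd b) (unit c) + scale ((- 1) ^ hdeg b) (tens (unit b) (bd c)))"

lemma bd_e [simp]: "bd e = 0"
proof -
  have "keys (bd e) = {}" using keys_bd[OF e_in] hdeg_e by fastforce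
  then show ?thesis by simp
qed

lemma keys_tbd:
  assumes "b \<in> B" "c \<in> B" "(b', c') \<in> keys (tbd (b, c))"
  shows "b' \<in> B" "c' \<in> B"
    "hdeg b = Suc (hdeg b') \<and> mdeg b' < mdeg b \<and> c' = c \<or> b' = b \<and> hdeg c = Suc (hdeg c') \<and> mdeg c' < mdeg c"
proof -
  have "(b', c') \<in> keys (tens (bd b) (unit c :: 'b \<Rightarrow>\<^sub>0 'a)) \<union> keys (tens (unit b :: 'b \<Rightarrow>\<^sub>0 'a) (bd c))"
    using assms(3) subsetD[OF keys_add] keys_scale_subset
    unfolding tbd_def by (fastforce dest: subsetD[OF keys_add] subsetD[OF keys_scale_subset])
  then have "b' \<in> keys (bd b) \<and> c' = c \<or> b' = b \<and> c' \<in> keys (bd c)"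
    using keys_tens[of "bd b" "unit c :: 'b \<Rightarrow>\<^sub>0 'a"] keys_tens[of "unit b :: 'b \<Rightarrow>\<^sub>0 'a" "bd c"] by auto
  then show "b' \<in> B" "c' \<in> B"
    "hdeg b = Suc (hdeg b') \<and> mdeg b' < mdeg b \<and> c' = c \<or> b' = b \<and> hdeg c = Suc (hdeg c') \<and> mdeg c' < mdeg c"
    using keys_bd assms(1,2) by blast+
qed

text \<open>The Leibniz rule. With the left factor in a single homological degree, the sign is one
  scalar.\<close>

lemma ext_tbd_tens:
  assumes "keys u \<subseteq> {b. hdeg b = i}"
  shows "ext tbd (tens u v) = tens (ext bd u) v + scale ((- 1) ^ i) (tens u (ext bd v))"
proof -
  have 1: "ext (\<lambda>c. tbd (b, c)) v = tens (bd b) v + scale ((- 1) ^ i) (tens (unit b) (ext bd v))"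
    if "b \<in> keys u" for b
  proof -
    have "ext (\<lambda>c. tbd (b, c)) v =
        ext (\<lambda>c. tens (bd b) (unit c)) v + scale ((- 1) ^ i) (ext (\<lambda>c. tens (unit b) (bd c)) v)"
      using that assms by (auto simp: tbd_def ext_fun_add ext_fun_scale)
    then show ?thesis by (simp add: tens_ext_right[symmetric])
  qed
  have "ext tbd (tens u v) = ext (\<lambda>b. ext (\<lambda>c. tbd (b, c)) v) u"
    by (simp add: tens_def ext_ext)
  also have "\<dots> = ext (\<lambda>b. tens (bd b) v + scale ((- 1) ^ i) (tens (unit b) (ext bd v))) u"
    by (intro ext_cong 1)
  also have "\<dots> = tens (ext bd u) v + scale ((- 1) ^ i) (tens u (ext bd v))"
    by (simp add: ext_fun_add ext_fun_scale tens_ext_left flip: tens_eq_ext)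
  finally show ?thesis .
qed

text \<open>The two mixed terms carry opposite signs because \<open>bd b\<close> sits one degree
  below \<open>b\<close>. In degree 0, where there is no lower degree, \<open>b = e\<close> and
  \<open>bd e = 0\<close>.\<close>

lemma tbd_tbd:
  assumes "b \<in> B" "c \<in> B"
  shows "ext tbd (tbd (b, c)) = 0"
proof (cases "hdeg b")
  case 0
  then have [simp]: "b = e" using assms e_unique by auto
  have "ext tbd (tbd (b, c)) = ext tbd (tens (unit b) (bd c))"
    by (simp add: tbd_def hdeg_e)
  also have "\<dots> = 0"
    using assms by (subst ext_tbd_tens[of _ 0]) (auto simp: hdeg_e bd_bd)
  finally show ?thesis .
next
  case (Suc i)
  have k: "keys (bd b) \<subseteq> {b. hdeg b = i}" using keys_bd[OF assms(1)] Suc by auto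
  have "ext tbd (tbd (b, c)) =
      ext tbd (tens (bd b) (unit c)) + scale ((- 1) ^ Suc i) (ext tbd (tens (unit b) (bd c)))"
    by (simp add: tbd_def Suc ext_add ext_scale)
  also have "\<dots> = 0"
    using assms Suc k
    by (simp add: ext_tbd_tens[OF k] ext_tbd_tens[of "unit b" "Suc i"] bd_bd scale_uminus)
  finally show ?thesis .
qed

text \<open>Once \<open>u\<close> lies above the multidegree of a basis element of positive
  homological degree, \<open>exact\<close> applies to the strand in every homological degree. An
  exact strand of vector spaces is contractible: \<open>h\<close> is built by recursion on
  \<open>hdeg\<close> so that \<open>bd h + h bd\<close> is the identity.\<close>

lemma contraction:
  assumes "b0 \<in> B" "0 < hdeg b0" "mdeg b0 \<le> u"
  shows "\<exists>h. \<forall>b. b \<in> B \<and> mdeg b \<le> u \<longrightarrow>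
    h b \<in> chn (Suc (hdeg b)) u \<and> ext bd (h b) = unit b - ext h (bd b)"
proof (rule dependent_wf_choice[of "measure hdeg"])
  show "wf (measure hdeg)" by simp
next
  fix f g :: "'b \<Rightarrow> ('b \<Rightarrow>\<^sub>0 'a)" and b r
  assume *: "\<And>z. (z, b) \<in> measure hdeg \<Longrightarrow> f z = g z"
  have "b \<in> B \<Longrightarrow> ext f (bd b) = ext g (bd b)"
    by (intro ext_cong *) (use keys_bd in force)
  then show "(b \<in> B \<and> mdeg b \<le> u \<longrightarrow> r \<in> chn (Suc (hdeg b)) u \<and> ext bd r = unit b - ext f (bd b)) =
    (b \<in> B \<and> mdeg b \<le> u \<longrightarrow> r \<in> chn (Suc (hdeg b)) u \<and> ext bd r = unit b - ext g (bd b))"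
    by auto
next
  fix b and h :: "'b \<Rightarrow> ('b \<Rightarrow>\<^sub>0 'a)"
  assume IH: "\<And>c. (c, b) \<in> measure hdeg \<Longrightarrow>
    c \<in> B \<and> mdeg c \<le> u \<longrightarrow> h c \<in> chn (Suc (hdeg c)) u \<and> ext bd (h c) = unit c - ext h (bd c)"
  show "\<exists>r. b \<in> B \<and> mdeg b \<le> u \<longrightarrow> r \<in> chn (Suc (hdeg b)) u \<and> ext bd r = unit b - ext h (bd b)"
  proof (cases "b \<in> B \<and> mdeg b \<le> u")
    case b: True
    have c: "h c \<in> chn (hdeg b) u" "ext bd (h c) = unit c - ext h (bd c)" if "c \<in> keys (bd b)" for c
      using keys_bd[OF _ that] IH[of c] b by (auto intro: order_trans less_imp_le)
    \<comment> \<open>\<open>h b\<close> has to be a preimage of \<open>?v\<close>, so the point is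
      that \<open>?v\<close> is a cycle.\<close>
    let ?v = "unit b - ext h (bd b)"
    have "keys ?v \<subseteq> {c \<in> B. hdeg c = hdeg b \<and> mdeg c \<le> u}"
      using b c(1) by (intro order_trans[OF Poly_Mapping.keys_diff] Un_least keys_ext_subset) (auto simp: chn_def)
    moreover have "ext bd ?v = 0"
    proof -
      have "ext bd (ext h (bd b)) = ext (\<lambda>c. unit c - ext h (bd c)) (bd b)"
        unfolding ext_ext using c(2) by (intro ext_cong)
      also have "\<dots> = bd b"
        using bd_bd b by (simp add: ext_fun_diff ext_ext[symmetric])
      finally show ?thesis by (simp add: ext_diff)
    qed
    ultimately show ?thesis
      using exact[OF assms, of ?v "hdeg b"] by (auto simp: chn_def)
  qed auto
qed

lemma tens_exact:
  assumes "b0 \<in> B" "0 < hdeg b0" "mdeg b0 \<le> u" and t: "t \<in> tchn n u" "ext tbd t = 0"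
  shows "\<exists>y \<in> tchn (Suc n) u. ext tbd y = t"
proof -
  obtain h where h: "\<And>b. b \<in> B \<Longrightarrow> mdeg b \<le> u \<Longrightarrow> h b \<in> chn (Suc (hdeg b)) u"
    "\<And>b. b \<in> B \<Longrightarrow> mdeg b \<le> u \<Longrightarrow> ext bd (h b) = unit b - ext h (bd b)"
    using contraction[OF assms(1-3)] by blast
  define H :: "'b \<times> 'b \<Rightarrow> 'b \<times> 'b \<Rightarrow>\<^sub>0 'a" where "H = (\<lambda>(b, c). tens (h b) (unit c))"
  have H_tens: "ext H (tens x v) = tens (ext h x) v" for x v
  proof -
    have "ext H (tens x v) = ext (\<lambda>b. ext (\<lambda>c. tens (h b) (unit c)) v) x"
      by (simp add: tens_def[of x] ext_ext H_def)
    then show ?thesis by (simp add: tens_ext_left tens_ext_right[symmetric])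
  qed
  \<comment> \<open>The terms with \<open>bd c\<close> cancel: \<open>h b\<close> lies one degree
    above \<open>b\<close>, which flips the sign.\<close>
  have p: "ext tbd (H p) + ext H (tbd p) = unit p" if "p \<in> keys t" for p
  proof -
    obtain b c where [simp]: "p = (b, c)" by force
    have b: "b \<in> B" "mdeg b \<le> u" using that t by (auto simp: tchn_def)
    have k: "keys (h b) \<subseteq> {c. hdeg c = Suc (hdeg b)}" using h(1)[OF b] by (auto simp: chn_def)
    have "ext tbd (H p) = tens (unit b - ext h (bd b)) (unit c) + scale ((- 1) ^ Suc (hdeg b)) (tens (h b) (bd c))"
      by (simp add: H_def ext_tbd_tens[OF k] h(2)[OF b])
    moreover have "ext H (tbd p) = tens (ext h (bd b)) (unit c) + scale ((- 1) ^ hdeg b) (tens (h b) (bd c))"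
      by (simp add: tbd_def ext_add ext_scale H_tens)
    ultimately show ?thesis by (simp add: tens_diff_left scale_uminus)
  qed
  have "ext tbd (ext H t) = ext tbd (ext H t) + ext H (ext tbd t)"
    using t by simp
  also have "\<dots> = ext (\<lambda>p. ext tbd (H p) + ext H (tbd p)) t"
    by (simp add: ext_ext ext_fun_add)
  also have "\<dots> = ext unit t" by (intro ext_cong p)
  finally have "ext tbd (ext H t) = t" by simp
  moreover have "ext H t \<in> tchn (Suc n) u"
    unfolding tchn_def
  proof (intro CollectI keys_ext_subset)
    fix p assume "p \<in> keys t"
    then obtain b c where p: "p = (b, c)" "b \<in> B" "c \<in> B" "hdeg b + hdeg c = n" "mdeg b \<le> u" "mdeg c \<le> u"
      using t by (auto simp: tchn_def)
    show "keys (H p) \<subseteq> {(b, c). b \<in> B \<and> c \<in> B \<and> hdeg b + hdeg c = Suc n \<and> mdeg b \<le> u \<and> mdeg c \<le> u}"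
      using keys_tens[of "h b" "unit c :: 'b \<Rightarrow>\<^sub>0 'a"] h(1)[of b] p by (fastforce simp: H_def chn_def)
  qed
  ultimately show ?thesis by blast
qed

text \<open>The Hadamard product is exact in the multidegree of any \<open>b\<close> of positive
  homological degree. Hence \<open>s b\<close> is found by recursion on \<open>hdeg\<close>, as a
  preimage of what the homotopy equation leaves once \<open>s\<close> is known on
  \<open>bd b\<close>.\<close>

lemma homotopy_units:
  "\<exists>s. \<forall>b. b \<in> B \<longrightarrow> s b \<in> tchn (Suc (hdeg b)) (mdeg b) \<and>
    ext tbd (s b) = unit (e, b) - unit (b, e) - ext s (bd b)"
proof (rule dependent_wf_choice[of "measure hdeg"])
  show "wf (measure hdeg)" by simp
next
  fix f g :: "'b \<Rightarrow> ('b \<times> 'b \<Rightarrow>\<^sub>0 'a)" and b r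
  assume *: "\<And>z. (z, b) \<in> measure hdeg \<Longrightarrow> f z = g z"
  have "b \<in> B \<Longrightarrow> ext f (bd b) = ext g (bd b)"
    by (intro ext_cong *) (use keys_bd in force)
  then show "(b \<in> B \<longrightarrow> r \<in> tchn (Suc (hdeg b)) (mdeg b) \<and> ext tbd r = unit (e, b) - unit (b, e) - ext f (bd b)) =
    (b \<in> B \<longrightarrow> r \<in> tchn (Suc (hdeg b)) (mdeg b) \<and> ext tbd r = unit (e, b) - unit (b, e) - ext g (bd b))"
    by auto
next
  fix b and s :: "'b \<Rightarrow> ('b \<times> 'b \<Rightarrow>\<^sub>0 'a)"
  assume IH: "\<And>c. (c, b) \<in> measure hdeg \<Longrightarrow>
    c \<in> B \<longrightarrow> s c \<in> tchn (Suc (hdeg c)) (mdeg c) \<and> ext tbd (s c) = unit (e, c) - unit (c, e) - ext s (bd c)"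
  show "\<exists>r. b \<in> B \<longrightarrow> r \<in> tchn (Suc (hdeg b)) (mdeg b) \<and>
    ext tbd r = unit (e, b) - unit (b, e) - ext s (bd b)"
  proof (cases "b \<in> B \<and> 0 < hdeg b")
    case b: True
    have c: "c \<in> B" "mdeg c < mdeg b" "s c \<in> tchn (hdeg b) (mdeg c)"
       "ext tbd (s c) = unit (e, c) - unit (c, e) - ext s (bd c)" if "c \<in> keys (bd b)" for c
      using keys_bd[OF _ that] IH[of c] b by auto
    let ?t = "unit (e, b) - unit (b, e) - ext s (bd b)"
    have "keys (s c) \<subseteq> {(p, q). p \<in> B \<and> q \<in> B \<and> hdeg p + hdeg q = hdeg b \<and> mdeg p \<le> mdeg b \<and> mdeg q \<le> mdeg b}"
      if "c \<in> keys (bd b)" for c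
    proof -
      have le: "z \<le> mdeg b" if "z \<le> mdeg c" for z
        using that c(2)[OF \<open>c \<in> keys (bd b)\<close>] by (meson less_imp_le order_trans)
      show ?thesis using c(3)[OF that] le by (auto simp: tchn_def)
    qed
    then have "?t \<in> tchn (hdeg b) (mdeg b)"
      unfolding tchn_def using b e_in hdeg_e e_least
      by (intro CollectI order_trans[OF Poly_Mapping.keys_diff] Un_least keys_ext_subset) auto
    moreover have "ext tbd ?t = 0"
    proof -
      have "ext tbd (ext s (bd b)) = ext (\<lambda>c. unit (e, c) - unit (c, e) - ext s (bd c)) (bd b)"
        unfolding ext_ext using c by (intro ext_cong)
      also have "\<dots> = ext (\<lambda>c. unit (e, c)) (bd b) - ext (\<lambda>c. unit (c, e)) (bd b) - ext s (ext bd (bd b))"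
        by (simp add: ext_fun_diff ext_ext)
      also have "\<dots> = tens (unit e) (bd b) - tens (bd b) (unit e)"
        using bd_bd b by (simp add: tens_def)
      \<comment> \<open>Each of these boundaries has only one part because \<open>bd e = 0\<close>;
        they cancel against the boundary of the first two terms of \<open>?t\<close>.\<close>
      also have "\<dots> = tbd (e, b) - tbd (b, e)"
        by (simp add: tbd_def hdeg_e)
      finally show ?thesis by (simp add: ext_diff)
    qed
    ultimately show ?thesis
      using tens_exact[of b "mdeg b" ?t "hdeg b"] b by auto
  next
    case False
    \<comment> \<open>In degree 0 the two inclusions agree on \<open>e\<close>, so the homotopy may
      be 0.\<close>
    have "b = e" if "b \<in> B" using False that e_unique by simp
    then show ?thesis by (intro exI[of _ 0]) (auto simp: tchn_def)
  qed
qed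

text \<open>Recursion on the total homological degree. On pairs \<open>(e, c)\<close> the value is
  prescribed; on other pairs \<open>b\<close> has positive homological degree, so the strand in
  multidegree \<open>sup (mdeg b) (mdeg c)\<close> is exact and a preimage exists.\<close>

lemma product:
  "\<exists>m. \<forall>p. fst p \<in> B \<and> snd p \<in> B \<longrightarrow>
    m p \<in> chn (hdeg (fst p) + hdeg (snd p)) (sup (mdeg (fst p)) (mdeg (snd p))) \<and>
    ext bd (m p) = ext m (tbd p) \<and> (fst p = e \<longrightarrow> m p = unit (snd p))"
proof (rule dependent_wf_choice[of "measure (\<lambda>p. hdeg (fst p) + hdeg (snd p))"])
  show "wf (measure (\<lambda>p. hdeg (fst p) + hdeg (snd p)))" by simp
next
  fix f g :: "'b \<times> 'b \<Rightarrow> ('b \<Rightarrow>\<^sub>0 'a)" and p r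
  assume *: "\<And>z. (z, p) \<in> measure (\<lambda>p. hdeg (fst p) + hdeg (snd p)) \<Longrightarrow> f z = g z"
  have "fst p \<in> B \<and> snd p \<in> B \<Longrightarrow> ext f (tbd p) = ext g (tbd p)"
    by (intro ext_cong *) (use keys_tbd(3)[of "fst p" "snd p"] in fastforce)
  then show "(fst p \<in> B \<and> snd p \<in> B \<longrightarrow>
      r \<in> chn (hdeg (fst p) + hdeg (snd p)) (sup (mdeg (fst p)) (mdeg (snd p))) \<and>
      ext bd r = ext f (tbd p) \<and> (fst p = e \<longrightarrow> r = unit (snd p))) =
    (fst p \<in> B \<and> snd p \<in> B \<longrightarrow>
      r \<in> chn (hdeg (fst p) + hdeg (snd p)) (sup (mdeg (fst p)) (mdeg (snd p))) \<and>
      ext bd r = ext g (tbd p) \<and> (fst p = e \<longrightarrow> r = unit (snd p)))"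
    by auto
next
  fix p and m :: "'b \<times> 'b \<Rightarrow> ('b \<Rightarrow>\<^sub>0 'a)"
  assume IH: "\<And>q. (q, p) \<in> measure (\<lambda>p. hdeg (fst p) + hdeg (snd p)) \<Longrightarrow> fst q \<in> B \<and> snd q \<in> B \<longrightarrow>
    m q \<in> chn (hdeg (fst q) + hdeg (snd q)) (sup (mdeg (fst q)) (mdeg (snd q))) \<and>
    ext bd (m q) = ext m (tbd q) \<and> (fst q = e \<longrightarrow> m q = unit (snd q))"
  obtain b c where p: "p = (b, c)" by force
  have "\<exists>r. b \<in> B \<and> c \<in> B \<longrightarrow> r \<in> chn (hdeg b + hdeg c) (sup (mdeg b) (mdeg c)) \<and>
    ext bd r = ext m (tbd p) \<and> (b = e \<longrightarrow> r = unit c)"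
  proof (cases "b \<in> B \<and> c \<in> B")
    case bc: True
    have q: "m q \<in> chn (hdeg (fst q) + hdeg (snd q)) (sup (mdeg (fst q)) (mdeg (snd q)))"
      "ext bd (m q) = ext m (tbd q)" "fst q = e \<Longrightarrow> m q = unit (snd q)"
      "hdeg b + hdeg c = Suc (hdeg (fst q) + hdeg (snd q))"
      "sup (mdeg (fst q)) (mdeg (snd q)) \<le> sup (mdeg b) (mdeg c)"
      if "q \<in> keys (tbd p)" for q
    proof -
      obtain b' c' where [simp]: "q = (b', c')" by force
      note k = keys_tbd[of b c b' c']
      show 1: "hdeg b + hdeg c = Suc (hdeg (fst q) + hdeg (snd q))" using that bc k p by auto
      show "m q \<in> chn (hdeg (fst q) + hdeg (snd q)) (sup (mdeg (fst q)) (mdeg (snd q)))"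
        "ext bd (m q) = ext m (tbd q)" "fst q = e \<Longrightarrow> m q = unit (snd q)"
        using IH[of q] that bc k p 1 by auto
      show "sup (mdeg (fst q)) (mdeg (snd q)) \<le> sup (mdeg b) (mdeg c)"
        using that bc k p by (auto intro: le_supI1 le_supI2 less_imp_le)
    qed
    show ?thesis
    proof (cases "b = e")
      case True
      \<comment> \<open>The prescribed value is consistent: the boundary of \<open>(e, c)\<close>
        consists of pairs \<open>(e, c')\<close>, on which \<open>m\<close> already projects to the
        second factor.\<close>
      have "tbd p = tens (unit e) (bd c)" using True p by (simp add: tbd_def hdeg_e)
      then have tp: "tbd p = ext (\<lambda>c. unit (e, c)) (bd c)" by (simp add: tens_def)
      have "ext m (tbd p) = ext (\<lambda>c. m (e, c)) (bd c)" unfolding tp ext_ext by simp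
      also have "\<dots> = ext unit (bd c)"
      proof (rule ext_cong)
        fix c' assume c': "c' \<in> keys (bd c)"
        then have "c' \<in> B" "hdeg c = Suc (hdeg c')" using keys_bd bc by auto
        then show "m (e, c') = unit c'" using IH[of "(e, c')"] e_in p True by simp
      qed
      finally show ?thesis using True bc hdeg_e
        by (intro exI[of _ "unit c"]) (auto simp: chn_def)
    next
      case False
      \<comment> \<open>This makes \<open>hdeg b + hdeg c - 1\<close> a true predecessor.\<close>
      then have b: "0 < hdeg b" using bc e_unique by auto
      have "keys (ext m (tbd p)) \<subseteq> {d \<in> B. hdeg d = hdeg b + hdeg c - 1 \<and> mdeg d \<le> sup (mdeg b) (mdeg c)}"
      proof (rule keys_ext_subset)
        fix q assume "q \<in> keys (tbd p)"
        from q(1,4,5)[OF this] show "keys (m q) \<subseteq> {d \<in> B. hdeg d = hdeg b + hdeg c - 1 \<and> mdeg d \<le> sup (mdeg b) (mdeg c)}"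
          by (auto simp: chn_def intro: order_trans)
      qed
      moreover have "ext bd (ext m (tbd p)) = 0"
      proof -
        have "ext bd (ext m (tbd p)) = ext (\<lambda>q. ext m (tbd q)) (tbd p)"
          unfolding ext_ext using q by (intro ext_cong)
        also have "\<dots> = ext m (ext tbd (tbd p))" by (simp add: ext_ext)
        finally show ?thesis using tbd_tbd bc p by simp
      qed
      ultimately obtain y where "keys y \<subseteq> {d \<in> B. hdeg d = Suc (hdeg b + hdeg c - 1) \<and> mdeg d \<le> sup (mdeg b) (mdeg c)}"
        "ext bd y = ext m (tbd p)"
        using exact[of b "sup (mdeg b) (mdeg c)" "ext m (tbd p)" "hdeg b + hdeg c - 1"] bc b by auto
      then show ?thesis using False b by (auto simp: chn_def)
    qed
  qed auto
  then show "\<exists>r. fst p \<in> B \<and> snd p \<in> B \<longrightarrow>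
      r \<in> chn (hdeg (fst p) + hdeg (snd p)) (sup (mdeg (fst p)) (mdeg (snd p))) \<and>
      ext bd r = ext m (tbd p) \<and> (fst p = e \<longrightarrow> r = unit (snd p))"
    using p by simp
qed

theorem degree_splits:
  assumes x: "x \<in> B" "hdeg x = a + b" and "0 < a" "0 < b"
  shows "\<exists>p\<in>B. \<exists>q\<in>B. hdeg p = a \<and> hdeg q = b \<and> sup (mdeg p) (mdeg q) = mdeg x"
proof (rule ccontr)
  assume "\<not> ?thesis"
  then have gap: "sup (mdeg p) (mdeg q) \<noteq> mdeg x" if "p \<in> B" "q \<in> B" "hdeg p = a" "hdeg q = b" for p q
    using that by blast
  obtain s where s: "\<And>b. b \<in> B \<Longrightarrow> s b \<in> tchn (Suc (hdeg b)) (mdeg b)"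
    "\<And>b. b \<in> B \<Longrightarrow> ext tbd (s b) = unit (e, b) - unit (b, e) - ext s (bd b)"
    using homotopy_units by blast
  obtain m where m: "\<And>b c. b \<in> B \<Longrightarrow> c \<in> B \<Longrightarrow> m (b, c) \<in> chn (hdeg b + hdeg c) (sup (mdeg b) (mdeg c))"
    "\<And>b c. b \<in> B \<Longrightarrow> c \<in> B \<Longrightarrow> ext bd (m (b, c)) = ext m (tbd (b, c))"
    "\<And>c. c \<in> B \<Longrightarrow> m (e, c) = unit c"
    using product e_in by fastforce
  \<comment> \<open>\<open>s x\<close> has total degree \<open>a + b + 1\<close>. Boundaries of
    \<open>y\<close> have first degree at most \<open>a\<close>, those of \<open>y'\<close> at least
    \<open>a\<close>, so they meet only in position \<open>(a, b)\<close>, where \<open>gap\<close>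
    applies.\<close>
  define y where "y = ext (\<lambda>p. if hdeg (fst p) \<le> a then unit p else 0) (s x)"
  define y' where "y' = ext (\<lambda>p. if hdeg (fst p) \<le> a then 0 else unit p) (s x)"
  have sx: "keys (s x) \<subseteq> {(p, q). p \<in> B \<and> q \<in> B \<and> hdeg p + hdeg q = Suc (a + b) \<and> mdeg p \<le> mdeg x \<and> mdeg q \<le> mdeg x}"
    using s(1)[OF x(1)] x(2) by (simp add: tchn_def)
  have "y + y' = ext (\<lambda>p. (if hdeg (fst p) \<le> a then unit p else 0) + (if hdeg (fst p) \<le> a then 0 else unit p)) (s x)"
    unfolding y_def y'_def ext_fun_add ..
  also have "\<dots> = ext unit (s x)" by (intro ext_cong) auto
  finally have yy': "s x = y + y'" by simp
  have y_keys: "p \<in> B" "q \<in> B" "hdeg p + hdeg q = Suc (a + b)" "mdeg p \<le> mdeg x" "mdeg q \<le> mdeg x" "hdeg p \<le> a"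
    if "(p, q) \<in> keys y" for p q
  proof -
    have "keys y \<subseteq> {p \<in> keys (s x). hdeg (fst p) \<le> a}"
      unfolding y_def by (intro keys_ext_subset) auto
    then show "p \<in> B" "q \<in> B" "hdeg p + hdeg q = Suc (a + b)" "mdeg p \<le> mdeg x" "mdeg q \<le> mdeg x" "hdeg p \<le> a"
      using sx that by auto
  qed
  have y'_keys: "p \<in> B" "q \<in> B" "hdeg p > a" if "(p, q) \<in> keys y'" for p q
  proof -
    have "keys y' \<subseteq> {p \<in> keys (s x). \<not> hdeg (fst p) \<le> a}"
      unfolding y'_def by (intro keys_ext_subset) auto
    then show "p \<in> B" "q \<in> B" "hdeg p > a"
      using sx that by auto
  qed
  have Dy: "p \<in> B \<and> q \<in> B \<and> hdeg p + hdeg q = a + b \<and> hdeg p \<le> a \<and> mdeg p \<le> mdeg x \<and> mdeg q \<le> mdeg x"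
    if pq: "(p, q) \<in> keys (ext tbd y)" for p q
  proof -
    obtain p' q' where "(p', q') \<in> keys y" "(p, q) \<in> keys (tbd (p', q'))"
      using subsetD[OF keys_ext pq] by auto
    then show ?thesis using keys_tbd[of p' q' p q] y_keys[of p' q'] by auto
  qed
  have Dy': "hdeg p \<ge> a" if pq: "(p, q) \<in> keys (ext tbd y')" for p q
  proof -
    obtain p' q' where "(p', q') \<in> keys y'" "(p, q) \<in> keys (tbd (p', q'))"
      using subsetD[OF keys_ext pq] by auto
    then show ?thesis using keys_tbd[of p' q' p q] y'_keys[of p' q'] by auto
  qed
  \<comment> \<open>The error left when \<open>y\<close> is taken as a chain with boundary
    \<open>(e, x)\<close>; it lives in multidegrees strictly below that of \<open>x\<close>.\<close>
  define t where "t = unit (e, x) - ext tbd y"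
  have t: "p \<in> B \<and> q \<in> B \<and> sup (mdeg p) (mdeg q) < mdeg x" if pq: "(p, q) \<in> keys t" for p q
  proof (cases "hdeg p < a")
    case True
    \<comment> \<open>Below first degree \<open>a\<close> the boundary of \<open>y'\<close> is
      absent, so \<open>t\<close> can be computed from all of \<open>s x\<close>. The homotopy
      equation gives \<open>(x, e)\<close> plus \<open>s (bd x)\<close>; the first has first degree
      \<open>a + b\<close>, the second comes from multidegrees below \<open>mdeg x\<close>.\<close>
    have "lookup (ext tbd y') (p, q) = 0"
      using Dy'[of p q] True by (auto simp: in_keys_iff)
    then have "lookup t (p, q) = lookup (unit (e, x) - ext tbd (s x)) (p, q)"
      by (simp add: t_def yy' ext_add lookup_minus lookup_add)
    also have "\<dots> = lookup (unit (x, e) + ext s (bd x)) (p, q)"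
      by (simp add: s(2)[OF x(1)] add.commute)
    also have "\<dots> = lookup (ext s (bd x)) (p, q)"
      using True x by (auto simp: lookup_add lookup_unit)
    finally have "(p, q) \<in> keys (ext s (bd x))" using pq by (simp add: in_keys_iff)
    from subsetD[OF keys_ext this] obtain z where z: "z \<in> keys (bd x)" "(p, q) \<in> keys (s z)" by blast
    then have "z \<in> B" "mdeg z < mdeg x" using keys_bd x by auto
    moreover have "p \<in> B \<and> q \<in> B \<and> sup (mdeg p) (mdeg q) \<le> mdeg z"
      using z s(1)[OF \<open>z \<in> B\<close>] by (auto simp: tchn_def)
    ultimately show ?thesis by (meson le_less_trans)
  next
    case False
    \<comment> \<open>The pair comes from the boundary of \<open>y\<close>, where the first degree
      is at most \<open>a\<close>, hence exactly \<open>a\<close>.\<close>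
    then have "(p, q) \<noteq> (e, x)" using hdeg_e \<open>0 < a\<close> by auto
    then have "(p, q) \<in> keys (ext tbd y)" using pq by (auto simp: t_def in_keys_iff lookup_minus lookup_unit)
    from Dy[OF this] False gap[of p q] show ?thesis by (auto simp: less_le)
  qed
  have "ext m (ext tbd y) = ext bd (ext m y)"
    unfolding ext_ext
  proof (rule ext_cong)
    fix pq assume "pq \<in> keys y"
    then show "ext m (tbd pq) = ext bd (m pq)"
      using m(2)[of "fst pq" "snd pq"] y_keys(1,2)[of "fst pq" "snd pq"] by simp
  qed
  \<comment> \<open>Applying the product writes \<open>x\<close> as a sum of two chains that do not
    involve \<open>x\<close>: the first has too small multidegrees, the second is a boundary, and
    boundaries strictly lower the multidegree.\<close>
  then have eq: "unit x = ext m t + ext bd (ext m y)"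
    using m(3) x by (simp add: t_def ext_diff)
  have "x \<notin> keys (ext m t)"
  proof
    assume "x \<in> keys (ext m t)"
    from subsetD[OF keys_ext this] obtain p q where pq: "(p, q) \<in> keys t" "x \<in> keys (m (p, q))" by auto
    then have "mdeg x \<le> sup (mdeg p) (mdeg q)" using m(1)[of p q] t[of p q] by (auto simp: chn_def)
    then show False using t[OF pq(1)] by (meson leD)
  qed
  moreover have "x \<notin> keys (ext bd (ext m y))"
  proof
    assume "x \<in> keys (ext bd (ext m y))"
    from subsetD[OF keys_ext this] obtain z where z: "z \<in> keys (ext m y)" "x \<in> keys (bd z)" by auto
    from subsetD[OF keys_ext z(1)] obtain p q where pq: "(p, q) \<in> keys y" "z \<in> keys (m (p, q))" by auto
    then have "z \<in> B" "mdeg z \<le> sup (mdeg p) (mdeg q)"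
      using m(1)[of p q] y_keys(1,2)[of p q] by (auto simp: chn_def)
    moreover have "sup (mdeg p) (mdeg q) \<le> mdeg x" using y_keys pq by simp
    ultimately show False using keys_bd[OF _ z(2)] by (meson leD order_trans)
  qed
  ultimately have "lookup (unit x :: 'b \<Rightarrow>\<^sub>0 'a) x = 0"
    unfolding eq lookup_add by (simp add: in_keys_iff)
  then show False by (simp add: lookup_unit)
qed

end

section \<open>Homogeneous polynomials and monomial ideals\<close>

lemma poly_sum_singles: "p = (\<Sum>m\<in>keys p. Poly_Mapping.single m (lookup p m))"
proof (rule poly_mapping_eqI)
  fix m
  have "lookup (\<Sum>m\<in>keys p. Poly_Mapping.single m (lookup p m)) m =
      (\<Sum>m'\<in>keys p. if m' = m then lookup p m' else 0)"
    unfolding lookup_sum by (intro sum.cong) (auto simp: lookup_single)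
  also have "\<dots> = lookup p m" by (simp add: in_keys_iff)
  finally show "lookup p m = lookup (\<Sum>m\<in>keys p. Poly_Mapping.single m (lookup p m)) m" by simp
qed

lemma mult_sum_singles:
  "p * q = (\<Sum>m\<in>keys p. \<Sum>m'\<in>keys q. Poly_Mapping.single (m + m') (lookup p m * lookup q m'))"
  by (subst poly_sum_singles[of p], subst poly_sum_singles[of q])
    (simp add: sum_product mult_single)

lemma lookup_mult_single:
  "lookup (Poly_Mapping.single m c * p) (m + m') = c * lookup p m'"
  for p :: "('n \<Rightarrow>\<^sub>0 nat) \<Rightarrow>\<^sub>0 'k::field"
proof -
  have "lookup (Poly_Mapping.single m c * p) (m + m') =
      (\<Sum>m''\<in>keys p. if m'' = m' then c * lookup p m'' else 0)"
    by (subst poly_sum_singles[of p])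
      (auto simp: sum_distrib_left mult_single lookup_sum lookup_single when_def intro!: sum.cong)
  then show ?thesis by (simp add: in_keys_iff)
qed

text \<open>Two exponent vectors add up to zero only if both are zero.\<close>

lemma constant_coeff_mult:
  "lookup (p * q) 0 = lookup p 0 * lookup q 0" for p q :: "('n \<Rightarrow>\<^sub>0 nat) \<Rightarrow>\<^sub>0 'k::field"
proof -
  have z: "m + m' = 0 \<longleftrightarrow> m = 0 \<and> m' = 0" for m m' :: "'n \<Rightarrow>\<^sub>0 nat"
    by (auto simp: poly_mapping_eq_iff fun_eq_iff lookup_add)
  have "lookup (p * q) 0 = (\<Sum>m\<in>keys p. \<Sum>m'\<in>keys q. if m' = 0 then if m = 0 then lookup p m * lookup q m' else 0 else 0)"
    unfolding mult_sum_singles lookup_sum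
    by (intro sum.cong refl) (auto simp: lookup_single when_def z)
  also have "\<dots> = (\<Sum>m\<in>keys p. if m = 0 then lookup p m * lookup q 0 else 0)"
    by (intro sum.cong refl) (auto simp: in_keys_iff)
  also have "\<dots> = lookup p 0 * lookup q 0" by (auto simp: in_keys_iff)
  finally show ?thesis .
qed

lemma total_degree_zero [simp]: "total_degree 0 = 0"
  by (simp add: total_degree_def)

lemma total_degree_add: "total_degree (m + m') = total_degree m + total_degree m'"
  by (simp add: total_degree_def lookup_add sum.distrib)

lemma homogeneous_zero [simp]: "homogeneous 0 d"
  by (simp add: homogeneous_def)

lemma homogeneous_one [simp]: "homogeneous 1 0"
  by (simp add: homogeneous_def)

lemma homogeneous_diff: "homogeneous p d \<Longrightarrow> homogeneous q d \<Longrightarrow> homogeneous (p - q) d"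
  using Poly_Mapping.keys_diff[of p q] by (auto simp: homogeneous_def)

lemma homogeneous_sum:
  assumes "\<And>x. x \<in> A \<Longrightarrow> homogeneous (f x) d" shows "homogeneous (sum f A) d"
  using assms keys_sum[of f A] by (fastforce simp: homogeneous_def)

lemma homogeneous_mult: "homogeneous p d \<Longrightarrow> homogeneous q e \<Longrightarrow> homogeneous (p * q) (d + e)"
  using keys_mult[of p q] by (fastforce simp: homogeneous_def total_degree_add)

lemma homogeneous_constant_coeff: "homogeneous p d \<Longrightarrow> lookup p 0 \<noteq> 0 \<Longrightarrow> d = 0"
  unfolding homogeneous_def by (metis in_keys_iff of_nat_0 total_degree_zero)

text \<open>Degrees are integers because entries of graded matrices have differences of shifts as
  degrees; for negative \<open>d\<close> the component is 0.\<close>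

definition hpart :: "int \<Rightarrow> ('n::finite, 'k::field) mpoly \<Rightarrow> ('n, 'k) mpoly" where
  "hpart d p = (\<Sum>m\<in>keys p. if int (total_degree m) = d then Poly_Mapping.single m (lookup p m) else 0)"

lemma lookup_hpart: "lookup (hpart d p) m = (if int (total_degree m) = d then lookup p m else 0)"
proof -
  have "lookup (hpart d p) m =
      (\<Sum>m'\<in>keys p. if m' = m then (if int (total_degree m) = d then lookup p m else 0) else 0)"
    unfolding hpart_def lookup_sum by (intro sum.cong) (auto simp: lookup_single)
  then show ?thesis by (simp add: in_keys_iff)
qed

lemma homogeneous_hpart: "homogeneous (hpart d p) d"
  by (auto simp: homogeneous_def in_keys_iff lookup_hpart split: if_splits)

lemma hpart_homogeneous: "homogeneous p d \<Longrightarrow> hpart d p = p"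
  by (rule poly_mapping_eqI) (auto simp: lookup_hpart homogeneous_def in_keys_iff)

lemma hpart_zero [simp]: "hpart d 0 = 0"
  by (simp add: hpart_def)

lemma hpart_add: "hpart d (p + q) = hpart d p + hpart d q"
  by (rule poly_mapping_eqI) (simp add: lookup_hpart lookup_add)

lemma hpart_diff: "hpart d (p - q) = hpart d p - hpart d q"
  by (rule poly_mapping_eqI) (simp add: lookup_hpart lookup_minus)

lemma hpart_sum: "hpart d (sum f A) = (\<Sum>x\<in>A. hpart d (f x))"
  by (induction A rule: infinite_finite_induct) (auto simp: hpart_add)

lemma hpart_single:
  "hpart d (Poly_Mapping.single m c) = (if int (total_degree m) = d then Poly_Mapping.single m c else 0)"
  by (rule poly_mapping_eqI) (auto simp: lookup_hpart lookup_single when_def)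

text \<open>This lets homogeneous matrices act on components, so that preimages can be made
  homogeneous.\<close>

lemma hpart_mult:
  assumes "homogeneous q e"
  shows "hpart d (q * p) = q * hpart (d - e) p"
proof -
  have "hpart d (q * p) = (\<Sum>m\<in>keys q. \<Sum>m'\<in>keys p. Poly_Mapping.single m (lookup q m) *
      (if int (total_degree m') = d - e then Poly_Mapping.single m' (lookup p m') else 0))"
    unfolding mult_sum_singles hpart_sum
    using assms by (intro sum.cong refl)
      (auto simp: hpart_single total_degree_add homogeneous_def mult_single)
  also have "\<dots> = (\<Sum>m\<in>keys q. Poly_Mapping.single m (lookup q m)) * hpart (d - e) p"
    by (simp add: hpart_def sum_product)
  finally show ?thesis using poly_sum_singles[of q] by simp
qed

text \<open>Every monomial in a multiple of a generator is divisible by it, and conversely a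
  divisible monomial is a multiple; so membership is decided monomial by monomial. \<open>J\<close>
  consists of plain functions, whose pointwise order is divisibility and whose supremum is the least
  common multiple.\<close>

lemma monomial_idealE:
  fixes I :: "('n::finite, 'k::field) mpoly set"
  assumes "monomial_ideal I"
  obtains J :: "('n \<Rightarrow> nat) set" where "\<And>u v. u \<in> J \<Longrightarrow> u \<le> v \<Longrightarrow> v \<in> J"
    "\<And>p. p \<in> I \<longleftrightarrow> (\<forall>m\<in>keys p. lookup m \<in> J)"
proof -
  interpret M: module "(*) :: ('n, 'k) mpoly \<Rightarrow> _" by unfold_locales (simp_all add: algebra_simps)
  obtain M where I: "I = M.span ((\<lambda>m. Poly_Mapping.single m 1) ` M)"
    using assms by (auto simp: monomial_ideal_def)
  define J where "J = {u. \<exists>m\<in>M. lookup m \<le> u}"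
  have up: "v \<in> J" if "u \<in> J" "u \<le> v" for u v using that by (auto simp: J_def intro: order_trans)
  have "\<forall>m\<in>keys p. lookup m \<in> J" if "p \<in> I" for p
    using that unfolding I
  proof (induction rule: M.span_induct_alt)
    case base
    show ?case by simp
  next
    case (step c x y)
    then obtain m where m: "m \<in> M" "x = Poly_Mapping.single m 1" by auto
    show ?case
    proof
      fix k assume "k \<in> keys (c * x + y)"
      then have "k \<in> keys (c * x) \<or> k \<in> keys y" using keys_add[of "c * x" y] by blast
      then show "lookup k \<in> J"
      proof
        assume "k \<in> keys (c * x)"
        then obtain k' where "k = k' + m" using keys_mult[of c x] m(2) by fastforce
        then have "lookup m \<le> lookup k" by (simp add: le_fun_def lookup_add)
        then show ?thesis using m(1) by (auto simp: J_def)
      qed (use step.IH in auto)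
    qed
  qed
  moreover have "p \<in> I" if p: "\<forall>m\<in>keys p. lookup m \<in> J" for p
  proof -
    have "Poly_Mapping.single k (lookup p k) \<in> I" if "k \<in> keys p" for k
    proof -
      obtain m where m: "m \<in> M" "lookup m \<le> lookup k" using bspec[OF p \<open>k \<in> keys p\<close>] unfolding J_def by blast
      \<comment> \<open>The subtraction of exponents does not truncate because \<open>m\<close>
        divides \<open>k\<close>.\<close>
      have "k = (k - m) + m" using m(2)
        by (intro poly_mapping_eqI) (simp add: lookup_add lookup_minus le_fun_def)
      then have "Poly_Mapping.single k (lookup p k) = Poly_Mapping.single (k - m) (lookup p k) * Poly_Mapping.single m 1"
        by (simp add: mult_single)
      then show ?thesis using m(1) unfolding I by (auto intro: M.span_scale M.span_base)
    qed
    then have "(\<Sum>k\<in>keys p. Poly_Mapping.single k (lookup p k)) \<in> I"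
      unfolding I by (intro M.span_sum)
    then show ?thesis using poly_sum_singles[of p] by simp
  qed
  ultimately have "p \<in> I \<longleftrightarrow> (\<forall>m\<in>keys p. lookup m \<in> J)" for p by blast
  with up show ?thesis by (rule that)
qed

lemma monomial_ideal_sum:
  assumes "monomial_ideal I" "\<And>x. x \<in> A \<Longrightarrow> f x \<in> I"
  shows "sum f A \<in> I"
  using assms(1)
proof (rule monomial_idealE)
  fix J :: "('a \<Rightarrow> nat) set"
  assume J: "\<And>p. (p \<in> I) = (\<forall>m\<in>keys p. lookup m \<in> J)"
  show ?thesis unfolding J using assms(2) keys_sum[of f A] unfolding J by blast
qed

lemma monomial_ideal_diff:
  assumes "monomial_ideal I" "p \<in> I" "q \<in> I"
  shows "p - q \<in> I"
  using assms(1)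
proof (rule monomial_idealE)
  fix J :: "('a \<Rightarrow> nat) set"
  assume J: "\<And>p. (p \<in> I) = (\<forall>m\<in>keys p. lookup m \<in> J)"
  show ?thesis using assms(2,3) Poly_Mapping.keys_diff[of p q] unfolding J by blast
qed

lemma monomial_ideal_hpart:
  assumes "monomial_ideal I" "p \<in> I"
  shows "hpart d p \<in> I"
  using assms(1)
proof (rule monomial_idealE)
  fix J :: "('a \<Rightarrow> nat) set"
  assume J: "\<And>p. (p \<in> I) = (\<forall>m\<in>keys p. lookup m \<in> J)"
  have "keys (hpart d p) \<subseteq> keys p" by (auto simp: in_keys_iff lookup_hpart split: if_splits)
  then show ?thesis using assms(2) unfolding J by blast
qed

lemma monomial_ideal_mult:
  assumes "monomial_ideal I" "p \<in> I"
  shows "p * q \<in> I"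
  using assms(1)
proof (rule monomial_idealE)
  fix J :: "('a \<Rightarrow> nat) set"
  assume up: "\<And>u v. u \<in> J \<Longrightarrow> u \<le> v \<Longrightarrow> v \<in> J" and J: "\<And>p. (p \<in> I) = (\<forall>m\<in>keys p. lookup m \<in> J)"
  show ?thesis
    unfolding J
  proof
    fix k assume "k \<in> keys (p * q)"
    then obtain m m' where "k = m + m'" "m \<in> keys p" using keys_mult[of p q] by blast
    then show "lookup k \<in> J" using assms(2) up[of "lookup m" "lookup k"]
      unfolding J by (simp add: le_fun_def lookup_add)
  qed
qed

section \<open>Comparison of graded free resolutions\<close>

lemma mat_apply_in_free_mod [simp]: "mat_apply r c A v \<in> free_mod r"
  by (simp add: mat_apply_def free_mod_def)

lemma mat_apply_diff: "mat_apply r c A (u - v) = mat_apply r c A u - mat_apply r c A v"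
  by (simp add: mat_apply_def fun_eq_iff right_diff_distrib sum_subtractf)

lemma mat_apply_mat_apply:
  "mat_apply r m A (mat_apply m c B v) = mat_apply r c (\<lambda>k l. \<Sum>j<m. A k j * B j l) v"
proof
  fix k
  have "(\<Sum>j<m. A k j * (\<Sum>l<c. B j l * v l)) = (\<Sum>j<m. \<Sum>l<c. A k j * B j l * v l)"
    by (simp add: sum_distrib_left mult.assoc)
  also have "\<dots> = (\<Sum>l<c. (\<Sum>j<m. A k j * B j l) * v l)"
    by (subst sum.swap) (simp add: sum_distrib_right)
  finally show "mat_apply r m A (mat_apply m c B v) k = mat_apply r c (\<lambda>k l. \<Sum>j<m. A k j * B j l) v k"
    by (simp add: mat_apply_def)
qed

lemma free_mod_diff: "u \<in> free_mod r \<Longrightarrow> v \<in> free_mod r \<Longrightarrow> (u - v :: nat \<Rightarrow> 'a::comm_ring_1) \<in> free_mod r"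
  by (simp add: free_mod_def)

lemma bd_map_in_free_mod [simp]: "bd_map F n v \<in> free_mod (rank F n)"
  by (simp add: bd_map_def)

lemma bd_map_diff: "bd_map F n (u - v) = bd_map F n u - bd_map F n v"
  by (simp add: bd_map_def mat_apply_diff)

text \<open>Agreement with a matrix is asked only on \<open>free_mod c\<close>, so that the identity
  function and pointwise differences of maps qualify.\<close>

definition graded_map :: "nat \<Rightarrow> (nat \<Rightarrow> int) \<Rightarrow> nat \<Rightarrow> (nat \<Rightarrow> int) \<Rightarrow>
    ((nat \<Rightarrow> ('n::finite, 'k::field) mpoly) \<Rightarrow> (nat \<Rightarrow> ('n, 'k) mpoly)) \<Rightarrow> bool" where
  "graded_map c s r t f \<longleftrightarrow> (\<exists>A. (\<forall>k<r. \<forall>l<c. homogeneous (A k l) (s l - t k)) \<and>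
     (\<forall>v\<in>free_mod c. f v = mat_apply r c A v))"

lemma graded_map_in_free_mod: "graded_map c s r t f \<Longrightarrow> v \<in> free_mod c \<Longrightarrow> f v \<in> free_mod r"
  by (auto simp: graded_map_def)

lemma graded_map_diff_arg:
  "graded_map c s r t f \<Longrightarrow> u \<in> free_mod c \<Longrightarrow> v \<in> free_mod c \<Longrightarrow> f (u - v) = f u - f v"
  by (auto simp: graded_map_def free_mod_diff mat_apply_diff)

lemma graded_map_zero: "graded_map c s r t f \<Longrightarrow> f 0 = 0"
  using graded_map_diff_arg[of c s r t f 0 0] by (simp add: free_mod_def)

lemma graded_map_id: "graded_map r s r s (\<lambda>v. v)"
  unfolding graded_map_def
proof (intro exI conjI allI impI ballI)
  let ?A = "\<lambda>k l::nat. if k = l then 1 else 0"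
  show "homogeneous (?A k l) (s l - s k)" for k l by simp
  show "v = mat_apply r r ?A v" if "v \<in> free_mod r" for v
  proof
    fix k
    have "(\<Sum>l<r. ?A k l * v l) = (\<Sum>l<r. if k = l then v l else 0)" by (intro sum.cong) auto
    then show "v k = mat_apply r r ?A v k" using that by (simp add: mat_apply_def free_mod_def)
  qed
qed

lemma graded_map_diff:
  assumes "graded_map c s r t f" "graded_map c s r t g"
  shows "graded_map c s r t (\<lambda>v. f v - g v)"
proof -
  obtain A B where A: "\<forall>k<r. \<forall>l<c. homogeneous (A k l) (s l - t k)" "\<forall>v\<in>free_mod c. f v = mat_apply r c A v"
    and B: "\<forall>k<r. \<forall>l<c. homogeneous (B k l) (s l - t k)" "\<forall>v\<in>free_mod c. g v = mat_apply r c B v"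
    using assms unfolding graded_map_def by auto
  show ?thesis
    unfolding graded_map_def using A B
    by (intro exI[of _ "\<lambda>k l. A k l - B k l"])
      (auto simp: homogeneous_diff mat_apply_def fun_eq_iff left_diff_distrib sum_subtractf)
qed

lemma graded_map_compose:
  assumes "graded_map c s m u f" "graded_map m u r t g"
  shows "graded_map c s r t (\<lambda>v. g (f v))"
proof -
  obtain A B where A: "\<forall>k<m. \<forall>l<c. homogeneous (A k l) (s l - u k)" "\<forall>v\<in>free_mod c. f v = mat_apply m c A v"
    and B: "\<forall>k<r. \<forall>l<m. homogeneous (B k l) (u l - t k)" "\<forall>v\<in>free_mod m. g v = mat_apply r m B v"
    using assms unfolding graded_map_def by auto
  have "homogeneous (B k j * A j l) (s l - t k)" if "k < r" "l < c" "j < m" for k l j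
    using homogeneous_mult[of "B k j" "u j - t k" "A j l" "s l - u j"] A B that by simp
  then show ?thesis
    unfolding graded_map_def using A B
    by (intro exI[of _ "\<lambda>k l. \<Sum>j<m. B k j * A j l"])
      (auto simp: mat_apply_mat_apply intro!: homogeneous_sum)
qed

section \<open>Cycles and homogeneous preimages\<close>

lemma homogeneous_bd:
  assumes "graded_free_resolution F I" "k < rank F n" "l < rank F (Suc n)"
  shows "homogeneous (bd F n k l) (shift F (Suc n) l - shift F n k)"
  using conjunct1[OF conjunct2[OF assms(1)[unfolded graded_free_resolution_def]]] assms(2,3) by simp

lemma homogeneous_aug:
  assumes "graded_free_resolution F I" "k < rank F 0"
  shows "homogeneous (aug F k) (shift F 0 k)"
  using conjunct1[OF assms(1)[unfolded graded_free_resolution_def]] assms(2) by simp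

lemma graded_map_bd:
  assumes "graded_free_resolution F I"
  shows "graded_map (rank F (Suc n)) (shift F (Suc n)) (rank F n) (shift F n) (bd_map F n)"
  unfolding graded_map_def
  by (intro exI[of _ "bd F n"]) (simp add: homogeneous_bd[OF assms] bd_map_def)

text \<open>In degree 0 the cycles are the kernel of the map to \<open>S/I\<close>, so that
  exactness of the augmented complex has the same form in every degree.\<close>

definition cyc :: "('n::finite, 'k::field) free_cpx \<Rightarrow> ('n, 'k) mpoly set \<Rightarrow> nat \<Rightarrow> (nat \<Rightarrow> ('n, 'k) mpoly) set" where
  "cyc F I n = {v \<in> free_mod (rank F n). case n of 0 \<Rightarrow> aug_map F v \<in> I | Suc i \<Rightarrow> bd_map F i v = 0}"

lemma cyc_Suc: "cyc F I (Suc i) = {v \<in> free_mod (rank F (Suc i)). bd_map F i v = 0}"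
  by (simp add: cyc_def)

lemma cyc_0: "cyc F I 0 = {v \<in> free_mod (rank F 0). aug_map F v \<in> I}"
  by (simp add: cyc_def)

lemma cyc_eq_image:
  assumes "graded_free_resolution F I"
  shows "cyc F I n = bd_map F n ` free_mod (rank F (Suc n))"
  using assms by (cases n) (simp_all add: graded_free_resolution_def cyc_def)

lemma bd_map_in_cyc:
  assumes "graded_free_resolution F I" "v \<in> free_mod (rank F (Suc n))"
  shows "bd_map F n v \<in> cyc F I n"
  using assms by (simp add: cyc_eq_image)

text \<open>The vector \<open>v\<close> is homogeneous of degree \<open>j\<close>. The degree
  \<open>j\<close> part of any preimage is again a preimage, because the matrix of the boundary is
  homogeneous.\<close>

lemma lift_homogeneous:
  assumes F: "graded_free_resolution F I" and v: "v \<in> cyc F I n"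
    and hom: "\<And>k. k < rank F n \<Longrightarrow> homogeneous (v k) (j - shift F n k)"
  shows "\<exists>u\<in>free_mod (rank F (Suc n)). bd_map F n u = v \<and>
    (\<forall>k<rank F (Suc n). homogeneous (u k) (j - shift F (Suc n) k))"
proof -
  obtain u where u: "u \<in> free_mod (rank F (Suc n))" "bd_map F n u = v"
    using v unfolding cyc_eq_image[OF F] by blast
  let ?u = "\<lambda>k. hpart (j - shift F (Suc n) k) (u k)"
  have "bd_map F n ?u k = v k" for k
  proof (cases "k < rank F n")
    case True
    have "bd_map F n ?u k = (\<Sum>l<rank F (Suc n). hpart (j - shift F n k) (bd F n k l * u l))"
      using True hpart_mult[OF homogeneous_bd[OF F True], of _ "j - shift F n k"]
      by (simp add: bd_map_def mat_apply_def)
    also have "\<dots> = hpart (j - shift F n k) (bd_map F n u k)"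
      using True by (simp add: bd_map_def mat_apply_def hpart_sum)
    also have "\<dots> = v k" using hom[OF True] u by (simp add: hpart_homogeneous)
    finally show ?thesis .
  next
    case False
    then show ?thesis using v by (auto simp: bd_map_def mat_apply_def cyc_def free_mod_def)
  qed
  moreover have "?u \<in> free_mod (rank F (Suc n))" using u by (auto simp: free_mod_def)
  ultimately show ?thesis by (intro bexI[of _ ?u]) (auto simp: homogeneous_hpart)
qed

text \<open>Projectivity of free modules: the images of the basis vectors \<open>e l\<close> are
  lifted one at a time, and the lifts are the columns of the matrix of \<open>h\<close>.\<close>

lemma lift_graded_map:
  fixes F :: "('n::finite, 'k::field) free_cpx"
  assumes F: "graded_free_resolution F I" and g: "graded_map c s (rank F n) (shift F n) g"
    and cyc: "\<And>v. v \<in> free_mod c \<Longrightarrow> g v \<in> cyc F I n"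
  shows "\<exists>h. graded_map c s (rank F (Suc n)) (shift F (Suc n)) h \<and> (\<forall>v\<in>free_mod c. bd_map F n (h v) = g v)"
proof -
  obtain A where A: "\<forall>k<rank F n. \<forall>l<c. homogeneous (A k l) (s l - shift F n k)"
    "\<forall>v\<in>free_mod c. g v = mat_apply (rank F n) c A v"
    using g unfolding graded_map_def by blast
  define e where "e l = (\<lambda>k. if k = l then 1 else 0 :: ('n, 'k) mpoly)" for l :: nat
  have e: "e l \<in> free_mod c" "g (e l) k = (if k < rank F n then A k l else 0)" if "l < c" for l k
  proof -
    show *: "e l \<in> free_mod c" using that by (auto simp: e_def free_mod_def)
    have "(\<Sum>m<c. A k m * e l m) = (\<Sum>m<c. if m = l then A k m else 0)"
      by (intro sum.cong) (auto simp: e_def)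
    then show "g (e l) k = (if k < rank F n then A k l else 0)"
      using * A(2) that by (simp add: mat_apply_def)
  qed
  have "\<exists>u\<in>free_mod (rank F (Suc n)). bd_map F n u = g (e l) \<and>
    (\<forall>k<rank F (Suc n). homogeneous (u k) (s l - shift F (Suc n) k))" if "l < c" for l
    using e[OF that] A(1) that by (intro lift_homogeneous[OF F cyc]) auto
  then obtain u where u: "\<And>l. l < c \<Longrightarrow> u l \<in> free_mod (rank F (Suc n))"
    "\<And>l. l < c \<Longrightarrow> bd_map F n (u l) = g (e l)"
    "\<And>l k. l < c \<Longrightarrow> k < rank F (Suc n) \<Longrightarrow> homogeneous (u l k) (s l - shift F (Suc n) k)"
    by metis
  let ?h = "mat_apply (rank F (Suc n)) c (\<lambda>k l. u l k)"
  have "bd_map F n (?h v) = g v" if v: "v \<in> free_mod c" for v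
  proof
    fix k
    have "(\<Sum>j<rank F (Suc n). bd F n k j * u l j) = A k l" if "l < c" "k < rank F n" for l
      using fun_cong[OF u(2)[OF that(1)], of k] e(2)[OF that(1), of k] that
      by (simp add: bd_map_def mat_apply_def)
    then show "bd_map F n (?h v) k = g v k"
      using A(2) v unfolding bd_map_def mat_apply_mat_apply by (auto simp: mat_apply_def intro!: sum.cong)
  qed
  moreover have "graded_map c s (rank F (Suc n)) (shift F (Suc n)) ?h"
    unfolding graded_map_def using u(3) by (intro exI[of _ "\<lambda>k l. u l k"]) simp
  ultimately show ?thesis by (intro exI[of _ ?h]) simp
qed

lemma aug_map_mat_apply:
  "aug_map F (mat_apply (rank F 0) c A v) = (\<Sum>l<c. aug_map F (\<lambda>k. A k l) * v l)"
proof -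
  have "aug_map F (mat_apply (rank F 0) c A v) = (\<Sum>k<rank F 0. \<Sum>l<c. aug F k * A k l * v l)"
    by (auto simp: aug_map_def mat_apply_def sum_distrib_left mult.assoc intro!: sum.cong)
  also have "\<dots> = (\<Sum>l<c. aug_map F (\<lambda>k. A k l) * v l)"
    by (subst sum.swap) (simp add: aug_map_def sum_distrib_right)
  finally show ?thesis .
qed

text \<open>As in \<open>lift_homogeneous\<close>, a preimage is cut down to its homogeneous part;
  the error stays in \<open>I\<close> because a monomial ideal is closed under taking
  components.\<close>

lemma aug_lift:
  assumes I: "monomial_ideal I" and F: "graded_free_resolution F I" and p: "homogeneous p j"
  shows "\<exists>u. (\<forall>k<rank F 0. homogeneous (u k) (j - shift F 0 k)) \<and> aug_map F u - p \<in> I"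
proof -
  obtain u where u: "aug_map F u - p \<in> I"
    using conjunct1[OF conjunct2[OF conjunct2[OF F[unfolded graded_free_resolution_def]]]] by blast
  let ?u = "\<lambda>k. hpart (j - shift F 0 k) (u k)"
  have "aug_map F ?u = hpart j (aug_map F u)"
    unfolding aug_map_def hpart_sum using hpart_mult[OF homogeneous_aug[OF F]]
    by (intro sum.cong refl) simp
  then have "aug_map F ?u - p = hpart j (aug_map F u - p)"
    using p by (simp add: hpart_diff hpart_homogeneous)
  also have "\<dots> \<in> I" by (rule monomial_ideal_hpart[OF I u])
  finally show ?thesis by (auto simp: homogeneous_hpart intro!: exI[of _ ?u])
qed

text \<open>The last clause says that the map lifts the identity of \<open>S/I\<close>.\<close>

definition chain_map ::
  "('n::finite, 'k::field) free_cpx \<Rightarrow> ('n, 'k) free_cpx \<Rightarrow> ('n, 'k) mpoly set \<Rightarrow>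
    (nat \<Rightarrow> (nat \<Rightarrow> ('n, 'k) mpoly) \<Rightarrow> (nat \<Rightarrow> ('n, 'k) mpoly)) \<Rightarrow> bool" where
  "chain_map F G I f \<longleftrightarrow> (\<forall>n. graded_map (rank F n) (shift F n) (rank G n) (shift G n) (f n)) \<and>
    (\<forall>n. \<forall>v\<in>free_mod (rank F (Suc n)). bd_map G n (f (Suc n) v) = f n (bd_map F n v)) \<and>
    (\<forall>v\<in>free_mod (rank F 0). aug_map G (f 0 v) - aug_map F v \<in> I)"

text \<open>The comparison theorem: degree 0 lifts the augmentation, and each further degree lifts
  the composite of the previous map with the boundary.\<close>

lemma chain_map_exists:
  assumes I: "monomial_ideal I" and F: "graded_free_resolution F I" and G: "graded_free_resolution G I"
  shows "\<exists>f. chain_map F G I f"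
proof -
  let ?g = "\<lambda>n. graded_map (rank F n) (shift F n) (rank G n) (shift G n)"
  \<comment> \<open>\<open>P\<close> records that cycles go to cycles, which is what the lift in the
    next degree requires.\<close>
  define P where "P n f \<longleftrightarrow> ?g n f \<and> (\<forall>v\<in>cyc F I n. f v \<in> cyc G I n) \<and>
    (n = 0 \<longrightarrow> (\<forall>v\<in>free_mod (rank F 0). aug_map G (f v) - aug_map F v \<in> I))" for n f
  define Q where "Q n f f' \<longleftrightarrow> (\<forall>v\<in>free_mod (rank F (Suc n)). bd_map G n (f' v) = f (bd_map F n v))" for n f f'
  have "\<exists>f. P 0 f"
  proof -
    have "\<exists>u. (\<forall>k<rank G 0. homogeneous (u k) (shift F 0 l - shift G 0 k)) \<and> aug_map G u - aug F l \<in> I"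
      if "l < rank F 0" for l
      by (rule aug_lift[OF I G homogeneous_aug[OF F that]])
    then obtain u where u: "\<And>l k. l < rank F 0 \<Longrightarrow> k < rank G 0 \<Longrightarrow> homogeneous (u l k) (shift F 0 l - shift G 0 k)"
      "\<And>l. l < rank F 0 \<Longrightarrow> aug_map G (u l) - aug F l \<in> I"
      by metis
    let ?f = "mat_apply (rank G 0) (rank F 0) (\<lambda>k l. u l k)"
    have aug: "aug_map G (?f v) - aug_map F v \<in> I" for v
    proof -
      have "aug_map G (?f v) - aug_map F v = (\<Sum>l<rank F 0. (aug_map G (u l) - aug F l) * v l)"
        unfolding aug_map_mat_apply by (simp add: aug_map_def[of F] left_diff_distrib sum_subtractf)
      also have "\<dots> \<in> I" using u(2) by (intro monomial_ideal_sum[OF I] monomial_ideal_mult[OF I]) auto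
      finally show ?thesis .
    qed
    moreover have "?g 0 ?f" 
      unfolding graded_map_def using u(1) by (intro exI[of _ "\<lambda>k l. u l k"]) simp
    moreover have "?f v \<in> cyc G I 0" if "v \<in> cyc F I 0" for v
    proof -
      have "0 - aug_map F v \<in> I"
        using that monomial_ideal_sum[OF I, of "{}"] by (intro monomial_ideal_diff[OF I]) (auto simp: cyc_0)
      from monomial_ideal_diff[OF I aug[of v] this] have "aug_map G (?f v) \<in> I" by simp
      then show ?thesis by (simp add: cyc_0)
    qed
    ultimately show ?thesis unfolding P_def by (intro exI[of _ ?f]) simp
  qed
  moreover have "\<exists>f'. P (Suc n) f' \<and> Q n f f'" if f: "P n f" for n f
  proof -
    have "graded_map (rank F (Suc n)) (shift F (Suc n)) (rank G n) (shift G n) (\<lambda>v. f (bd_map F n v))"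
      using graded_map_compose[OF graded_map_bd[OF F]] f by (auto simp: P_def)
    moreover have "f (bd_map F n v) \<in> cyc G I n" if "v \<in> free_mod (rank F (Suc n))" for v
      using f bd_map_in_cyc[OF F that] by (simp add: P_def)
    ultimately obtain f' where f': "?g (Suc n) f'"
      "\<forall>v\<in>free_mod (rank F (Suc n)). bd_map G n (f' v) = f (bd_map F n v)"
      using lift_graded_map[OF G] by blast
    moreover have "f' v \<in> cyc G I (Suc n)" if "v \<in> cyc F I (Suc n)" for v
    proof -
      have "v \<in> free_mod (rank F (Suc n))" "bd_map F n v = 0" using that by (simp_all add: cyc_Suc)
      moreover have "f 0 = 0" using f graded_map_zero unfolding P_def by blast
      ultimately show ?thesis using f' graded_map_in_free_mod by (fastforce simp: cyc_Suc)
    qed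
    ultimately show ?thesis unfolding P_def Q_def by blast
  qed
  ultimately obtain f where "\<And>n. P n (f n)" "\<And>n. Q n (f n) (f (Suc n))"
    using dependent_nat_choice[of P Q] by blast
  then have "chain_map F G I f" unfolding chain_map_def P_def Q_def by blast
  then show ?thesis by (intro exI[of _ f])
qed

text \<open>The next homotopy is a lift of what the homotopy relation still lacks, and this is
  always a cycle.\<close>

lemma chain_homotopy_exists:
  assumes I: "monomial_ideal I" and F: "graded_free_resolution F I" and f: "chain_map F F I f"
  shows "\<exists>h. (\<forall>n. graded_map (rank F n) (shift F n) (rank F (Suc n)) (shift F (Suc n)) (h n)) \<and>
    (\<forall>v\<in>free_mod (rank F 0). bd_map F 0 (h 0 v) = f 0 v - v) \<and>
    (\<forall>n. \<forall>v\<in>free_mod (rank F (Suc n)). bd_map F (Suc n) (h (Suc n) v) = f (Suc n) v - v - h n (bd_map F n v))"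
proof -
  let ?g = "\<lambda>n. graded_map (rank F n) (shift F n) (rank F n) (shift F n)"
  let ?h = "\<lambda>n. graded_map (rank F n) (shift F n) (rank F (Suc n)) (shift F (Suc n))"
  have f1: "?g n (f n)" "\<And>v. v \<in> free_mod (rank F (Suc n)) \<Longrightarrow> bd_map F n (f (Suc n) v) = f n (bd_map F n v)"
    "\<And>v. v \<in> free_mod (rank F 0) \<Longrightarrow> aug_map F (f 0 v) - aug_map F v \<in> I" for n
    using f unfolding chain_map_def by blast+
  have f2: "?g n (\<lambda>v. f n v - v)" for n
    using graded_map_diff[OF f1(1) graded_map_id] .
  \<comment> \<open>On cycles the relation has no term from below; applied to boundaries, this short
    form shows that the vector to be lifted next is a cycle.\<close>
  define P where "P n h \<longleftrightarrow> ?h n h \<and> (\<forall>v\<in>cyc F I n. bd_map F n (h v) = f n v - v) \<and>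
    (n = 0 \<longrightarrow> (\<forall>v\<in>free_mod (rank F 0). bd_map F 0 (h v) = f 0 v - v))" for n h
  define Q where "Q n h h' \<longleftrightarrow> (\<forall>v\<in>free_mod (rank F (Suc n)).
    bd_map F (Suc n) (h' v) = f (Suc n) v - v - h (bd_map F n v))" for n h h'
  have "\<exists>h. P 0 h"
  proof -
    have "f 0 v - v \<in> cyc F I 0" if "v \<in> free_mod (rank F 0)" for v
    proof -
      have "aug_map F (f 0 v - v) = aug_map F (f 0 v) - aug_map F v"
        by (simp add: aug_map_def right_diff_distrib sum_subtractf)
      then show ?thesis
        using f1(3)[OF that] free_mod_diff[OF graded_map_in_free_mod[OF f1(1) that] that] by (simp add: cyc_0)
    qed
    then obtain h where "?h 0 h" "\<forall>v\<in>free_mod (rank F 0). bd_map F 0 (h v) = f 0 v - v"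
      using lift_graded_map[OF F f2] by blast
    then show ?thesis unfolding P_def cyc_0 by blast
  qed
  moreover have "\<exists>h'. P (Suc n) h' \<and> Q n h h'" if h: "P n h" for n h
  proof -
    let ?G = "\<lambda>v. f (Suc n) v - v - h (bd_map F n v)"
    have hb: "graded_map (rank F (Suc n)) (shift F (Suc n)) (rank F (Suc n)) (shift F (Suc n)) (\<lambda>v. h (bd_map F n v))"
      using graded_map_compose[OF graded_map_bd[OF F]] h by (auto simp: P_def)
    have gG: "?g (Suc n) ?G" by (rule graded_map_diff[OF f2 hb])
    moreover have "?G v \<in> cyc F I (Suc n)" if v: "v \<in> free_mod (rank F (Suc n))" for v
    proof -
      have "bd_map F n (h (bd_map F n v)) = f n (bd_map F n v) - bd_map F n v"
        using h bd_map_in_cyc[OF F v] by (simp add: P_def)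
      then have "bd_map F n (?G v) = 0" using f1(2)[OF v] by (simp add: bd_map_diff)
      then show ?thesis using graded_map_in_free_mod[OF gG v] by (simp add: cyc_Suc)
    qed
    ultimately obtain h' where h': "?h (Suc n) h'"
      "\<forall>v\<in>free_mod (rank F (Suc n)). bd_map F (Suc n) (h' v) = ?G v"
      using lift_graded_map[OF F] by blast
    moreover have "bd_map F (Suc n) (h' v) = f (Suc n) v - v" if "v \<in> cyc F I (Suc n)" for v
    proof -
      have "v \<in> free_mod (rank F (Suc n))" "bd_map F n v = 0" using that by (simp_all add: cyc_Suc)
      moreover have "h 0 = 0" using h graded_map_zero unfolding P_def by blast
      ultimately show ?thesis using h' by simp
    qed
    ultimately show ?thesis unfolding P_def Q_def by blast
  qed
  ultimately obtain h where "\<And>n. P n (h n)" "\<And>n. Q n (h n) (h (Suc n))"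
    using dependent_nat_choice[of P Q] by blast
  then show ?thesis unfolding P_def Q_def by blast
qed

section \<open>Existence of a minimal multigraded resolution\<close>

text \<open>Dickson's lemma by induction on the coordinates. The set \<open>M\<close> obtained for
  \<open>A\<close> settles the elements whose coordinate \<open>a\<close> is at least that of every
  member of \<open>M\<close>; the others lie in finitely many slices with constant coordinate
  \<open>a\<close>.\<close>

lemma dickson_coordinates:
  fixes J :: "('n \<Rightarrow> nat) set"
  assumes "finite A"
  shows "\<exists>M\<subseteq>J. finite M \<and> (\<forall>u\<in>J. \<exists>m\<in>M. \<forall>x\<in>A. m x \<le> u x)"
  using assms
proof (induction A arbitrary: J)
  case empty
  show ?case
  proof (cases "J = {}")
    case False
    then obtain m where "m \<in> J" by auto
    then show ?thesis by (intro exI[of _ "{m}"]) auto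
  qed auto
next
  case (insert a A)
  obtain M where M: "M \<subseteq> J" "finite M" "\<forall>u\<in>J. \<exists>m\<in>M. \<forall>x\<in>A. m x \<le> u x"
    using insert.IH[of J] by blast
  \<comment> \<open>The sum bounds the coordinate \<open>a\<close> on \<open>M\<close> and also
    makes sense for empty \<open>M\<close>.\<close>
  define N where "N = (\<Sum>m\<in>M. m a)"
  have N: "m a \<le> N" if "m \<in> M" for m
    unfolding N_def using that M(2) by (intro member_le_sum) auto
  have "\<forall>c. \<exists>K\<subseteq>{u \<in> J. u a = c}. finite K \<and> (\<forall>u\<in>{u \<in> J. u a = c}. \<exists>m\<in>K. \<forall>x\<in>A. m x \<le> u x)"
    by (intro allI insert.IH)
  from choice[OF this] obtain K where K': "\<forall>c. K c \<subseteq> {u \<in> J. u a = c} \<and> finite (K c) \<and>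
      (\<forall>u\<in>{u \<in> J. u a = c}. \<exists>m\<in>K c. \<forall>x\<in>A. m x \<le> u x)" ..
  then have K: "\<And>c. K c \<subseteq> {u \<in> J. u a = c}" "\<And>c. finite (K c)"
    "\<And>c u. u \<in> J \<Longrightarrow> u a = c \<Longrightarrow> \<exists>m\<in>K c. \<forall>x\<in>A. m x \<le> u x"
    by simp_all
  show ?case
  proof (intro exI[of _ "M \<union> (\<Union>c<N. K c)"] conjI ballI)
    fix u assume u: "u \<in> J"
    show "\<exists>m\<in>M \<union> (\<Union>c<N. K c). \<forall>x\<in>insert a A. m x \<le> u x"
    proof (cases "u a < N")
      case True
      obtain m where m: "m \<in> K (u a)" "\<forall>x\<in>A. m x \<le> u x" using K(3)[OF u refl] by blast
      then have "\<forall>x\<in>insert a A. m x \<le> u x" using K(1)[of "u a"] by auto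
      then show ?thesis using m True by blast
    next
      case False
      obtain m where m: "m \<in> M" "\<forall>x\<in>A. m x \<le> u x" using M u by blast
      then have "\<forall>x\<in>insert a A. m x \<le> u x" using N[OF m(1)] False by auto
      then show ?thesis using m by blast
    qed
  next
    show "M \<union> (\<Union>c<N. K c) \<subseteq> J" using M(1) K(1) by fast
    show "finite (M \<union> (\<Union>c<N. K c))" using M(2) K(2) by simp
  qed
qed

lemma dickson:
  fixes J :: "('n::finite \<Rightarrow> nat) set"
  shows "\<exists>M\<subseteq>J. finite M \<and> (\<forall>u\<in>J. \<exists>m\<in>M. m \<le> u)"
proof -
  have "\<exists>M\<subseteq>J. finite M \<and> (\<forall>u\<in>J. \<exists>m\<in>M. \<forall>x\<in>UNIV. m x \<le> u x)"
    by (rule dickson_coordinates) simp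
  then show ?thesis unfolding le_fun_def by simp
qed

text \<open>The degree \<open>u\<close> part of the free module with generators in degrees
  \<open>w k\<close>. Each generator with \<open>w k \<le> u\<close> has one monomial multiple in
  degree \<open>u\<close>, so scalar vectors describe this part.\<close>

definition level :: "nat \<Rightarrow> (nat \<Rightarrow> 'd::ord) \<Rightarrow> 'd \<Rightarrow> (nat \<Rightarrow> 'k::zero) set" where
  "level r w u = {v \<in> free_mod r. \<forall>k. v k \<noteq> 0 \<longrightarrow> w k \<le> u}"

lemma level_zero: "v \<in> level r w u \<Longrightarrow> r \<le> k \<Longrightarrow> v k = 0"
  unfolding level_def free_mod_def by blast

lemma level_less: "v \<in> level r w u \<Longrightarrow> v k \<noteq> 0 \<Longrightarrow> k < r"
  using level_zero[of v r w u k] by linarith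

text \<open>A generator is a pair of a multidegree and a scalar vector in that degree. In degree
  \<open>u\<close> the generators of degree at most \<open>u\<close> are available, each through the
  unique monomial that fits.\<close>

definition generates :: "('d::ord \<times> (nat \<Rightarrow> 'k::field)) set \<Rightarrow> ('d \<Rightarrow> (nat \<Rightarrow> 'k) set) \<Rightarrow> bool" where
  "generates G Z \<longleftrightarrow> finite G \<and> (\<forall>g\<in>G. snd g \<in> Z (fst g)) \<and>
     (\<forall>u. \<forall>x\<in>Z u. \<exists>y. (\<forall>g. y g \<noteq> 0 \<longrightarrow> g \<in> G \<and> fst g \<le> u) \<and> x = (\<lambda>k. \<Sum>g\<in>G. y g * snd g k))"

text \<open>A relation in the degree of \<open>g\<close> that involves \<open>g\<close> expresses it
  by generators of no larger degree.\<close>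

lemma generates_remove:
  assumes "generates G Z" "y g \<noteq> 0" "\<And>h. y h \<noteq> 0 \<Longrightarrow> h \<in> G \<and> fst h \<le> fst g"
    and zero: "\<And>k. (\<Sum>h\<in>G. y h * snd h k) = 0"
  shows "generates (G - {g}) (Z :: 'd::order \<Rightarrow> _)"
  unfolding generates_def
proof (intro conjI allI ballI)
  show "finite (G - {g})" using assms(1) by (simp add: generates_def)
  show "snd h \<in> Z (fst h)" if "h \<in> G - {g}" for h using assms(1) that by (auto simp: generates_def)
  fix u x assume x: "x \<in> Z u"
  then obtain a where a: "\<And>h. a h \<noteq> 0 \<Longrightarrow> h \<in> G \<and> fst h \<le> u" "x = (\<lambda>k. \<Sum>h\<in>G. a h * snd h k)"
    using assms(1) unfolding generates_def by blast
  \<comment> \<open>Subtract the multiple of the relation that clears the coefficient of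
    \<open>g\<close>.\<close>
  define b where "b h = a h - a g / y g * y h" for h
  have bg: "b g = 0" using assms(2) by (simp add: b_def)
  have "h \<in> G - {g} \<and> fst h \<le> u" if h: "b h \<noteq> 0" for h
  proof (cases "a g = 0")
    case True
    then have "a h \<noteq> 0" using h by (simp add: b_def)
    then show ?thesis using a(1) bg h by auto
  next
    case False
    then have "fst g \<le> u" using a(1) by auto
    moreover have "a h \<noteq> 0 \<or> y h \<noteq> 0" using h by (auto simp: b_def)
    ultimately show ?thesis using a(1)[of h] assms(3)[of h] bg h by (auto intro: order_trans)
  qed
  moreover have "x = (\<lambda>k. \<Sum>h\<in>G - {g}. b h * snd h k)"
  proof
    fix k
    have "(\<Sum>h\<in>G. b h * snd h k) = (\<Sum>h\<in>G. a h * snd h k) - a g / y g * (\<Sum>h\<in>G. y h * snd h k)"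
      by (simp add: b_def left_diff_distrib sum_subtractf sum_distrib_left mult.assoc)
    moreover have "(\<Sum>h\<in>G. b h * snd h k) = (\<Sum>h\<in>G - {g}. b h * snd h k)"
      using assms(1) bg by (intro sum.mono_neutral_right) (auto simp: generates_def)
    ultimately show "x k = (\<Sum>h\<in>G - {g}. b h * snd h k)" by (simp add: a(2) zero)
  qed
  ultimately show "\<exists>y. (\<forall>h. y h \<noteq> 0 \<longrightarrow> h \<in> G - {g} \<and> fst h \<le> u) \<and> x = (\<lambda>k. \<Sum>h\<in>G - {g}. y h * snd h k)"
    by blast
qed

text \<open>
  A generating set of least cardinality has no relation with a nonzero coefficient in the top degree,
  because such a relation would make a generator redundant.
\<close>

lemma minimal_generators:
  assumes "generates G0 (Z :: 'd::order \<Rightarrow> (nat \<Rightarrow> 'k::field) set)"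
  shows "\<exists>G. generates G Z \<and> (\<forall>u y. (\<forall>g. y g \<noteq> 0 \<longrightarrow> g \<in> G \<and> fst g \<le> u) \<longrightarrow>
    (\<forall>k. (\<Sum>g\<in>G. y g * snd g k) = 0) \<longrightarrow> (\<forall>g. y g \<noteq> 0 \<longrightarrow> fst g < u))"
proof -
  obtain G where G: "generates G Z" "\<And>H. generates H Z \<Longrightarrow> card G \<le> card H"
    using ex_has_least_nat[of "\<lambda>G. generates G Z" G0 card] assms by blast
  have "fst g < u" if y: "\<forall>g. y g \<noteq> 0 \<longrightarrow> g \<in> G \<and> fst g \<le> u" "\<forall>k. (\<Sum>g\<in>G. y g * snd g k) = 0" "y g \<noteq> 0"
    for u y g
  proof (rule ccontr)
    assume "\<not> fst g < u"
    then have "fst g = u" using y by (auto simp: less_le)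
    then have "generates (G - {g}) Z" using y by (intro generates_remove[OF G(1), of y]) auto
    then have "card G \<le> card (G - {g})" by (rule G(2))
    moreover have "g \<in> G" using y(1,3) by blast
    moreover have "finite G" using G(1) by (simp add: generates_def)
    ultimately show False by (metis card_Diff1_less leD)
  qed
  then show ?thesis using G(1) by blast
qed

text \<open>Gaussian elimination: a vector of \<open>U\<close> with nonzero coordinate
  \<open>d\<close> serves as pivot and reduces \<open>U\<close> to the vectors vanishing at
  \<open>d\<close>.\<close>

lemma finite_span:
  fixes U :: "(nat \<Rightarrow> 'k::field) set"
  assumes "finite D" "\<And>x y c. x \<in> U \<Longrightarrow> y \<in> U \<Longrightarrow> (\<lambda>k. x k - c * y k) \<in> U"
    and "\<And>x k. x \<in> U \<Longrightarrow> x k \<noteq> 0 \<Longrightarrow> k \<in> D"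
  shows "\<exists>G\<subseteq>U. finite G \<and> (\<forall>x\<in>U. \<exists>y. x = (\<lambda>k. \<Sum>g\<in>G. y g * g k))"
  using assms
proof (induction D arbitrary: U)
  case empty
  have "x = (\<lambda>k. 0)" if "x \<in> U" for x
    using empty.prems(2)[OF that] by (intro ext) auto
  then show ?case by (intro exI[of _ "{}"]) auto
next
  case (insert d D)
  let ?U = "{x \<in> U. x d = 0}"
  have "\<exists>G\<subseteq>?U. finite G \<and> (\<forall>x\<in>?U. \<exists>y. x = (\<lambda>k. \<Sum>g\<in>G. y g * g k))"
  proof (rule insert.IH)
    show "k \<in> D" if "x \<in> ?U" "x k \<noteq> 0" for x k using insert.prems(2)[of x k] that by auto
  qed (use insert.prems in auto)
  then obtain G where G: "G \<subseteq> ?U" "finite G" "\<forall>x\<in>?U. \<exists>y. x = (\<lambda>k. \<Sum>g\<in>G. y g * g k)"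
    by blast
  show ?case
  proof (cases "U = ?U")
    case True
    then show ?thesis using G by auto
  next
    case False
    then obtain u where u: "u \<in> U" "u d \<noteq> 0" by blast
    then have uG: "u \<notin> G" using G by auto
    have "\<exists>y. x = (\<lambda>k. \<Sum>g\<in>insert u G. y g * g k)" if x: "x \<in> U" for x
    proof -
      have "(\<lambda>k. x k - x d / u d * u k) \<in> ?U" using insert.prems(1)[OF x u(1), of "x d / u d"] u(2) by simp
      then obtain y where y: "(\<lambda>k. x k - x d / u d * u k) = (\<lambda>k. \<Sum>g\<in>G. y g * g k)" using G(3) by blast
      have "x k = (\<Sum>g\<in>insert u G. (y(u := x d / u d)) g * g k)" for k
      proof -
        have "(\<Sum>g\<in>G. (y(u := x d / u d)) g * g k) = (\<Sum>g\<in>G. y g * g k)"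
          using uG by (intro sum.cong) auto
        then show ?thesis using uG G(2) fun_cong[OF y, of k] by (simp add: algebra_simps)
      qed
      then show ?thesis by blast
    qed
    then show ?thesis using G u by (intro exI[of _ "insert u G"]) auto
  qed
qed

lemma mat_apply_diff_scale:
  "mat_apply r c A (\<lambda>k. x k - a * y k) = (\<lambda>k. mat_apply r c A x k - a * mat_apply r c A y k)"
proof
  fix k
  have "(\<Sum>l<c. A k l * (x l - a * y l)) = (\<Sum>l<c. A k l * x l) - a * (\<Sum>l<c. A k l * y l)"
    by (simp add: right_diff_distrib sum_subtractf sum_distrib_left mult.left_commute)
  then show "mat_apply r c A (\<lambda>k. x k - a * y k) k = mat_apply r c A x k - a * mat_apply r c A y k"
    by (simp add: mat_apply_def)
qed

text \<open>The kernel at \<open>u\<close> depends only on the set of basis elements of degree at most \<open>u\<close>.\<close>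

lemma kernel_finitely_generated:
  fixes w :: "nat \<Rightarrow> 'n::finite \<Rightarrow> nat" and A :: "nat \<Rightarrow> nat \<Rightarrow> 'k::field"
  shows "\<exists>G. generates G (\<lambda>u. {v \<in> level r w u. mat_apply r0 r A v = 0})"
proof -
  let ?U = "\<lambda>D. {v. (\<forall>k. v k \<noteq> 0 \<longrightarrow> k \<in> D) \<and> mat_apply r0 r A v = 0}"
  \<comment> \<open>The least multidegree in which all basis elements of \<open>D\<close> are
    present; inserting 0 gives the empty \<open>D\<close> a maximum.\<close>
  define top where "top D = (\<lambda>x. Max (insert 0 ((\<lambda>k. w k x) ` D)))" for D
  have "\<exists>G\<subseteq>?U D. finite G \<and> (\<forall>x\<in>?U D. \<exists>y. x = (\<lambda>k. \<Sum>g\<in>G. y g * g k))" if "D \<subseteq> {..<r}" for D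
  proof (rule finite_span)
    show "finite D" using that by (rule finite_subset) simp
    show "(\<lambda>k. x k - c * y k) \<in> ?U D" if xy: "x \<in> ?U D" "y \<in> ?U D" for x y c
    proof (intro CollectI conjI allI impI)
      show "k \<in> D" if "x k - c * y k \<noteq> 0" for k
      proof -
        have "x k \<noteq> 0 \<or> y k \<noteq> 0" using that by auto
        then show ?thesis using xy by blast
      qed
      show "mat_apply r0 r A (\<lambda>k. x k - c * y k) = 0"
        using xy by (simp add: mat_apply_diff_scale fun_eq_iff)
    qed
  qed auto
  then have "\<forall>D. \<exists>G. D \<subseteq> {..<r} \<longrightarrow> G \<subseteq> ?U D \<and> finite G \<and>
      (\<forall>x\<in>?U D. \<exists>y. x = (\<lambda>k. \<Sum>g\<in>G. y g * g k))" by auto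
  from choice[OF this] obtain G where G': "\<forall>D. D \<subseteq> {..<r} \<longrightarrow> G D \<subseteq> ?U D \<and> finite (G D) \<and>
      (\<forall>x\<in>?U D. \<exists>y. x = (\<lambda>k. \<Sum>g\<in>G D. y g * g k))" ..
  then have G: "\<And>D. D \<subseteq> {..<r} \<Longrightarrow> G D \<subseteq> ?U D" "\<And>D. D \<subseteq> {..<r} \<Longrightarrow> finite (G D)"
    "\<And>D x. D \<subseteq> {..<r} \<Longrightarrow> x \<in> ?U D \<Longrightarrow> \<exists>y. x = (\<lambda>k. \<Sum>g\<in>G D. y g * g k)"
    by simp_all
  \<comment> \<open>One spanning set for each of the finitely many sets \<open>D\<close> of basis
    elements, placed in degree \<open>top D\<close>.\<close>
  let ?G = "\<Union>D\<in>Pow {..<r}. Pair (top D) ` G D"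
  have "generates ?G (\<lambda>u. {v \<in> level r w u. mat_apply r0 r A v = 0})"
    unfolding generates_def
  proof (intro conjI ballI allI)
    show fin: "finite ?G" using G(2) by auto
    show "snd g \<in> {v \<in> level r w (fst g). mat_apply r0 r A v = 0}" if g: "g \<in> ?G" for g
    proof -
      obtain D z where D: "D \<subseteq> {..<r}" "z \<in> G D" "g = (top D, z)" using g by auto
      have "w k \<le> top D" if "k \<in> D" for k
        using D(1) that finite_subset[OF D(1)] by (auto simp: le_fun_def top_def intro!: Max_ge)
      then have "v \<in> level r w (top D)" if "v \<in> ?U D" for v
        using that D(1) unfolding level_def free_mod_def by force
      then show ?thesis using D G(1)[OF D(1)] by auto
    qed
    fix u x assume x: "x \<in> {v \<in> level r w u. mat_apply r0 r A v = 0}"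
    define D where "D = {k. k < r \<and> w k \<le> u}"
    have D: "D \<subseteq> {..<r}" by (auto simp: D_def)
    have "x k \<noteq> 0 \<Longrightarrow> k < r" for k using x level_less[of x r w u k] by simp
    then have "x \<in> ?U D" using x by (auto simp: level_def D_def)
    then obtain y where y: "x = (\<lambda>k. \<Sum>g\<in>G D. y g * g k)" using G(3)[OF D] by blast
    let ?y = "\<lambda>g. if g \<in> Pair (top D) ` G D then y (snd g) else 0"
    have "top D \<le> u" using finite_subset[OF D] by (auto simp: le_fun_def top_def D_def)
    then have "\<forall>g. ?y g \<noteq> 0 \<longrightarrow> g \<in> ?G \<and> fst g \<le> u" using D by auto
    moreover have "x = (\<lambda>k. \<Sum>g\<in>?G. ?y g * snd g k)"
    proof
      fix k
      have "(\<Sum>g\<in>?G. ?y g * snd g k) = (\<Sum>g\<in>Pair (top D) ` G D. ?y g * snd g k)"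
        using D fin by (intro sum.mono_neutral_right) auto
      also have "\<dots> = (\<Sum>g\<in>G D. y g * g k)"
        by (subst sum.reindex) (auto simp: inj_on_def)
      finally show "x k = (\<Sum>g\<in>?G. ?y g * snd g k)" by (simp add: y)
    qed
    ultimately show "\<exists>y. (\<forall>g. y g \<noteq> 0 \<longrightarrow> g \<in> ?G \<and> fst g \<le> u) \<and> x = (\<lambda>k. \<Sum>g\<in>?G. y g * snd g k)"
      by (intro exI[of _ ?y] conjI)
  qed
  then show ?thesis by blast
qed

text \<open>A minimal generating set, enumerated by \<open>h\<close>, becomes a matrix: its vectors
  are the columns and their degrees those of the new basis. The last clause is minimality: a kernel
  vector in degree \<open>u\<close> has no component in degree \<open>u\<close>.\<close>

lemma minimal_cover:
  assumes "generates G0 Z" and sub: "\<And>u. Z u \<subseteq> free_mod r"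
  shows "\<exists>r' (w' :: nat \<Rightarrow> 'd::order) (c :: nat \<Rightarrow> nat \<Rightarrow> 'k::field).
    (\<forall>l<r'. (\<lambda>k. c k l) \<in> Z (w' l)) \<and>
    (\<forall>u. \<forall>v\<in>Z u. \<exists>y\<in>level r' w' u. mat_apply r r' c y = v) \<and>
    (\<forall>u. \<forall>y\<in>level r' w' u. mat_apply r r' c y = 0 \<longrightarrow> (\<forall>l. y l \<noteq> 0 \<longrightarrow> w' l < u))"
proof -
  obtain G where G: "generates G Z"
    "\<And>u y g. \<forall>g. y g \<noteq> 0 \<longrightarrow> g \<in> G \<and> fst g \<le> u \<Longrightarrow> \<forall>k. (\<Sum>g\<in>G. y g * snd g k) = 0 \<Longrightarrow> y g \<noteq> 0 \<Longrightarrow> fst g < u"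
    using minimal_generators[OF assms(1)] by blast
  have "finite G" using G(1) by (simp add: generates_def)
  then obtain h where h: "bij_betw h {0..<card G} G"
    using ex_bij_betw_nat_finite by blast
  then have hG: "h l \<in> G" if "l < card G" for l using that by (auto simp: bij_betw_def)
  define c where "c k l = snd (h l) k" for k l
  have col: "(\<lambda>k. c k l) \<in> Z (fst (h l))" if "l < card G" for l
    using G(1) hG[OF that] by (simp add: c_def generates_def)
  have app: "mat_apply r (card G) c y = (\<lambda>k. \<Sum>l<card G. snd (h l) k * y l)" for y
  proof
    fix k
    have "c k l = 0" if "l < card G" "\<not> k < r" for l
      using subsetD[OF sub col[OF that(1)]] that by (auto simp: free_mod_def)
    then show "mat_apply r (card G) c y k = (\<Sum>l<card G. snd (h l) k * y l)"
      by (auto simp: mat_apply_def c_def)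
  qed
  have reindex: "(\<Sum>g\<in>G. f g) = (\<Sum>l<card G. f (h l))" for f :: "_ \<Rightarrow> 'k"
    using sum.reindex_bij_betw[OF h, of f] by (simp add: atLeast0LessThan)
  have 2: "\<exists>y\<in>level (card G) (\<lambda>l. fst (h l)) u. mat_apply r (card G) c y = v" if v: "v \<in> Z u" for u v
  proof -
    obtain y where y: "\<forall>g. y g \<noteq> 0 \<longrightarrow> g \<in> G \<and> fst g \<le> u" "v = (\<lambda>k. \<Sum>g\<in>G. y g * snd g k)"
      using G(1) v unfolding generates_def by blast
    let ?y = "\<lambda>l. if l < card G then y (h l) else 0"
    have "?y \<in> level (card G) (\<lambda>l. fst (h l)) u"
      using y(1)[rule_format, of "h _"] by (simp add: level_def free_mod_def)
    moreover have "mat_apply r (card G) c ?y = v"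
      unfolding app y(2) reindex by (auto simp: mult.commute intro!: ext sum.cong)
    ultimately show ?thesis by blast
  qed
  have 3: "fst (h l) < u" if y: "y \<in> level (card G) (\<lambda>l. fst (h l)) u" "mat_apply r (card G) c y = 0" "y l \<noteq> 0" for u y l
  proof -
    have inj: "inj_on h {0..<card G}" using h by (simp add: bij_betw_def)
    \<comment> \<open>The kernel vector is carried back along the enumeration to a relation among
      the generators.\<close>
    let ?y = "\<lambda>g. if g \<in> G then y (the_inv_into {0..<card G} h g) else 0"
    have yh: "?y (h l) = y l" if "l < card G" for l
      using hG[OF that] the_inv_into_f_f[OF inj] that by simp
    have l: "l < card G"
      using level_less[OF y(1,3)] .
    have "\<forall>g. ?y g \<noteq> 0 \<longrightarrow> g \<in> G \<and> fst g \<le> u"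
    proof (intro allI impI)
      fix g assume g: "?y g \<noteq> 0"
      then have gG: "g \<in> G" by (auto split: if_splits)
      then have "g \<in> h ` {0..<card G}" using h by (simp add: bij_betw_def)
      then obtain l where "l < card G" "g = h l" by auto
      have "y l \<noteq> 0" using g unfolding \<open>g = h l\<close> yh[OF \<open>l < card G\<close>] .
      then have "fst (h l) \<le> u" using y(1) by (simp add: level_def)
      then show "g \<in> G \<and> fst g \<le> u" using gG \<open>g = h l\<close> by simp
    qed
    moreover have "\<forall>k. (\<Sum>g\<in>G. ?y g * snd g k) = 0"
    proof
      fix k
      have "(\<Sum>g\<in>G. ?y g * snd g k) = (\<Sum>l<card G. snd (h l) k * y l)"
        unfolding reindex using yh by (intro sum.cong) (auto simp: mult.commute)
      also have "\<dots> = mat_apply r (card G) c y k" by (simp add: app)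
      finally show "(\<Sum>g\<in>G. ?y g * snd g k) = 0" using y(2) by simp
    qed
    ultimately show ?thesis using G(2)[of ?y u "h l"] yh[OF l] y(3) by auto
  qed
  show ?thesis using col 2 3
    by (intro exI[of _ "card G"] exI[of _ "\<lambda>l. fst (h l)"] exI[of _ c]) blast
qed


text \<open>A graded submodule given by its strands: monotonicity is closure under multiplication by
  monomials, and the second condition says that each strand is a subspace.\<close>

definition submodule :: "('d::ord \<Rightarrow> (nat \<Rightarrow> 'k::field) set) \<Rightarrow> bool" where
  "submodule Z \<longleftrightarrow> (\<forall>u v. u \<le> v \<longrightarrow> Z u \<subseteq> Z v) \<and>
     (\<forall>u. 0 \<in> Z u \<and> (\<forall>x\<in>Z u. \<forall>y\<in>Z u. \<forall>c. (\<lambda>k. x k - c * y k) \<in> Z u))"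

lemma submodule_kernel:
  fixes w :: "nat \<Rightarrow> 'd::order" and A :: "nat \<Rightarrow> nat \<Rightarrow> 'k::field"
  shows "submodule (\<lambda>u. {v \<in> level r w u. mat_apply r0 r A v = 0})"
proof -
  have 1: "level r w u \<subseteq> level r w v" if "u \<le> v" for u v :: 'd
    using that by (auto simp: level_def intro: order_trans)
  have 2: "(0 :: nat \<Rightarrow> 'k) \<in> level r w u" "mat_apply r0 r A 0 = 0" for u
    by (simp_all add: level_def free_mod_def mat_apply_def fun_eq_iff)
  have 3: "(\<lambda>k. x k - c * y k) \<in> level r w u"
    if xy: "x \<in> level r w u" "y \<in> level r w u" for x y :: "nat \<Rightarrow> 'k" and c u
  proof -
    have "w k \<le> u" if "x k - c * y k \<noteq> 0" for k
    proof -
      have "x k \<noteq> 0 \<or> y k \<noteq> 0" using that by auto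
      then show ?thesis using xy unfolding level_def by blast
    qed
    then show ?thesis using level_zero[OF xy(1)] level_zero[OF xy(2)] by (simp add: level_def free_mod_def)
  qed
  have 4: "mat_apply r0 r A (\<lambda>k. x k - c * y k) = 0" if "mat_apply r0 r A x = 0" "mat_apply r0 r A y = 0" for x y c
    using that by (simp add: mat_apply_diff_scale fun_eq_iff)
  show ?thesis
    unfolding submodule_def
  proof (intro conjI allI impI ballI)
    fix u v :: 'd assume "u \<le> v"
    then show "{x \<in> level r w u. mat_apply r0 r A x = 0} \<subseteq> {x \<in> level r w v. mat_apply r0 r A x = 0}"
      using 1 by auto
  next
    fix u show "0 \<in> {x \<in> level r w u. mat_apply r0 r A x = 0}" using 2 by simp
  next
    fix u x y c
    assume "x \<in> {x \<in> level r w u. mat_apply r0 r A x = 0}" "y \<in> {x \<in> level r w u. mat_apply r0 r A x = 0}"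
    then show "(\<lambda>k. x k - c * y k) \<in> {x \<in> level r w u. mat_apply r0 r A x = 0}"
      using 3 4 by simp
  qed
qed

text \<open>A column with nonzero coefficient has degree at most \<open>u\<close>, so it may be
  moved up into \<open>Z u\<close>.\<close>

lemma submodule_mat_apply:
  assumes Z: "submodule (Z :: 'd::order \<Rightarrow> (nat \<Rightarrow> 'k::field) set)" and sub: "\<And>u. Z u \<subseteq> free_mod r"
    and col: "\<And>l. l < c \<Longrightarrow> (\<lambda>k. A k l) \<in> Z (w l)" and y: "y \<in> level c w u"
  shows "mat_apply r c A y \<in> Z u"
proof -
  have "(\<lambda>k. \<Sum>l<n. A k l * y l) \<in> Z u" if "n \<le> c" for n
    using that
  proof (induction n)
    case 0
    show ?case using Z by (simp add: submodule_def zero_fun_def)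
  next
    case (Suc n)
    show ?case
    proof (cases "y n = 0")
      case True
      then show ?thesis using Suc by simp
    next
      case False
      then have "w n \<le> u" using y by (simp add: level_def)
      then have "(\<lambda>k. A k n) \<in> Z u" using col[of n] Suc.prems Z by (auto simp: submodule_def)
      moreover have "(\<lambda>k. \<Sum>l<n. A k l * y l) \<in> Z u" using Suc by simp
      ultimately have "(\<lambda>k. (\<Sum>l<n. A k l * y l) - (- y n) * A k n) \<in> Z u"
        using Z unfolding submodule_def by blast
      then show ?thesis by (simp add: mult.commute)
    qed
  qed
  then have s: "(\<lambda>k. \<Sum>l<c. A k l * y l) \<in> Z u" by simp
  have "mat_apply r c A y = (\<lambda>k. \<Sum>l<c. A k l * y l)"
    using subsetD[OF sub s] by (auto simp: mat_apply_def free_mod_def)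
  then show ?thesis using s by simp
qed

text \<open>
  \<open>Z i u\<close> is the degree \<open>u\<close> part of the \<open>i\<close>-th syzygies, so \<open>Z 0\<close> is the monomial ideal with exponent
  set \<open>J\<close>; the matrix \<open>c i\<close> maps \<open>F\<^bsub>i+1\<^esub>\<close> onto \<open>Z i\<close>. That \<open>Z i u\<close> has no component in degree \<open>u\<close>
  is minimality.
\<close>

lemma minimal_resolution_exists:
  fixes J :: "('n::finite \<Rightarrow> nat) set"
  assumes up: "\<And>u v. u \<in> J \<Longrightarrow> u \<le> v \<Longrightarrow> v \<in> J" and J0: "(\<lambda>x. 0) \<notin> J"
  obtains r :: "nat \<Rightarrow> nat" and w :: "nat \<Rightarrow> nat \<Rightarrow> 'n \<Rightarrow> nat" and c :: "nat \<Rightarrow> nat \<Rightarrow> nat \<Rightarrow> 'k::field"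
    and Z :: "nat \<Rightarrow> ('n \<Rightarrow> nat) \<Rightarrow> (nat \<Rightarrow> 'k) set"
  where "r 0 = 1" "w 0 0 = (\<lambda>x. 0)" "\<And>u. Z 0 u = {v \<in> free_mod 1. v 0 \<noteq> 0 \<longrightarrow> u \<in> J}"
    "\<And>i u. Z (Suc i) u = {v \<in> level (r (Suc i)) (w (Suc i)) u. mat_apply (r i) (r (Suc i)) (c i) v = 0}"
    "\<And>i u. Z i u \<subseteq> level (r i) (w i) u"
    "\<And>i u v k. v \<in> Z i u \<Longrightarrow> v k \<noteq> 0 \<Longrightarrow> w i k < u"
    "\<And>i l. l < r (Suc i) \<Longrightarrow> (\<lambda>k. c i k l) \<in> Z i (w (Suc i) l)"
    "\<And>i u. mat_apply (r i) (r (Suc i)) (c i) ` level (r (Suc i)) (w (Suc i)) u = Z i u"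
proof -
  \<comment> \<open>A state \<open>(r, w, Z)\<close> holds the rank and degrees of the current free
    module and the submodule still to be covered. \<open>P\<close> includes finite generation and
    minimality; \<open>Q\<close> says that the next module covers \<open>Z\<close> and that the next
    submodule is the kernel.\<close>
  define P where "P = (\<lambda>(r, w, Z :: ('n \<Rightarrow> nat) \<Rightarrow> (nat \<Rightarrow> 'k) set). submodule Z \<and> (\<exists>G. generates G Z) \<and>
    (\<forall>u. \<forall>v\<in>Z u. v \<in> level r w u \<and> (\<forall>k. v k \<noteq> 0 \<longrightarrow> w k < u)))"
  define Q where "Q = (\<lambda>(r, w :: nat \<Rightarrow> 'n \<Rightarrow> nat, Z :: ('n \<Rightarrow> nat) \<Rightarrow> (nat \<Rightarrow> 'k) set)
      (r', w' :: nat \<Rightarrow> 'n \<Rightarrow> nat, Z'). \<exists>c.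
    (\<forall>l<r'. (\<lambda>k. c k l) \<in> Z (w' l)) \<and> (\<forall>u. mat_apply r r' c ` level r' w' u = Z u) \<and>
    (\<forall>u. Z' u = {v \<in> level r' w' u. mat_apply r r' c v = 0}))"
  define Z0 where "Z0 u = {v \<in> free_mod 1. v 0 \<noteq> (0::'k) \<longrightarrow> u \<in> J}" for u
  let ?s0 = "(1::nat, \<lambda>k::nat. \<lambda>x::'n. 0::nat, Z0)"
  have P0: "P ?s0"
  proof -
    obtain M where M: "M \<subseteq> J" "finite M" "\<forall>u\<in>J. \<exists>m\<in>M. m \<le> u" using dickson[of J] by blast
    let ?e = "\<lambda>k::nat. if k = 0 then 1 else (0::'k)"
    have "generates ((\<lambda>m. (m, ?e)) ` M) Z0"
      unfolding generates_def
    proof (intro conjI ballI allI)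
      show "finite ((\<lambda>m. (m, ?e)) ` M)" using M by simp
      show "snd g \<in> Z0 (fst g)" if "g \<in> (\<lambda>m. (m, ?e)) ` M" for g
        using that M(1) by (auto simp: Z0_def free_mod_def)
      fix u x assume x: "x \<in> Z0 u"
      show "\<exists>y. (\<forall>g. y g \<noteq> 0 \<longrightarrow> g \<in> (\<lambda>m. (m, ?e)) ` M \<and> fst g \<le> u) \<and>
          x = (\<lambda>k. \<Sum>g\<in>(\<lambda>m. (m, ?e)) ` M. y g * snd g k)"
      proof (cases "x 0 = 0")
        case True
        have "x k = 0" for k using x True by (cases k) (auto simp: Z0_def free_mod_def)
        then show ?thesis by (intro exI[of _ "\<lambda>g. 0"]) auto
      next
        case False
        then obtain m where m: "m \<in> M" "m \<le> u" using x M(3) by (auto simp: Z0_def)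
        have "x k = (\<Sum>g\<in>(\<lambda>m. (m, ?e)) ` M. (if g = (m, ?e) then x 0 else 0) * snd g k)" for k
        proof -
          have "(\<Sum>g\<in>(\<lambda>m. (m, ?e)) ` M. (if g = (m, ?e) then x 0 else 0) * snd g k) =
              (\<Sum>g\<in>(\<lambda>m. (m, ?e)) ` M. if g = (m, ?e) then x 0 * ?e k else 0)"
            by (intro sum.cong) auto
          also have "\<dots> = x 0 * ?e k" using m M(2) by (subst sum.delta) auto
          also have "\<dots> = x k" using x by (cases k) (auto simp: Z0_def free_mod_def)
          finally show ?thesis by simp
        qed
        then show ?thesis
          using m by (intro exI[of _ "\<lambda>g. if g = (m, ?e) then x 0 else 0"]) auto
      qed
    qed
    moreover have "submodule Z0"
      unfolding submodule_def
    proof (intro conjI allI impI ballI)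
      show "Z0 u \<subseteq> Z0 v" if "u \<le> v" for u v using up that by (auto simp: Z0_def)
      show "0 \<in> Z0 u" for u by (auto simp: Z0_def free_mod_def)
      show "(\<lambda>k. x k - c * y k) \<in> Z0 u" if "x \<in> Z0 u" "y \<in> Z0 u" for x y c u
        using that by (cases "x 0 = 0 \<and> y 0 = 0") (auto simp: Z0_def free_mod_def)
    qed
    \<comment> \<open>Minimality at the start comes from \<open>J0\<close>: a proper monomial ideal
      has nothing in degree 0.\<close>
    moreover have "v \<in> level 1 (\<lambda>k x. 0) u \<and> (\<forall>k. v k \<noteq> 0 \<longrightarrow> (\<lambda>x. 0) < u)" if v: "v \<in> Z0 u" for u v
    proof -
      have le: "(\<lambda>x. 0) \<le> u" by (simp add: le_fun_def)
      have "(\<lambda>x. 0) < u" if "v k \<noteq> 0" for k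
      proof -
        have "k = 0" using v that by (cases k) (auto simp: Z0_def free_mod_def)
        then have "u \<in> J" using v that by (simp add: Z0_def)
        then have "(\<lambda>x. 0) \<noteq> u" using J0 by blast
        then show ?thesis using le by (simp add: less_le)
      qed
      then show ?thesis using v le by (auto simp: level_def Z0_def)
    qed
    ultimately show ?thesis unfolding P_def by auto
  qed
  have step: "\<exists>s'. P s' \<and> Q s s'" if "P s" for s
  proof -
    obtain r w Z where s: "s = (r, w, Z)" by (cases s) auto
    have Z: "submodule Z" "\<exists>G. generates G Z" "\<And>u v. v \<in> Z u \<Longrightarrow> v \<in> level r w u"
      using that by (auto simp: P_def s)
    have sub: "Z u \<subseteq> free_mod r" for u using Z(3) by (auto simp: level_def)
    from Z(2) obtain G where "generates G Z" by blast
    from minimal_cover[OF this sub] obtain r' and w' :: "nat \<Rightarrow> 'n \<Rightarrow> nat" and c where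
      c: "\<forall>l<r'. (\<lambda>k. c k l) \<in> Z (w' l)"
      "\<forall>u. \<forall>v\<in>Z u. \<exists>y\<in>level r' w' u. mat_apply r r' c y = v"
      "\<forall>u. \<forall>y\<in>level r' w' u. mat_apply r r' c y = 0 \<longrightarrow> (\<forall>l. y l \<noteq> 0 \<longrightarrow> w' l < u)"
      by blast
    define Z' where "Z' u = {v \<in> level r' w' u. mat_apply r r' c v = 0}" for u
    have Z'_eq: "Z' = (\<lambda>u. {v \<in> level r' w' u. mat_apply r r' c v = 0})"
      by (simp add: Z'_def fun_eq_iff)
    have "mat_apply r r' c ` level r' w' u = Z u" for u
    proof
      show "mat_apply r r' c ` level r' w' u \<subseteq> Z u"
        using submodule_mat_apply[OF Z(1) sub, of r' c w'] c(1) by blast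
      show "Z u \<subseteq> mat_apply r r' c ` level r' w' u"
      proof
        fix v assume "v \<in> Z u"
        then obtain y where "y \<in> level r' w' u" "mat_apply r r' c y = v" using c(2) by metis
        then show "v \<in> mat_apply r r' c ` level r' w' u" by (metis imageI)
      qed
    qed
    then have "Q s (r', w', Z')" using c(1) unfolding Q_def s Z'_def by auto
    moreover have "P (r', w', Z')"
      unfolding P_def using submodule_kernel[of r' w' r c] kernel_finitely_generated[of r' w' r c] c(3)
      unfolding Z'_eq by blast
    ultimately show ?thesis by blast
  qed
  obtain s where s0: "s 0 = ?s0" and P: "\<And>i. P (s i)" and Q: "\<And>i. Q (s i) (s (Suc i))"
  proof -
    have "\<exists>s. \<forall>i. (P (s i) \<and> (i = 0 \<longrightarrow> s i = ?s0)) \<and> Q (s i) (s (Suc i))"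
      by (rule dependent_nat_choice) (use P0 step in auto)
    then show ?thesis using that by blast
  qed
  define r where "r i = fst (s i)" for i
  define w where "w i = fst (snd (s i))" for i
  define Z where "Z i = snd (snd (s i))" for i
  have s_eq: "s i = (r i, w i, Z i)" for i by (simp add: r_def w_def Z_def)
  have "\<forall>i. \<exists>c. (\<forall>l<r (Suc i). (\<lambda>k. c k l) \<in> Z i (w (Suc i) l)) \<and>
    (\<forall>u. mat_apply (r i) (r (Suc i)) c ` level (r (Suc i)) (w (Suc i)) u = Z i u) \<and>
    (\<forall>u. Z (Suc i) u = {v \<in> level (r (Suc i)) (w (Suc i)) u. mat_apply (r i) (r (Suc i)) c v = 0})"
    using Q unfolding Q_def s_eq by simp
  from choice[OF this] obtain c where c: "\<forall>i. (\<forall>l<r (Suc i). (\<lambda>k. c i k l) \<in> Z i (w (Suc i) l)) \<and>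
    (\<forall>u. mat_apply (r i) (r (Suc i)) (c i) ` level (r (Suc i)) (w (Suc i)) u = Z i u) \<and>
    (\<forall>u. Z (Suc i) u = {v \<in> level (r (Suc i)) (w (Suc i)) u. mat_apply (r i) (r (Suc i)) (c i) v = 0})" ..
  have lev: "v \<in> level (r i) (w i) u \<and> (\<forall>k. v k \<noteq> 0 \<longrightarrow> w i k < u)" if "v \<in> Z i u" for i u v
    using P[of i] that unfolding P_def s_eq by simp
  show ?thesis
  proof (rule that[of r w Z c])
    show "r 0 = 1" "w 0 0 = (\<lambda>x. 0)" by (simp_all add: r_def w_def s0)
    show "Z 0 u = {v \<in> free_mod 1. v 0 \<noteq> 0 \<longrightarrow> u \<in> J}" for u by (simp add: Z_def s0 Z0_def)
  qed (use c lev in blast)+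
qed

section \<open>Betti numbers and comparison maps\<close>

definition reduce :: "(nat \<Rightarrow> ('n::finite, 'k::field) mpoly) \<Rightarrow> (nat \<Rightarrow> 'k)" where
  "reduce v = (\<lambda>k. lookup (v k) 0)"

definition const_vec :: "(nat \<Rightarrow> 'k::field) \<Rightarrow> (nat \<Rightarrow> ('n::finite, 'k) mpoly)" where
  "const_vec v = (\<lambda>k. Poly_Mapping.single 0 (v k))"

lemma reduce_const_vec [simp]: "reduce (const_vec v) = v"
  by (simp add: reduce_def const_vec_def)

lemma reduce_diff: "reduce (u - v) = reduce u - reduce v"
  by (simp add: reduce_def fun_eq_iff lookup_minus)

lemma const_vec_in_free_mod: "v \<in> free_mod r \<Longrightarrow> const_vec v \<in> free_mod r"
  by (simp add: const_vec_def free_mod_def)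

lemma reduce_mat_apply: "reduce (mat_apply r c A v) = mat_apply r c (\<lambda>k l. lookup (A k l) 0) (reduce v)"
  by (simp add: reduce_def mat_apply_def fun_eq_iff lookup_sum constant_coeff_mult)

lemma reduce_bd_map: "reduce (bd_map F n v) = tensor_bd_map F n (reduce v)"
  by (simp add: bd_map_def tensor_bd_map_def reduce_mat_apply)

text \<open>The reduction of \<open>f v\<close> depends only on that of \<open>v\<close>, so a
  graded map induces a map after tensoring with the field; \<open>const_vec\<close> supplies
  representatives.\<close>

lemma reduce_graded_map:
  assumes "graded_map c s r t f" "v \<in> free_mod c"
  shows "reduce (f v) = reduce (f (const_vec (reduce v)))"
proof -
  obtain A where A: "\<forall>v\<in>free_mod c. f v = mat_apply r c A v" using assms(1) unfolding graded_map_def by auto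
  have "const_vec (reduce v) \<in> free_mod c"
    using assms(2) by (simp add: const_vec_def reduce_def free_mod_def)
  from A[rule_format, OF this] A[rule_format, OF assms(2)] show ?thesis
    by (simp add: reduce_mat_apply)
qed

text \<open>An entry with nonzero constant coefficient has degree 0 and so joins generators of equal
  degree.\<close>

lemma reduce_graded_map_piece:
  assumes f: "graded_map (rank F m) (shift F m) (rank G n) (shift G n) f" and v: "v \<in> tensor_piece F m j"
  shows "reduce (f (const_vec v)) \<in> tensor_piece G n j"
proof -
  obtain A where A: "\<forall>k<rank G n. \<forall>l<rank F m. homogeneous (A k l) (shift F m l - shift G n k)"
    "\<forall>v\<in>free_mod (rank F m). f v = mat_apply (rank G n) (rank F m) A v"
    using f unfolding graded_map_def by auto
  have vf: "v \<in> free_mod (rank F m)" "\<And>k. v k \<noteq> 0 \<Longrightarrow> shift F m k = j"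
    using v by (auto simp: tensor_piece_def)
  have eq: "reduce (f (const_vec v)) = mat_apply (rank G n) (rank F m) (\<lambda>k l. lookup (A k l) 0) v"
    unfolding A(2)[rule_format, OF const_vec_in_free_mod[OF vf(1)]] by (simp add: reduce_mat_apply)
  have "shift G n k = j" if "mat_apply (rank G n) (rank F m) (\<lambda>k l. lookup (A k l) 0) v k \<noteq> 0" for k
  proof -
    have k: "k < rank G n" "(\<Sum>l<rank F m. lookup (A k l) 0 * v l) \<noteq> 0"
      using that by (auto simp: mat_apply_def split: if_splits)
    then obtain l where l: "l < rank F m" "lookup (A k l) 0 * v l \<noteq> 0"
      by (metis (no_types, lifting) lessThan_iff sum.not_neutral_contains_not_neutral)
    then have "shift F m l - shift G n k = 0"
      using A(1) k(1) by (intro homogeneous_constant_coeff[of "A k l"]) auto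
    then show ?thesis using vf(2)[of l] l by simp
  qed
  then show ?thesis unfolding eq tensor_piece_def by simp
qed

text \<open>
  Only the vanishing of \<open>Tor\<close> is needed: if it holds for one resolution, it holds for every other one,
  since the composite of comparison maps is homotopic to the identity.
\<close>

lemma tor_vanishing_transfer:
  fixes F G :: "('n::finite, 'k::field) free_cpx"
  assumes I: "monomial_ideal I" and F: "graded_free_resolution F I" and G: "graded_free_resolution G I"
    and van: "tor_cycles G i j \<subseteq> tor_boundaries G i j"
  shows "tor_cycles F i j \<subseteq> tor_boundaries F i j"
proof
  fix z assume z: "z \<in> tor_cycles F i j"
  obtain f where f: "chain_map F G I f" using chain_map_exists[OF I F G] ..
  obtain g where g: "chain_map G F I g" using chain_map_exists[OF I G F] ..
  have fm: "graded_map (rank F n) (shift F n) (rank G n) (shift G n) (f n)"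
    and fc: "v \<in> free_mod (rank F (Suc n)) \<Longrightarrow> bd_map G n (f (Suc n) v) = f n (bd_map F n v)"
    and fa: "v \<in> free_mod (rank F 0) \<Longrightarrow> aug_map G (f 0 v) - aug_map F v \<in> I" for n v
    using f unfolding chain_map_def by blast+
  have gm: "graded_map (rank G n) (shift G n) (rank F n) (shift F n) (g n)"
    and gc: "v \<in> free_mod (rank G (Suc n)) \<Longrightarrow> bd_map F n (g (Suc n) v) = g n (bd_map G n v)"
    and ga: "v \<in> free_mod (rank G 0) \<Longrightarrow> aug_map F (g 0 v) - aug_map G v \<in> I" for n v
    using g unfolding chain_map_def by blast+
  have "chain_map F F I (\<lambda>n v. g n (f n v))"
    unfolding chain_map_def
  proof (intro conjI allI ballI)
    show "graded_map (rank F n) (shift F n) (rank F n) (shift F n) (\<lambda>v. g n (f n v))" for n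
      by (rule graded_map_compose[OF fm gm])
    show "bd_map F n (g (Suc n) (f (Suc n) v)) = g n (f n (bd_map F n v))"
      if "v \<in> free_mod (rank F (Suc n))" for n v
      using gc[OF graded_map_in_free_mod[OF fm that]] fc[OF that] by simp
    show "aug_map F (g 0 (f 0 v)) - aug_map F v \<in> I" if v: "v \<in> free_mod (rank F 0)" for v
    proof -
      \<comment> \<open>The sum over two truth values writes an addition in the form to which
        closure under finite sums applies.\<close>
      have "(\<Sum>b\<in>{True, False}. if b then aug_map F (g 0 (f 0 v)) - aug_map G (f 0 v) else aug_map G (f 0 v) - aug_map F v) \<in> I"
        using ga[OF graded_map_in_free_mod[OF fm v]] fa[OF v] by (intro monomial_ideal_sum[OF I]) auto
      then show ?thesis by simp
    qed
  qed
  from chain_homotopy_exists[OF I F this] obtain h where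
    hm: "\<And>n. graded_map (rank F n) (shift F n) (rank F (Suc n)) (shift F (Suc n)) (h n)"
    and h0: "\<And>v. v \<in> free_mod (rank F 0) \<Longrightarrow> bd_map F 0 (h 0 v) = g 0 (f 0 v) - v"
    and hS: "\<And>n v. v \<in> free_mod (rank F (Suc n)) \<Longrightarrow>
      bd_map F (Suc n) (h (Suc n) v) = g (Suc n) (f (Suc n) v) - v - h n (bd_map F n v)"
    by blast
  have zp: "z \<in> tensor_piece F i j" using z by (simp add: tor_cycles_def)
  then have zf: "(const_vec z :: nat \<Rightarrow> ('n, 'k) mpoly) \<in> free_mod (rank F i)"
    by (intro const_vec_in_free_mod) (simp add: tensor_piece_def)
  have zb: "tensor_bd_map F i' z = 0" if "i = Suc i'" for i'
    using z that by (simp add: tor_cycles_def)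
  let ?x = "reduce (f i (const_vec z))"
  \<comment> \<open>\<open>f\<close> carries the cycle \<open>z\<close> to a cycle of
    \<open>G\<close>, which by \<open>van\<close> is the boundary of some \<open>y\<close>; then
    \<open>g\<close> carries \<open>y\<close> back.\<close>
  have "?x \<in> tor_cycles G i j"
  proof -
    have "tensor_bd_map G i' ?x = 0" if i: "i = Suc i'" for i'
    proof -
      have "tensor_bd_map G i' ?x = reduce (f i' (bd_map F i' (const_vec z)))"
        using fc[of "const_vec z" i'] zf i by (simp add: reduce_bd_map[symmetric])
      also have "\<dots> = reduce (f i' (const_vec (tensor_bd_map F i' z)))"
        by (subst reduce_graded_map[OF fm]) (simp_all add: reduce_bd_map)
      also have "const_vec (tensor_bd_map F i' z) = (0 :: nat \<Rightarrow> ('n, 'k) mpoly)"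
        using zb[OF i] by (simp add: const_vec_def fun_eq_iff)
      also have "f i' 0 = 0" by (rule graded_map_zero[OF fm])
      finally show ?thesis by (simp add: reduce_def fun_eq_iff)
    qed
    then show ?thesis
      using reduce_graded_map_piece[OF fm zp] by (simp add: tor_cycles_def split: nat.split)
  qed
  then obtain y where y: "y \<in> tensor_piece G (Suc i) j" "?x = tensor_bd_map G i y"
    using van by (auto simp: tor_boundaries_def)
  have yf: "(const_vec y :: nat \<Rightarrow> ('n, 'k) mpoly) \<in> free_mod (rank G (Suc i))"
    using y(1) by (intro const_vec_in_free_mod) (simp add: tensor_piece_def)
  let ?y = "reduce (g (Suc i) (const_vec y))" and ?h = "reduce (h i (const_vec z))"
  have "reduce (g i (f i (const_vec z))) = reduce (g i (const_vec ?x))"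
    by (rule reduce_graded_map[OF gm graded_map_in_free_mod[OF fm zf]])
  also have "\<dots> = reduce (g i (const_vec (reduce (bd_map G i (const_vec y)))))"
    by (simp add: y(2) reduce_bd_map)
  also have "\<dots> = reduce (g i (bd_map G i (const_vec y)))"
    by (rule reduce_graded_map[OF gm, symmetric]) simp
  also have "\<dots> = tensor_bd_map F i ?y"
    using gc[OF yf] by (simp add: reduce_bd_map[symmetric])
  finally have gf: "reduce (g i (f i (const_vec z))) = tensor_bd_map F i ?y" .
  \<comment> \<open>The homotopy relation after reduction: its term through the lower boundary drops
    out because \<open>z\<close> is a cycle.\<close>
  have "tensor_bd_map F i ?h = reduce (g i (f i (const_vec z))) - z"
  proof (cases i)
    case 0
    then show ?thesis using h0 zf by (simp add: reduce_bd_map[symmetric] reduce_diff)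
  next
    case (Suc i')
    have "reduce (h i' (bd_map F i' (const_vec z))) = reduce (h i' (const_vec (tensor_bd_map F i' z)))"
      by (subst reduce_graded_map[OF hm]) (simp_all add: reduce_bd_map)
    also have "const_vec (tensor_bd_map F i' z) = (0 :: nat \<Rightarrow> ('n, 'k) mpoly)"
      using zb[OF Suc] by (simp add: const_vec_def fun_eq_iff)
    also have "h i' 0 = 0" by (rule graded_map_zero[OF hm])
    finally have "reduce (h i' (bd_map F i' (const_vec z))) = 0" by (simp add: reduce_def fun_eq_iff)
    then show ?thesis using hS[of "const_vec z" i'] zf Suc by (simp add: reduce_bd_map[symmetric] reduce_diff)
  qed
  then have "z = tensor_bd_map F i (?y - ?h)"
    by (simp add: gf tensor_bd_map_def mat_apply_diff)
  moreover have "?y - ?h \<in> tensor_piece F (Suc i) j"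
  proof -
    have yh: "?y \<in> tensor_piece F (Suc i) j" "?h \<in> tensor_piece F (Suc i) j"
      using reduce_graded_map_piece[OF gm y(1)] reduce_graded_map_piece[OF hm zp] .
    have "?y k \<noteq> 0 \<or> ?h k \<noteq> 0" if "(?y - ?h) k \<noteq> 0" for k using that by auto
    then show ?thesis using yh free_mod_diff[of ?y _ ?h] unfolding tensor_piece_def by blast
  qed
  ultimately show "z \<in> tor_boundaries F i j" by (auto simp: tor_boundaries_def)
qed

section \<open>Dimensions and the vanishing of Betti numbers\<close>

lemma sum_fun_apply: "(\<Sum>x\<in>A. f x) k = (\<Sum>x\<in>A. f x k :: 'a::comm_monoid_add)"
  by (induction A rule: infinite_finite_induct) auto

text \<open>A basis of \<open>U\<close> stays independent after adding a vector of \<open>V\<close>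
  outside \<open>U\<close>, and an independent set in the span of a finite basis of \<open>V\<close>
  is no larger than that basis.\<close>

lemma kdim_strict_mono:
  fixes U V :: "(nat \<Rightarrow> 'k::field) set"
  assumes UV: "U \<subset> V" and fin: "V \<subseteq> free_mod r"
    and sub: "0 \<in> U" "\<And>x y c. x \<in> U \<Longrightarrow> y \<in> U \<Longrightarrow> (\<lambda>k. x k - c * y k) \<in> U"
  shows "kdim U < kdim V"
proof -
  interpret vs: vector_space "\<lambda>(c::'k) v. \<lambda>k::nat. c * v k"
    by unfold_locales (auto simp: fun_eq_iff algebra_simps)
  let ?e = "\<lambda>l k. if k = l then 1 else 0 :: 'k"
  have span: "v \<in> vs.span (?e ` {..<r})" if "v \<in> V" for v
  proof -
    have "v = (\<Sum>l<r. (\<lambda>k. v l * ?e l k))"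
    proof
      fix k
      have "(\<Sum>l<r. (\<lambda>k. v l * ?e l k)) k = (\<Sum>l<r. if k = l then v l else 0)"
        by (subst sum_fun_apply) (intro sum.cong, auto)
      then show "v k = (\<Sum>l<r. (\<lambda>k. v l * ?e l k)) k"
        using that fin by (auto simp: free_mod_def)
    qed
    also have "\<dots> \<in> vs.span (?e ` {..<r})"
      by (intro vs.span_sum vs.span_scale vs.span_base) auto
    finally show ?thesis .
  qed
  have subU: "vs.subspace U"
    unfolding vs.subspace_def
  proof (intro conjI allI ballI)
    show "0 \<in> U" by (rule sub)
    have neg: "(\<lambda>k. - (c * y k)) \<in> U" if "y \<in> U" for y c using sub(2)[OF sub(1) that, of c] by simp
    show "x + y \<in> U" if "x \<in> U" "y \<in> U" for x y
      using sub(2)[OF that, of "-1"] by (simp add: plus_fun_def)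
    show "(\<lambda>k. c * x k) \<in> U" if "x \<in> U" for x c using neg[OF that, of "- c"] by simp
  qed
  obtain B where B: "B \<subseteq> U" "vs.independent B" "U \<subseteq> vs.span B" "card B = vs.dim U"
    using vs.basis_exists by blast
  obtain C where C: "C \<subseteq> V" "vs.independent C" "V \<subseteq> vs.span C" "card C = vs.dim V"
    using vs.basis_exists by blast
  obtain z where z: "z \<in> V" "z \<notin> U" using UV by blast
  have "vs.span B \<subseteq> U" using B(1) subU by (rule vs.span_minimal)
  then have zB: "vs.independent (insert z B)" using z(2) B(2) by (intro vs.independent_insertI) auto
  have "finite C"
    using vs.independent_span_bound[of "?e ` {..<r}" C] C span by auto
  moreover have "insert z B \<subseteq> vs.span C" using B(1) C(3) UV z(1) by auto
  ultimately have "finite (insert z B) \<and> card (insert z B) \<le> card C"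
    using vs.independent_span_bound[OF _ zB] by simp
  moreover have "z \<notin> B" using B z by auto
  ultimately show ?thesis using B(4) C(4) by auto
qed


lemma tor_boundaries_subset:
  assumes F: "graded_free_resolution F I"
  shows "tor_boundaries F i j \<subseteq> tor_cycles F i j"
proof
  fix z assume "z \<in> tor_boundaries F i j"
  then obtain y where y: "y \<in> tensor_piece F (Suc i) j" "z = tensor_bd_map F i y"
    by (auto simp: tor_boundaries_def)
  let ?y = "const_vec y :: nat \<Rightarrow> ('a, 'b) mpoly"
  have yf: "?y \<in> free_mod (rank F (Suc i))"
    using y(1) by (intro const_vec_in_free_mod) (simp add: tensor_piece_def)
  have z: "z = reduce (bd_map F i ?y)" by (simp add: y(2) reduce_bd_map)
  have "tensor_bd_map F i' z = 0" if "i = Suc i'" for i'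
  proof -
    have "bd_map F i' (bd_map F i ?y) = 0"
      using bd_map_in_cyc[OF F yf] that by (simp add: cyc_Suc)
    then show ?thesis by (simp add: z reduce_bd_map[symmetric]) (simp add: reduce_def fun_eq_iff)
  qed
  moreover have "z \<in> tensor_piece F i j"
    unfolding z by (rule reduce_graded_map_piece[OF graded_map_bd[OF F] y(1)])
  ultimately show "z \<in> tor_cycles F i j" by (simp add: tor_cycles_def split: nat.split)
qed

text \<open>The boundaries lie in the cycles, and a proper inclusion would make the difference of
  dimensions positive by \<open>kdim_strict_mono\<close>.\<close>

lemma tor_dim_eq_0_iff:
  assumes F: "graded_free_resolution F I"
  shows "tor_dim F i j = 0 \<longleftrightarrow> tor_cycles F i j \<subseteq> tor_boundaries F i j"
proof
  assume "tor_cycles F i j \<subseteq> tor_boundaries F i j"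
  then have "tor_cycles F i j = tor_boundaries F i j" using tor_boundaries_subset[OF F] by blast
  then show "tor_dim F i j = 0" by (simp add: tor_dim_def)
next
  assume 0: "tor_dim F i j = 0"
  show "tor_cycles F i j \<subseteq> tor_boundaries F i j"
  proof (rule ccontr)
    assume "\<not> tor_cycles F i j \<subseteq> tor_boundaries F i j"
    then have "tor_boundaries F i j \<subset> tor_cycles F i j" using tor_boundaries_subset[OF F] by blast
    moreover have "tor_cycles F i j \<subseteq> free_mod (rank F i)" by (auto simp: tor_cycles_def tensor_piece_def)
    moreover have "0 \<in> tor_boundaries F i j"
      unfolding tor_boundaries_def
      by (intro image_eqI[of _ _ 0]) (auto simp: tensor_bd_map_def mat_apply_def tensor_piece_def free_mod_def)
    moreover have "(\<lambda>k. x k - c * y k) \<in> tor_boundaries F i j"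
      if xy: "x \<in> tor_boundaries F i j" "y \<in> tor_boundaries F i j" for x y c
    proof -
      obtain u v where uv: "u \<in> tensor_piece F (Suc i) j" "x = tensor_bd_map F i u"
        "v \<in> tensor_piece F (Suc i) j" "y = tensor_bd_map F i v"
        using xy by (auto simp: tor_boundaries_def)
      have "shift F (Suc i) k = j" if "u k - c * v k \<noteq> 0" for k
      proof (cases "u k = 0")
        case True
        then have "v k \<noteq> 0" using that by auto
        then show ?thesis using uv(3) by (simp add: tensor_piece_def)
      next
        case False
        then show ?thesis using uv(1) by (simp add: tensor_piece_def)
      qed
      then have "(\<lambda>k. u k - c * v k) \<in> tensor_piece F (Suc i) j"
        using uv(1,3) unfolding tensor_piece_def free_mod_def by simp
      moreover have "(\<lambda>k. x k - c * y k) = tensor_bd_map F i (\<lambda>k. u k - c * v k)"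
        unfolding uv tensor_bd_map_def mat_apply_diff_scale ..
      ultimately show ?thesis unfolding tor_boundaries_def by blast
    qed
    ultimately have "kdim (tor_boundaries F i j) < kdim (tor_cycles F i j)"
      by (rule kdim_strict_mono)
    then show False using 0 by (simp add: tor_dim_def)
  qed
qed

text \<open>Once a resolution exists, the one selected by \<open>SOME\<close> is a resolution too,
  and vanishing passes between it and \<open>F\<close>.\<close>

lemma betti_eq_0_iff:
  assumes "monomial_ideal I" "graded_free_resolution F I"
  shows "betti I i j = 0 \<longleftrightarrow> tor_cycles F i j \<subseteq> tor_boundaries F i j"
proof -
  have "graded_free_resolution (SOME F. graded_free_resolution F I) I"
    using assms(2) by (rule someI)
  then show ?thesis
    unfolding betti_def tor_dim_eq_0_iff[OF \<open>graded_free_resolution (SOME F. graded_free_resolution F I) I\<close>]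
    using tor_vanishing_transfer[OF assms(1)] assms(2) by blast
qed

section \<open>The graded resolution defined by scalar data\<close>

text \<open>On the finite type \<open>'n\<close> every function has finite support, so
  \<open>expo\<close> is inverse to \<open>lookup\<close>.\<close>

definition expo :: "('n::finite \<Rightarrow> nat) \<Rightarrow> ('n \<Rightarrow>\<^sub>0 nat)" where
  "expo f = Abs_poly_mapping f"

lemma lookup_expo [simp]: "lookup (expo f) = f"
  by (simp add: expo_def)

lemma expo_lookup [simp]: "expo (lookup m) = m"
  by (simp add: poly_mapping_eq_iff)

lemma expo_eq_add_iff: "expo f = expo g + m \<longleftrightarrow> (\<forall>x. f x = g x + lookup m x)"
  by (auto simp: poly_mapping_eq_iff lookup_add fun_eq_iff)

lemma lookup_mult_single_eq_0:
  fixes p :: "('n \<Rightarrow>\<^sub>0 nat) \<Rightarrow>\<^sub>0 'k::field"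
  assumes "\<And>m'. n \<noteq> m + m'"
  shows "lookup (Poly_Mapping.single m c * p) n = 0"
proof -
  have "n \<notin> keys (Poly_Mapping.single m c * p)"
    using keys_mult[of "Poly_Mapping.single m c" p] assms by (auto split: if_splits)
  then show ?thesis by (simp add: in_keys_iff)
qed

text \<open>The output of \<open>minimal_resolution_exists\<close> together with the description of
  \<open>I\<close> by its exponents; polynomial matrices are built from it below.\<close>

locale scalar_resolution =
  fixes J :: "('n::finite \<Rightarrow> nat) set" and I :: "('n, 'k::field) mpoly set"
    and r :: "nat \<Rightarrow> nat" and w :: "nat \<Rightarrow> nat \<Rightarrow> 'n \<Rightarrow> nat" and c :: "nat \<Rightarrow> nat \<Rightarrow> nat \<Rightarrow> 'k"
    and Z :: "nat \<Rightarrow> ('n \<Rightarrow> nat) \<Rightarrow> (nat \<Rightarrow> 'k) set"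
  assumes up: "\<And>u v. u \<in> J \<Longrightarrow> u \<le> v \<Longrightarrow> v \<in> J"
    and I_iff: "\<And>p. p \<in> I \<longleftrightarrow> (\<forall>m\<in>keys p. lookup m \<in> J)"
    and r_0: "r 0 = 1" and w_0: "w 0 0 = (\<lambda>x. 0)"
    and Z_0: "\<And>u. Z 0 u = {v \<in> free_mod 1. v 0 \<noteq> 0 \<longrightarrow> u \<in> J}"
    and Z_Suc: "\<And>i u. Z (Suc i) u = {v \<in> level (r (Suc i)) (w (Suc i)) u. mat_apply (r i) (r (Suc i)) (c i) v = 0}"
    and Z_level: "\<And>i u. Z i u \<subseteq> level (r i) (w i) u"
    and Z_less: "\<And>i u v k. v \<in> Z i u \<Longrightarrow> v k \<noteq> 0 \<Longrightarrow> w i k < u"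
    and column: "\<And>i l. l < r (Suc i) \<Longrightarrow> (\<lambda>k. c i k l) \<in> Z i (w (Suc i) l)"
    and image: "\<And>i u. mat_apply (r i) (r (Suc i)) (c i) ` level (r (Suc i)) (w (Suc i)) u = Z i u"
begin

lemma coeff_less: "l < r (Suc i) \<Longrightarrow> c i k l \<noteq> 0 \<Longrightarrow> w i k < w (Suc i) l"
  using Z_less[OF column] by blast

text \<open>Homogenization: each scalar entry is multiplied by the monomial that makes up the
  difference of multidegrees. The subtraction does not truncate at nonzero entries within the ranks,
  by \<open>coeff_less\<close>.\<close>

definition cpx :: "('n, 'k) free_cpx" where
  "cpx = \<lparr>rank = r, shift = (\<lambda>i k. int (\<Sum>x\<in>UNIV. w i k x)),
    bd = (\<lambda>i k l. Poly_Mapping.single (expo (\<lambda>x. w (Suc i) l x - w i k x)) (c i k l)), aug = (\<lambda>k. 1)\<rparr>"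

lemma cpx_simps [simp]: "rank cpx = r" "shift cpx i k = int (\<Sum>x\<in>UNIV. w i k x)"
  "bd cpx i k l = Poly_Mapping.single (expo (\<lambda>x. w (Suc i) l x - w i k x)) (c i k l)" "aug cpx k = 1"
  by (simp_all add: cpx_def)

text \<open>The degree \<open>u\<close> part of a vector of polynomials, as a vector of scalars.\<close>

definition slice :: "nat \<Rightarrow> ('n \<Rightarrow> nat) \<Rightarrow> (nat \<Rightarrow> ('n, 'k) mpoly) \<Rightarrow> (nat \<Rightarrow> 'k)" where
  "slice i u v = (\<lambda>k. if k < r i \<and> w i k \<le> u then lookup (v k) (expo (\<lambda>x. u x - w i k x)) else 0)"

lemma slice_level: "slice i u v \<in> level (r i) (w i) u"
  by (auto simp: slice_def level_def free_mod_def)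

lemma slice_zero [simp]: "slice i u 0 = 0"
  by (simp add: slice_def fun_eq_iff)

text \<open>In each multidegree the boundary acts through the scalar matrix, since the exponents add
  up. Exactness of the polynomial complex thereby reduces to that of the strands.\<close>

lemma slice_bd: "slice i u (bd_map cpx i v) = mat_apply (r i) (r (Suc i)) (c i) (slice (Suc i) u v)"
proof
  fix k
  show "slice i u (bd_map cpx i v) k = mat_apply (r i) (r (Suc i)) (c i) (slice (Suc i) u v) k"
  proof (cases "k < r i")
    case k: True
    have "(if w i k \<le> u then lookup (Poly_Mapping.single (expo (\<lambda>x. w (Suc i) l x - w i k x)) (c i k l) * v l)
        (expo (\<lambda>x. u x - w i k x)) else 0) = c i k l * slice (Suc i) u v l"
      (is "?L = _") if l: "l < r (Suc i)" for l
    proof (cases "c i k l = 0")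
      case False
      then have le: "w i k \<le> w (Suc i) l" using coeff_less[OF l] by (simp add: less_imp_le)
      show ?thesis
      proof (cases "w (Suc i) l \<le> u")
        case True
        then have "w i k \<le> u" using le by simp
        moreover have "expo (\<lambda>x. u x - w i k x) = expo (\<lambda>x. w (Suc i) l x - w i k x) + expo (\<lambda>x. u x - w (Suc i) l x)"
          using le True by (simp add: expo_eq_add_iff le_fun_def)
        ultimately show ?thesis using True l by (simp add: slice_def lookup_mult_single)
      next
        case nle: False
        have "?L = 0"
        proof (cases "w i k \<le> u")
          case True
          \<comment> \<open>The monomial of the entry does not divide the monomial whose coefficient
            is read, because \<open>w (Suc i) l\<close> is not below \<open>u\<close>.\<close>
          have "expo (\<lambda>x. u x - w i k x) \<noteq> expo (\<lambda>x. w (Suc i) l x - w i k x) + m" for m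
          proof
            assume eq: "expo (\<lambda>x. u x - w i k x) = expo (\<lambda>x. w (Suc i) l x - w i k x) + m"
            have "w (Suc i) l x \<le> u x" for x
              using eq le_funD[OF le, of x] le_funD[OF True, of x] unfolding expo_eq_add_iff
              by (drule_tac spec[of _ x]) linarith
            then show False using nle by (simp add: le_fun_def)
          qed
          then show ?thesis by (simp add: lookup_mult_single_eq_0)
        qed simp
        then show ?thesis using nle by (simp add: slice_def)
      qed
    qed simp
    note * = this
    have "slice i u (bd_map cpx i v) k = (\<Sum>l<r (Suc i). if w i k \<le> u then
        lookup (Poly_Mapping.single (expo (\<lambda>x. w (Suc i) l x - w i k x)) (c i k l) * v l) (expo (\<lambda>x. u x - w i k x)) else 0)"
      using k by (simp add: slice_def bd_map_def mat_apply_def lookup_sum)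
    also have "\<dots> = (\<Sum>l<r (Suc i). c i k l * slice (Suc i) u v l)"
      by (intro sum.cong refl *) simp
    finally show ?thesis using k by (simp add: mat_apply_def)
  qed (simp add: slice_def mat_apply_def)
qed

lemma slice_eqI:
  assumes "v \<in> free_mod (r i)" "v' \<in> free_mod (r i)" "\<And>u. slice i u v = slice i u v'"
  shows "v = v'"
proof
  fix k
  show "v k = v' k"
  proof (cases "k < r i")
    case True
    show ?thesis
    proof (rule poly_mapping_eqI)
      fix m
      have "w i k \<le> (\<lambda>x. lookup m x + w i k x)" by (simp add: le_fun_def)
      then show "lookup (v k) m = lookup (v' k) m"
        using fun_cong[OF assms(3)[of "\<lambda>x. lookup m x + w i k x"], of k] True by (simp add: slice_def)
    qed
  next
    case False
    then show ?thesis using assms(1,2) by (simp add: free_mod_def)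
  qed
qed

lemma finite_slices:
  assumes "v \<in> free_mod (r i)"
  shows "finite {u. slice i u v \<noteq> 0}"
proof (rule finite_subset)
  show "finite (\<Union>k<r i. (\<lambda>m x. lookup m x + w i k x) ` keys (v k))" by simp
  show "{u. slice i u v \<noteq> 0} \<subseteq> (\<Union>k<r i. (\<lambda>m x. lookup m x + w i k x) ` keys (v k))"
  proof
    fix u assume "u \<in> {u. slice i u v \<noteq> 0}"
    then obtain k where k: "slice i u v k \<noteq> 0" by (auto simp: fun_eq_iff)
    then have "k < r i" "w i k \<le> u" "expo (\<lambda>x. u x - w i k x) \<in> keys (v k)"
      by (auto simp: slice_def in_keys_iff split: if_splits)
    moreover have "u = (\<lambda>x. lookup (expo (\<lambda>x. u x - w i k x)) x + w i k x)"
      using \<open>w i k \<le> u\<close> by (simp add: le_fun_def)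
    ultimately show "u \<in> (\<Union>k<r i. (\<lambda>m x. lookup m x + w i k x) ` keys (v k))" by blast
  qed
qed

text \<open>The inverse of slicing: the coefficient of \<open>m\<close> in component
  \<open>k\<close> is taken from degree \<open>m + w i k\<close>. Finitely many nonzero strands
  ensure that the components are polynomials.\<close>

lemma assemble:
  assumes y: "\<And>u. y u \<in> level (r i) (w i) u" and fin: "finite {u. y u \<noteq> 0}"
  shows "\<exists>v\<in>free_mod (r i). \<forall>u. slice i u v = y u"
proof -
  define v where "v k = (if k < r i then Abs_poly_mapping (\<lambda>m. y (\<lambda>x. lookup m x + w i k x) k) else 0)" for k
  have "finite {m. y (\<lambda>x. lookup m x + w i k x) k \<noteq> 0}" for k
  proof -
    have "inj (\<lambda>m x. lookup m x + w i k x)"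
      by (auto simp: inj_def fun_eq_iff poly_mapping_eq_iff)
    then have "finite ((\<lambda>m x. lookup m x + w i k x) -` {u. y u \<noteq> 0})" by (rule finite_vimageI[OF fin])
    then show ?thesis by (rule rev_finite_subset) auto
  qed
  then have lv: "lookup (v k) m = y (\<lambda>x. lookup m x + w i k x) k" if "k < r i" for k m
    using that by (simp add: v_def)
  have "slice i u v k = y u k" for u k
  proof (cases "k < r i \<and> w i k \<le> u")
    case True
    then have "(\<lambda>x. u x - w i k x + w i k x) = u" by (auto simp: le_fun_def)
    then show ?thesis using True by (simp add: slice_def lv)
  next
    case False
    then have "y u k = 0" using level_less[OF y] y[of u] unfolding level_def by blast
    then show ?thesis using False by (auto simp: slice_def)
  qed
  then show ?thesis by (intro bexI[of _ v]) (auto simp: v_def free_mod_def)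
qed

lemma bd_map_image:
  "bd_map cpx i ` free_mod (r (Suc i)) = {v \<in> free_mod (r i). \<forall>u. slice i u v \<in> Z i u}"
proof (intro equalityI subsetI)
  fix v assume "v \<in> bd_map cpx i ` free_mod (r (Suc i))"
  then obtain y where y: "v = bd_map cpx i y" by blast
  have "slice i u v \<in> Z i u" for u
    unfolding y slice_bd image[symmetric] by (intro imageI slice_level)
  then show "v \<in> {v \<in> free_mod (r i). \<forall>u. slice i u v \<in> Z i u}"
    using bd_map_in_free_mod[of cpx i y] y by simp
next
  fix v assume v: "v \<in> {v \<in> free_mod (r i). \<forall>u. slice i u v \<in> Z i u}"
  \<comment> \<open>Preimages are chosen strand by strand, with 0 over 0, so that only finitely many
    are nonzero and they can be assembled.\<close>
  have "\<exists>y\<in>level (r (Suc i)) (w (Suc i)) u. mat_apply (r i) (r (Suc i)) (c i) y = slice i u v \<and>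
      (slice i u v = 0 \<longrightarrow> y = 0)" for u
  proof (cases "slice i u v = 0")
    case True
    then show ?thesis by (intro bexI[of _ 0]) (auto simp: level_def free_mod_def mat_apply_def)
  next
    case False
    have "slice i u v \<in> mat_apply (r i) (r (Suc i)) (c i) ` level (r (Suc i)) (w (Suc i)) u"
      using v unfolding image by simp
    then obtain y where "y \<in> level (r (Suc i)) (w (Suc i)) u" "mat_apply (r i) (r (Suc i)) (c i) y = slice i u v"
      by (elim imageE) simp
    then show ?thesis using False by blast
  qed
  then obtain y where y: "\<And>u. y u \<in> level (r (Suc i)) (w (Suc i)) u"
    "\<And>u. mat_apply (r i) (r (Suc i)) (c i) (y u) = slice i u v" "\<And>u. slice i u v = 0 \<Longrightarrow> y u = 0"
    by metis
  have "finite {u. y u \<noteq> 0}"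
  proof (rule finite_subset)
    show "{u. y u \<noteq> 0} \<subseteq> {u. slice i u v \<noteq> 0}" using y(3) by blast
    show "finite {u. slice i u v \<noteq> 0}" using finite_slices v by simp
  qed
  from assemble[OF y(1) this] obtain v' where v': "v' \<in> free_mod (r (Suc i))" "\<forall>u. slice (Suc i) u v' = y u"
    by blast
  have "v = bd_map cpx i v'"
  proof (rule slice_eqI)
    show "v \<in> free_mod (r i)" using v by simp
    show "bd_map cpx i v' \<in> free_mod (r i)" using bd_map_in_free_mod[of cpx i v'] by simp
    show "slice i u v = slice i u (bd_map cpx i v')" for u using v'(2) y(2) by (simp add: slice_bd)
  qed
  then show "v \<in> bd_map cpx i ` free_mod (r (Suc i))" using v'(1) by blast
qed

text \<open>Exactness at the free modules follows from \<open>bd_map_image\<close>, once the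
  condition on slices is recognised as membership of the augmentation in \<open>I\<close> in degree
  0 and as being a cycle in higher degrees.\<close>

lemma graded_free_resolution_cpx: "graded_free_resolution cpx I"
  unfolding graded_free_resolution_def
proof (intro conjI allI impI)
  show "homogeneous (aug cpx k) (shift cpx 0 k)" if "k < rank cpx 0" for k
    using that by (simp add: r_0 w_0)
  show "homogeneous (bd cpx i k l) (shift cpx (Suc i) l - shift cpx i k)"
    if "k < rank cpx i" "l < rank cpx (Suc i)" for i k l
  proof (cases "c i k l = 0")
    case False
    then have "w i k \<le> w (Suc i) l" using coeff_less that(2) by (simp add: less_imp_le)
    then have "int (\<Sum>x\<in>UNIV. w (Suc i) l x - w i k x) = (\<Sum>x\<in>UNIV. int (w (Suc i) l x) - int (w i k x))"
      by (simp add: of_nat_diff le_fun_def)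
    then show ?thesis by (simp add: homogeneous_def total_degree_def sum_subtractf)
  qed simp
  \<comment> \<open>The module in degree 0 is the ring itself and its augmentation is the
    identity.\<close>
  show "\<exists>v\<in>free_mod (rank cpx 0). aug_map cpx v - p \<in> I" for p
    by (intro bexI[of _ "\<lambda>k. if k = 0 then p else 0"]) (auto simp: aug_map_def r_0 free_mod_def I_iff)
  have "(\<forall>u. slice 0 u v \<in> Z 0 u) \<longleftrightarrow> aug_map cpx v \<in> I" if "v \<in> free_mod (r 0)" for v
  proof -
    have s: "slice 0 u v 0 = lookup (v 0) (expo u)" for u
      by (simp add: slice_def r_0 w_0 le_fun_def)
    have "(\<forall>u. slice 0 u v \<in> Z 0 u) \<longleftrightarrow> (\<forall>u. lookup (v 0) (expo u) \<noteq> 0 \<longrightarrow> u \<in> J)"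
      using slice_level[of 0 _ v] by (simp add: Z_0 s level_def r_0)
    also have "\<dots> \<longleftrightarrow> (\<forall>m. lookup (v 0) m \<noteq> 0 \<longrightarrow> lookup m \<in> J)"
      by (metis expo_lookup lookup_expo)
    also have "\<dots> \<longleftrightarrow> aug_map cpx v \<in> I"
      by (auto simp: aug_map_def r_0 I_iff in_keys_iff)
    finally show ?thesis .
  qed
  then show "bd_map cpx 0 ` free_mod (rank cpx 1) = {v \<in> free_mod (rank cpx 0). aug_map cpx v \<in> I}"
    using bd_map_image[of 0] by auto
  fix i
  have "(\<forall>u. slice (Suc i) u v \<in> Z (Suc i) u) \<longleftrightarrow> bd_map cpx i v = 0" for v
  proof -
    have "(\<forall>u. slice (Suc i) u v \<in> Z (Suc i) u) \<longleftrightarrow> (\<forall>u. slice i u (bd_map cpx i v) = 0)"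
      using slice_level by (simp add: Z_Suc slice_bd)
    also have "\<dots> \<longleftrightarrow> bd_map cpx i v = 0"
      using slice_eqI[of "bd_map cpx i v" i 0] bd_map_in_free_mod[of cpx i v]
      by (auto simp: free_mod_def)
    finally show ?thesis .
  qed
  then show "bd_map cpx (Suc i) ` free_mod (rank cpx (Suc (Suc i))) =
      {v \<in> free_mod (rank cpx (Suc i)). bd_map cpx i v = 0}"
    using bd_map_image[of "Suc i"] by simp
qed

text \<open>Minimality: a nonzero entry raises the multidegree strictly, so its monomial is not
  constant.\<close>

lemma tensor_bd_map_cpx: "tensor_bd_map cpx i v = 0"
proof -
  have "lookup (bd cpx i k l) 0 = 0" if "l < r (Suc i)" for k l
  proof (cases "c i k l = 0")
    case False
    have "expo (\<lambda>x. w (Suc i) l x - w i k x) \<noteq> 0"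
    proof
      assume "expo (\<lambda>x. w (Suc i) l x - w i k x) = 0"
      then have "w (Suc i) l x - w i k x = 0" for x by (metis lookup_expo lookup_zero)
      then have "w (Suc i) l \<le> w i k" by (simp add: le_fun_def)
      then show False using coeff_less[OF that False] by (simp add: leD)
    qed
    then show ?thesis by (simp add: lookup_single)
  qed simp
  then show ?thesis by (simp add: tensor_bd_map_def mat_apply_def fun_eq_iff)
qed

text \<open>All boundaries vanish after tensoring, so Tor is the tensored complex itself and lives
  exactly in the degrees of the generators.\<close>

lemma betti_nonzero_iff:
  assumes "monomial_ideal I"
  shows "betti I i j \<noteq> 0 \<longleftrightarrow> (\<exists>k<r i. int (\<Sum>x\<in>UNIV. w i k x) = j)"
proof -
  have cyc: "tor_cycles cpx i j = tensor_piece cpx i j"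
    by (cases i) (simp_all add: tor_cycles_def tensor_bd_map_cpx)
  have "0 \<in> tor_boundaries cpx i j"
    unfolding tor_boundaries_def
    by (intro image_eqI[of _ _ 0]) (auto simp: tensor_bd_map_cpx tensor_piece_def free_mod_def)
  then have bnd: "tor_boundaries cpx i j = {0}"
    by (auto simp: tor_boundaries_def tensor_bd_map_cpx)
  have "betti I i j \<noteq> 0 \<longleftrightarrow> (\<exists>v\<in>tensor_piece cpx i j. v \<noteq> 0)"
    unfolding betti_eq_0_iff[OF assms graded_free_resolution_cpx] cyc bnd subset_iff by auto
  also have "\<dots> \<longleftrightarrow> (\<exists>k<r i. int (\<Sum>x\<in>UNIV. w i k x) = j)"
  proof
    assume "\<exists>v\<in>tensor_piece cpx i j. v \<noteq> 0"
    then obtain v where v: "v \<in> tensor_piece cpx i j" "v \<noteq> 0" by blast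
    from v(2) obtain k where k: "v k \<noteq> 0" by (auto simp: fun_eq_iff)
    have "k < r i" using v(1) k by (intro not_le_imp_less) (auto simp: tensor_piece_def free_mod_def)
    moreover have "int (\<Sum>x\<in>UNIV. w i k x) = j"
      using v(1) k by (simp add: tensor_piece_def del: of_nat_sum)
    ultimately show "\<exists>k<r i. int (\<Sum>x\<in>UNIV. w i k x) = j" by blast
  next
    assume "\<exists>k<r i. int (\<Sum>x\<in>UNIV. w i k x) = j"
    then obtain k where k: "k < r i" "int (\<Sum>x\<in>UNIV. w i k x) = j" by blast
    let ?v = "\<lambda>l. if l = k then 1 else 0 :: 'k"
    have "?v \<in> tensor_piece cpx i j" using k by (auto simp: tensor_piece_def free_mod_def)
    moreover have "?v \<noteq> 0" by (auto simp: fun_eq_iff)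
    ultimately show "\<exists>v\<in>tensor_piece cpx i j. v \<noteq> 0" by blast
  qed
  finally show ?thesis .
qed

end

section \<open>Subadditivity of the maximal shifts\<close>

context scalar_resolution
begin

text \<open>Basis elements of all homological degrees are gathered in one type, as pairs of a
  homological degree and an index.\<close>

definition chain :: "nat \<Rightarrow> (nat \<Rightarrow> 'k) \<Rightarrow> (nat \<times> nat \<Rightarrow>\<^sub>0 'k)" where
  "chain n y = (\<Sum>l<r n. Poly_Mapping.single (n, l) (y l))"

definition chain_bd :: "nat \<times> nat \<Rightarrow> (nat \<times> nat \<Rightarrow>\<^sub>0 'k)" where
  "chain_bd = (\<lambda>(n, l). case n of 0 \<Rightarrow> 0 | Suc i \<Rightarrow> chain i (\<lambda>k. c i k l))"

lemma lookup_chain: "lookup (chain n y) p = (if fst p = n \<and> snd p < r n then y (snd p) else 0)"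
proof -
  have "lookup (chain n y) p = (\<Sum>l<r n. if l = snd p then (if fst p = n then y (snd p) else 0) else 0)"
    unfolding chain_def lookup_sum by (intro sum.cong refl) (cases p, auto simp: lookup_single when_def)
  then show ?thesis by auto
qed

lemma lookup_ext_chain_bd:
  assumes "keys v \<subseteq> {p. fst p = Suc i \<and> snd p < r (Suc i)}"
  shows "lookup (ext chain_bd v) p =
    (if fst p = i then mat_apply (r i) (r (Suc i)) (c i) (\<lambda>l. lookup v (Suc i, l)) (snd p) else 0)"
proof -
  have "keys v \<subseteq> Pair (Suc i) ` {..<r (Suc i)}" using assms by force
  then have "lookup (ext chain_bd v) p =
      (\<Sum>b\<in>Pair (Suc i) ` {..<r (Suc i)}. lookup v b * lookup (chain_bd b) p)"
    by (intro lookup_ext) auto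
  also have "\<dots> = (\<Sum>l<r (Suc i). lookup v (Suc i, l) * lookup (chain_bd (Suc i, l)) p)"
    by (subst sum.reindex) (auto simp: inj_on_def)
  also have "\<dots> = (if fst p = i then mat_apply (r i) (r (Suc i)) (c i) (\<lambda>l. lookup v (Suc i, l)) (snd p) else 0)"
    by (auto simp: chain_bd_def lookup_chain mat_apply_def mult.commute)
  finally show ?thesis .
qed

text \<open>A zero column would make its basis vector a cycle with a component in its own degree,
  against \<open>Z_less\<close>.\<close>

lemma column_nonzero:
  assumes "l < r (Suc i)"
  shows "\<exists>k. c i k l \<noteq> 0"
proof (rule ccontr)
  assume "\<not> ?thesis"
  then have 0: "c i k l = 0" for k by blast
  let ?e = "\<lambda>m. if m = l then 1 else 0 :: 'k"
  have "(\<Sum>m<r (Suc i). c i k m * ?e m) = 0" for k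
    using 0 by (intro sum.neutral) auto
  then have "mat_apply (r i) (r (Suc i)) (c i) ?e = 0"
    by (simp add: mat_apply_def fun_eq_iff)
  then have "?e \<in> Z (Suc i) (w (Suc i) l)"
    using assms by (simp add: Z_Suc level_def free_mod_def)
  from Z_less[OF this, of l] show False by simp
qed

text \<open>Follow nonzero entries down to homological degree 1, where the columns lie in the ideal.
  Degrees decrease along the way and \<open>J\<close> is closed upwards.\<close>

lemma degree_in_J: "l < r (Suc i) \<Longrightarrow> w (Suc i) l \<in> J"
proof (induction i arbitrary: l)
  case (0 l)
  obtain k where k: "c 0 k l \<noteq> 0" using column_nonzero[OF 0] by blast
  have col: "(\<lambda>k. c 0 k l) \<in> Z 0 (w (Suc 0) l)" using column[OF 0] .
  then have "k = 0" using k by (cases k) (auto simp: Z_0 free_mod_def)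
  then show ?case using col k by (simp add: Z_0)
next
  case (Suc i l)
  obtain k where k: "c (Suc i) k l \<noteq> 0" using column_nonzero[OF Suc.prems] by blast
  have "(\<lambda>k. c (Suc i) k l) \<in> level (r (Suc i)) (w (Suc i)) (w (Suc (Suc i)) l)"
    using column[OF Suc.prems] Z_level by blast
  from level_less[OF this k] have "w (Suc i) k \<in> J" by (rule Suc.IH)
  then show ?case using up coeff_less[OF Suc.prems k] by (meson less_imp_le)
qed

text \<open>Makes the abstract splitting argument available for the scalar matrices.\<close>

lemma multigraded_resolution:
  "multigraded_resolution {p. snd p < r (fst p)} fst (\<lambda>p. w (fst p) (snd p)) chain_bd (0, 0)"
proof
  show "(0, 0) \<in> {p. snd p < r (fst p)}" by (simp add: r_0)
  show "fst (0, 0) = 0" by simp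
  show "b = (0, 0)" if "b \<in> {p. snd p < r (fst p)}" "fst b = 0" for b :: "nat \<times> nat"
    using that by (cases b) (simp add: r_0)
  show "w (fst (0, 0)) (snd (0, 0)) \<le> w (fst b) (snd b)" for b
    by (simp add: w_0 le_fun_def)
next
  fix b p assume b: "b \<in> {p. snd p < r (fst p)}" and p: "p \<in> keys (chain_bd b)"
  obtain i l where [simp]: "b = (Suc i, l)"
    using p by (cases b) (auto simp: chain_bd_def split: nat.splits)
  have "fst p = i" "snd p < r i" "c i (snd p) l \<noteq> 0"
    using p by (auto simp: chain_bd_def in_keys_iff lookup_chain split: if_splits)
  then show "p \<in> {p. snd p < r (fst p)} \<and> fst b = Suc (fst p) \<and> w (fst p) (snd p) < w (fst b) (snd b)"
    using coeff_less[of l i "snd p"] b by simp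
next
  fix b assume b: "b \<in> {p. snd p < r (fst p)}"
  show "ext chain_bd (chain_bd b) = 0"
  proof (cases "\<exists>i l. b = (Suc (Suc i), l)")
    case True
    then obtain i l where [simp]: "b = (Suc (Suc i), l)" by blast
    have "(\<lambda>k. c (Suc i) k l) \<in> Z (Suc i) (w (Suc (Suc i)) l)" using b by (intro column) simp
    then have col: "(\<lambda>k. c (Suc i) k l) \<in> level (r (Suc i)) (w (Suc i)) (w (Suc (Suc i)) l)"
      "mat_apply (r i) (r (Suc i)) (c i) (\<lambda>k. c (Suc i) k l) = 0"
      by (simp_all add: Z_Suc)
    have "(\<lambda>k. lookup (chain_bd b) (Suc i, k)) = (\<lambda>k. c (Suc i) k l)"
      using level_less[OF col(1)] by (auto simp: chain_bd_def lookup_chain fun_eq_iff)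
    moreover have "keys (chain_bd b) \<subseteq> {p. fst p = Suc i \<and> snd p < r (Suc i)}"
      by (auto simp: chain_bd_def in_keys_iff lookup_chain split: if_splits)
    ultimately show ?thesis
      using col(2) by (intro poly_mapping_eqI) (simp add: lookup_ext_chain_bd)
  next
    case False
    \<comment> \<open>Below homological degree 2 the second boundary is 0 by definition.\<close>
    have "chain_bd p = 0" if "p \<in> keys (chain_bd b)" for p
    proof -
      have "fst b = Suc (fst p)"
        using that by (cases b) (auto simp: chain_bd_def in_keys_iff lookup_chain split: nat.splits if_splits)
      then have "fst p = 0" using False by (cases b, cases "fst p") auto
      then show ?thesis by (cases p) (simp add: chain_bd_def)
    qed
    then have "ext chain_bd (chain_bd b) = ext (\<lambda>p. 0) (chain_bd b)" by (rule ext_cong)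
    then show ?thesis by simp
  qed
next
  fix b u n v
  assume b: "b \<in> {p. snd p < r (fst p)}" "0 < fst b" "w (fst b) (snd b) \<le> u"
    and v: "keys v \<subseteq> {p \<in> {p. snd p < r (fst p)}. fst p = n \<and> w (fst p) (snd p) \<le> u}" "ext chain_bd v = 0"
  \<comment> \<open>The basis element \<open>b\<close> puts \<open>u\<close> into the ideal, so
    \<open>Z 0 u\<close> is the whole strand in homological degree 0 and exactness holds there
    too.\<close>
  have uJ: "u \<in> J"
    using degree_in_J[of "snd b" "fst b - 1"] b up by auto
  let ?x = "\<lambda>k. lookup v (n, k)"
  have x: "?x \<in> level (r n) (w n) u"
  proof -
    have "k < r n \<and> w n k \<le> u" if "?x k \<noteq> 0" for k
    proof -
      have "(n, k) \<in> keys v" using that by (simp add: in_keys_iff)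
      then show ?thesis using v(1) by auto
    qed
    then show ?thesis by (force simp: level_def free_mod_def)
  qed
  have "?x \<in> Z n u"
  proof (cases n)
    case 0
    then show ?thesis using x uJ by (simp add: Z_0 level_def r_0)
  next
    case (Suc i)
    have "keys v \<subseteq> {p. fst p = Suc i \<and> snd p < r (Suc i)}" using v(1) Suc by auto
    from lookup_ext_chain_bd[OF this] have "mat_apply (r i) (r n) (c i) ?x k = 0" for k
      using v(2) Suc by (metis fst_conv lookup_zero snd_conv)
    then show ?thesis using x Suc by (simp add: Z_Suc fun_eq_iff)
  qed
  then have "?x \<in> mat_apply (r n) (r (Suc n)) (c n) ` level (r (Suc n)) (w (Suc n)) u" by (simp add: image)
  then obtain y where y: "y \<in> level (r (Suc n)) (w (Suc n)) u" "mat_apply (r n) (r (Suc n)) (c n) y = ?x"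
    by (elim imageE) simp
  have "keys (chain (Suc n) y) \<subseteq> {p \<in> {p. snd p < r (fst p)}. fst p = Suc n \<and> w (fst p) (snd p) \<le> u}"
    using y(1) by (auto simp: in_keys_iff lookup_chain level_def split: if_splits)
  moreover have "ext chain_bd (chain (Suc n) y) = v"
  proof (rule poly_mapping_eqI)
    fix p
    have "(\<lambda>l. lookup (chain (Suc n) y) (Suc n, l)) = y"
      using level_less[OF y(1)] by (auto simp: lookup_chain fun_eq_iff)
    moreover have "keys (chain (Suc n) y) \<subseteq> {p. fst p = Suc n \<and> snd p < r (Suc n)}"
      by (auto simp: in_keys_iff lookup_chain split: if_splits)
    moreover have "lookup v p = 0" if "fst p \<noteq> n" using v(1) that by (auto simp: in_keys_iff)
    ultimately show "lookup (ext chain_bd (chain (Suc n) y)) p = lookup v p"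
      using y(2) by (cases p) (simp add: lookup_ext_chain_bd)
  qed
  ultimately show "\<exists>y. keys y \<subseteq> {p \<in> {p. snd p < r (fst p)}. fst p = Suc n \<and> w (fst p) (snd p) \<le> u} \<and>
      ext chain_bd y = v" by (intro exI[of _ "chain (Suc n) y"] conjI)
qed

lemma degree_splits:
  assumes "k < r (a + b)" "0 < a" "0 < b"
  shows "\<exists>p<r a. \<exists>q<r b. sup (w a p) (w b q) = w (a + b) k"
  using multigraded_resolution.degree_splits[OF multigraded_resolution, of "(a + b, k)" a b] assms by auto

section \<open>Maximal shifts in terms of the degrees of generators\<close>

lemma betti_degrees:
  assumes "monomial_ideal I"
  shows "{j. betti I i j \<noteq> 0} = (\<lambda>k. int (\<Sum>x\<in>UNIV. w i k x)) ` {..<r i}"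
  unfolding betti_nonzero_iff[OF assms] by auto

lemma betti_degree_le_max_shift:
  assumes "monomial_ideal I" "k < r i"
  shows "int (\<Sum>x\<in>UNIV. w i k x) \<le> max_shift I i"
proof -
  have k: "int (\<Sum>x\<in>UNIV. w i k x) \<in> {j. betti I i j \<noteq> 0}"
    unfolding betti_degrees[OF assms(1)] using assms(2) by blast
  moreover have "finite {j. betti I i j \<noteq> 0}" unfolding betti_degrees[OF assms(1)] by simp
  ultimately have "int (\<Sum>x\<in>UNIV. w i k x) \<le> Max {j. betti I i j \<noteq> 0}" by (intro Max_ge)
  moreover have "\<not> (\<forall>j. betti I i j = 0)"
  proof
    assume "\<forall>j. betti I i j = 0"
    from spec[OF this] k show False by simp
  qed
  ultimately show ?thesis unfolding max_shift_def by (simp only: if_False)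
qed

lemma max_shift_cases:
  assumes "monomial_ideal I"
  shows "max_shift I i = 0 \<or> (\<exists>k<r i. max_shift I i = int (\<Sum>x\<in>UNIV. w i k x))"
proof (cases "\<forall>j. betti I i j = 0")
  case True
  then show ?thesis by (simp add: max_shift_def)
next
  case False
  then have "max_shift I i = Max {j. betti I i j \<noteq> 0}" by (simp only: max_shift_def if_False)
  moreover have "Max {j. betti I i j \<noteq> 0} \<in> {j. betti I i j \<noteq> 0}"
  proof (rule Max_in)
    show "finite {j. betti I i j \<noteq> 0}" unfolding betti_degrees[OF assms] by simp
    show "{j. betti I i j \<noteq> 0} \<noteq> {}" using False by blast
  qed
  ultimately show ?thesis using betti_nonzero_iff[OF assms] by auto
qed

lemma max_shift_nonneg:
  assumes "monomial_ideal I" shows "0 \<le> max_shift I i"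
  using max_shift_cases[OF assms, of i] by (elim disjE exE conjE) (simp_all add: sum_nonneg)

text \<open>The multidegree of a generator attaining the shift in degree \<open>a + b\<close> is a
  supremum of one from degree \<open>a\<close> and one from degree \<open>b\<close>, and a supremum
  of exponent vectors is bounded by their sum.\<close>

lemma max_shift_subadditive:
  assumes I: "monomial_ideal I"
  shows "max_shift I (a + b) \<le> max_shift I a + max_shift I b"
proof (cases "a = 0 \<or> b = 0")
  case True
  \<comment> \<open>One of the two shifts on the right is the left side, and the other is
    nonnegative.\<close>
  then show ?thesis using max_shift_nonneg[OF I] by auto
next
  case False
  from max_shift_cases[OF I, of "a + b"] show ?thesis
  proof (elim disjE exE conjE)
    assume "max_shift I (a + b) = 0"
    then show ?thesis using max_shift_nonneg[OF I, of a] max_shift_nonneg[OF I, of b] by simp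
  next
    fix k assume k: "k < r (a + b)" "max_shift I (a + b) = int (\<Sum>x\<in>UNIV. w (a + b) k x)"
    obtain p q where pq: "p < r a" "q < r b" "sup (w a p) (w b q) = w (a + b) k"
      using degree_splits[OF k(1)] False by auto
    have "(\<Sum>x\<in>UNIV. w (a + b) k x) \<le> (\<Sum>x\<in>UNIV. w a p x + w b q x)"
      unfolding pq(3)[symmetric] by (intro sum_mono) (simp add: sup_nat_def)
    then have "max_shift I (a + b) \<le> int (\<Sum>x\<in>UNIV. w a p x) + int (\<Sum>x\<in>UNIV. w b q x)"
      unfolding k(2) by (simp only: sum.distrib of_nat_add[symmetric] of_nat_le_iff)
    also have "\<dots> \<le> max_shift I a + max_shift I b"
      by (intro add_mono betti_degree_le_max_shift[OF I] pq)
    finally show ?thesis .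
  qed
qed

end

text \<open>The quotient is zero and the zero complex resolves it, so all Betti numbers vanish and
  the default value of the maximal shift takes effect.\<close>

lemma max_shift_UNIV:
  assumes "monomial_ideal (UNIV :: ('n::finite, 'k::field) mpoly set)"
  shows "max_shift (UNIV :: ('n, 'k) mpoly set) i = 0"
proof -
  let ?F = "\<lparr>rank = (\<lambda>i. 0), shift = (\<lambda>i k. 0), bd = (\<lambda>i k l. 0), aug = (\<lambda>k. 0)\<rparr> :: ('n, 'k) free_cpx"
  have free: "free_mod 0 = {0 :: nat \<Rightarrow> 'a::zero}" by (auto simp: free_mod_def fun_eq_iff)
  have bd: "bd_map ?F i v = 0" for i v by (simp add: bd_map_def mat_apply_def fun_eq_iff)
  have "graded_free_resolution ?F UNIV"
    by (simp add: graded_free_resolution_def bd free)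
  moreover have "tor_cycles ?F i j \<subseteq> tor_boundaries ?F i j" for i j
  proof -
    have "tor_cycles ?F i j \<subseteq> {0}" by (auto simp: tor_cycles_def tensor_piece_def free)
    moreover have "0 \<in> tor_boundaries ?F i j"
      unfolding tor_boundaries_def
      by (intro image_eqI[of _ _ 0]) (simp_all add: tensor_bd_map_def mat_apply_def tensor_piece_def free fun_eq_iff)
    ultimately show ?thesis by blast
  qed
  ultimately show ?thesis
    using betti_eq_0_iff[OF assms] by (simp add: max_shift_def)
qed

theorem theorem1p3:
  fixes I :: "('n::finite, 'k::field) mpoly set"
    and i1 i2 :: nat
  assumes "monomial_ideal I"
  shows "max_shift I (i1 + i2) \<le> max_shift I i1 + max_shift I i2"
proof -
  obtain J where J: "\<And>u v. u \<in> J \<Longrightarrow> u \<le> v \<Longrightarrow> v \<in> J" "\<And>p. p \<in> I \<longleftrightarrow> (\<forall>m\<in>keys p. lookup m \<in> J)"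
    by (rule monomial_idealE[OF assms]) (rule that)
  show ?thesis
  proof (cases "(\<lambda>x. 0) \<in> J")
    case True
    \<comment> \<open>The unit ideal is treated apart because the minimal resolution, starting from
      a module of rank 1, is built for proper ideals.\<close>
    have "u \<in> J" for u using J(1)[OF True] by (simp add: le_fun_def)
    then have "I = UNIV" using J(2) by auto
    then show ?thesis using assms by (simp add: max_shift_UNIV)
  next
    case False
    obtain r w and c :: "nat \<Rightarrow> nat \<Rightarrow> nat \<Rightarrow> 'k" and Z where
      "r 0 = 1" "w 0 0 = (\<lambda>x. 0)" "\<And>u. Z 0 u = {v \<in> free_mod 1. v 0 \<noteq> 0 \<longrightarrow> u \<in> J}"
      "\<And>i u. Z (Suc i) u = {v \<in> level (r (Suc i)) (w (Suc i)) u. mat_apply (r i) (r (Suc i)) (c i) v = 0}"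
      "\<And>i u. Z i u \<subseteq> level (r i) (w i) u"
      "\<And>i u v k. v \<in> Z i u \<Longrightarrow> v k \<noteq> 0 \<Longrightarrow> w i k < u"
      "\<And>i l. l < r (Suc i) \<Longrightarrow> (\<lambda>k. c i k l) \<in> Z i (w (Suc i) l)"
      "\<And>i u. mat_apply (r i) (r (Suc i)) (c i) ` level (r (Suc i)) (w (Suc i)) u = Z i u"
      by (rule minimal_resolution_exists[of J], erule (1) J(1), rule False) (rule that)
    then interpret scalar_resolution J I r w c Z
      using J by unfold_locales
    show ?thesis by (rule max_shift_subadditive[OF assms])
  qed
qed

end
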